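(* $\mathrm{MC}(\overline{\phantom{c}},/)$ is $\mathrm{P}$-hard under logarithmic-space many-one reductions.
   Context: Natural numbers include $0$. For $A,B\subseteq\mathbb N$: $A\cup B$, $A\cap B$ are the usual operations, $\overline{A}=\mathbb N\setminus A$, $A+B=\{a+b: a\in A, b\in B\}$, $A\times B=\{a\cdot b: a\in A, b\in B\}$, and $A/B=\{c\in\mathbb N:\exists a\in A\ \exists b\in B\setminus\{0\}: a=c\cdot b\}$ (exact integer division without remainder or rounding). For $\emptyset\ne\mathcal O\subseteq\{\cup,\cap,\overline{\phantom{c}},+,\times,/\}$, an $\mathcal O$-circuit $C=(V,E,g_C,\alpha)$ is a finite acyclic directed multigraph with gate set $V\subseteq\mathbb N$, every gate having indegree $0$, $1$ or $2$, a designated output gate $g_C\in V$, and a labeling $\alpha$: gates of indegree $0$ (input gates) are labeled by natural numbers, gates of indegree $1$ are labeled $\overline{\phantom{c}}$ (allowed only if $\overline{\phantom{c}}\in\mathcal O$), and gates of indegree $2$ are labeled by an operation in $\mathcal O\setminus\{\overline{\phantom{c}}\}$. The result set $I(g)\subseteq\mathbb N$ is defined inductively: $I(g)=\{\alpha(g)\}$ for an input gate; $I(g)=\mathbb N\setminus I(p)$ for a complement gate with predecessor $p$; $I(g)=I(g_1)\,\sigma\,I(g_2)$ for a gate labeled $\sigma$ with predecessors $g_1\le g_2$ (a double edge from one gate gives $g_1=g_2$). $I(C)=I(g_C)$. A circuit is encoded as a bit string listing its gates in reverse topological order, each gate as the triple (gate name, label, list of predecessors), with all numbers (including input labels) in binary;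 $|C|$ denotes the length of this encoding. The membership problem is $\mathrm{MC}(\mathcal O)=\{(C,b): C \text{ is an } \mathcal O\text{-circuit},\ b\in\mathbb N,\ b\in I(C)\}$, with $b$ given in binary; $\mathrm{MC}(\sigma_1,\dots,\sigma_n)$ abbreviates $\mathrm{MC}(\{\sigma_1,\dots,\sigma_n\})$. *)

theory Defs
  imports Complex_Main
begin

datatype op = Cup | Cap | Neg | Plus | Times | Divide

datatype label = Input nat | Gate op

text \<open>A gate is a triple (gate name, label, list of predecessors).
  A circuit is a pair (output gate name, list of gates in reverse topological
  order, i.e. every predecessor of a gate is listed after that gate).\<close>
type_synonym gate = "nat \<times> label \<times> nat list"
type_synonym circuit = "nat \<times> gate list"

definition is_circuit :: "op set \<Rightarrow> circuit \<Rightarrow> bool" where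
  "is_circuit Ops C \<longleftrightarrow> (case C of (g, gs) \<Rightarrow>
     Ops \<noteq> {} \<and> distinct (map fst gs) \<and> g \<in> fst ` set gs \<and>
     (\<forall>i<length gs. case gs ! i of (n, l, ps) \<Rightarrow>
        set ps \<subseteq> fst ` set (drop (Suc i) gs) \<and>
        (case l of
           Input a \<Rightarrow> ps = []
         | Gate Neg \<Rightarrow> Neg \<in> Ops \<and> length ps = 1
         | Gate \<sigma> \<Rightarrow> \<sigma> \<in> Ops \<and> length ps = 2)))"

fun setop :: "op \<Rightarrow> nat set \<Rightarrow> nat set \<Rightarrow> nat set" where
  "setop Cup A B = A \<union> B"
| "setop Cap A B = A \<inter> B"
| "setop Neg A B = UNIV - A"
| "setop Plus A B = {a + b | a b. a \<in> A \<and> b \<in> B}"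
| "setop Times A B = {a * b | a b. a \<in> A \<and> b \<in> B}"
| "setop Divide A B = {c. \<exists>a\<in>A. \<exists>b\<in>B - {0}. a = c * b}"

fun gval :: "label \<Rightarrow> nat set list \<Rightarrow> nat set" where
  "gval (Input a) xs = {a}"
| "gval (Gate Neg) xs = UNIV - hd xs"
| "gval (Gate \<sigma>) xs = setop \<sigma> (xs ! 0) (xs ! 1)"

text \<open>Result sets of all gates; predecessors are sorted so that the operation
  is applied as I(g1) op I(g2) with g1 \<le> g2.\<close>
fun vals :: "gate list \<Rightarrow> nat \<Rightarrow> nat set" where
  "vals [] = (\<lambda>_. {})"
| "vals ((n, l, ps) # rest) = (vals rest)(n := gval l (map (vals rest) (sort ps)))"

definition circuit_value :: "circuit \<Rightarrow> nat set" where
  "circuit_value C = vals (snd C) (fst C)"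

fun bin :: "nat \<Rightarrow> bool list" where
  "bin n = (if n < 2 then [n = 1] else bin (n div 2) @ [odd n])"

datatype sym = Bit bool | Open | Close | Comma | In | OpSym op

fun opidx :: "op \<Rightarrow> nat" where
  "opidx Cup = 0" | "opidx Cap = 1" | "opidx Neg = 2"
| "opidx Plus = 3" | "opidx Times = 4" | "opidx Divide = 5"

fun symidx :: "sym \<Rightarrow> nat" where
  "symidx (Bit False) = 0" | "symidx (Bit True) = 1" | "symidx Open = 2"
| "symidx Close = 3" | "symidx Comma = 4" | "symidx In = 5"
| "symidx (OpSym \<sigma>) = 6 + opidx \<sigma>"

definition fixed4 :: "nat \<Rightarrow> bool list" where
  "fixed4 k = [odd (k div 8), odd (k div 4), odd (k div 2), odd k]"

definition enc_nat :: "nat \<Rightarrow> sym list" where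
  "enc_nat n = map Bit (bin n)"

fun enc_label :: "label \<Rightarrow> sym list" where
  "enc_label (Input a) = In # enc_nat a"
| "enc_label (Gate \<sigma>) = [OpSym \<sigma>]"

fun enc_gate :: "gate \<Rightarrow> sym list" where
  "enc_gate (n, l, ps) = [Open] @ enc_nat n @ [Comma] @ enc_label l @ [Comma, Open]
     @ concat (map (\<lambda>p. enc_nat p @ [Comma]) ps) @ [Close, Close]"

definition enc_instance :: "circuit \<Rightarrow> nat \<Rightarrow> bool list" where
  "enc_instance C b = concat (map (fixed4 \<circ> symidx)
     ([Open] @ enc_nat (fst C) @ [Comma] @ concat (map enc_gate (snd C))
      @ [Comma] @ enc_nat b @ [Close]))"

definition MC :: "op set \<Rightarrow> bool list set" where
  "MC Ops = {enc_instance C b | C b. is_circuit Ops C \<and> b \<in> circuit_value C}"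

text \<open>Deterministic machine with a two-way read-only input tape (positions 0 and
  length w + 1 read as end markers None), k work tapes over {0..<syms}
  (0 = blank), and a one-way write-only binary output tape.
  Transition: state, input symbol, work symbols \<mapsto>
  (new state, input move, (write symbol, move) per work tape, optional output bit).\<close>
record tm =
  tm_states :: nat
  tm_syms :: nat
  tm_tapes :: nat
  tm_start :: nat
  tm_acc :: nat
  tm_rej :: nat
  tm_delta :: "nat \<Rightarrow> bool option \<Rightarrow> nat list \<Rightarrow> nat \<times> int \<times> (nat \<times> int) list \<times> bool option"

definition tm_wf :: "tm \<Rightarrow> bool" where
  "tm_wf M \<longleftrightarrow> tm_start M < tm_states M \<and> tm_acc M < tm_states M \<and>
     tm_rej M < tm_states M \<and> tm_acc M \<noteq> tm_rej M \<and> 0 < tm_syms M \<and>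
     (\<forall>q<tm_states M. \<forall>x ss. length ss = tm_tapes M \<and> set ss \<subseteq> {..<tm_syms M} \<longrightarrow>
        (case tm_delta M q x ss of (q', d, ops, ob) \<Rightarrow>
           q' < tm_states M \<and> d \<in> {-1, 0, 1} \<and> length ops = tm_tapes M \<and>
           (\<forall>(s, e)\<in>set ops. s < tm_syms M \<and> e \<in> {-1, 0, 1})))"

text \<open>Configuration: (state, input head, work tape contents, work heads, output).\<close>
type_synonym cfg = "nat \<times> nat \<times> (nat \<Rightarrow> nat) list \<times> nat list \<times> bool list"

definition read_input :: "bool list \<Rightarrow> nat \<Rightarrow> bool option" where
  "read_input w i = (if i = 0 \<or> i > length w then None else Some (w ! (i - 1)))"

definition mv :: "nat \<Rightarrow> int \<Rightarrow> nat" where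
  "mv h d = nat (int h + d)"

definition halted :: "tm \<Rightarrow> cfg \<Rightarrow> bool" where
  "halted M c \<longleftrightarrow> fst c = tm_acc M \<or> fst c = tm_rej M"

fun step :: "tm \<Rightarrow> bool list \<Rightarrow> cfg \<Rightarrow> cfg" where
  "step M w (q, i, ts, hs, out) =
     (if q = tm_acc M \<or> q = tm_rej M then (q, i, ts, hs, out) else
      (case tm_delta M q (read_input w i) (map (\<lambda>(t, h). t h) (zip ts hs)) of
        (q', d, ops, ob) \<Rightarrow>
          (q', mv i d,
           map (\<lambda>((t, h), (s, e)). t(h := s)) (zip (zip ts hs) ops),
           map (\<lambda>(h, (s, e)). mv h e) (zip hs ops),
           out @ (case ob of None \<Rightarrow> [] | Some b \<Rightarrow> [b]))))"

definition init_cfg :: "tm \<Rightarrow> cfg" where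
  "init_cfg M = (tm_start M, 0, replicate (tm_tapes M) (\<lambda>_. 0), replicate (tm_tapes M) 0, [])"

definition run :: "tm \<Rightarrow> bool list \<Rightarrow> nat \<Rightarrow> cfg" where
  "run M w t = (step M w ^^ t) (init_cfg M)"

definition cfg_inpos :: "cfg \<Rightarrow> nat" where "cfg_inpos c = fst (snd c)"
definition cfg_heads :: "cfg \<Rightarrow> nat list" where "cfg_heads c = fst (snd (snd (snd c)))"
definition cfg_out :: "cfg \<Rightarrow> bool list" where "cfg_out c = snd (snd (snd (snd c)))"

definition in_P :: "bool list set \<Rightarrow> bool" where
  "in_P L \<longleftrightarrow> (\<exists>M k c. tm_wf M \<and> (\<forall>w.
      halted M (run M w (c * (length w + 1) ^ k)) \<and>
      (fst (run M w (c * (length w + 1) ^ k)) = tm_acc M \<longleftrightarrow> w \<in> L)))"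

definition logspace_computable :: "(bool list \<Rightarrow> bool list) \<Rightarrow> bool" where
  "logspace_computable f \<longleftrightarrow> (\<exists>M (c::real). tm_wf M \<and> (\<forall>w.
      (\<exists>T. halted M (run M w T) \<and> cfg_out (run M w T) = f w) \<and>
      (\<forall>t. cfg_inpos (run M w t) \<le> length w + 1 \<and>
           (\<forall>h\<in>set (cfg_heads (run M w t)). real h \<le> c * log 2 (real (length w) + 2)))))"

definition logspace_reducible :: "bool list set \<Rightarrow> bool list set \<Rightarrow> bool" where
  "logspace_reducible A B \<longleftrightarrow>
     (\<exists>f. logspace_computable f \<and> (\<forall>w. w \<in> A \<longleftrightarrow> f w \<in> B))"

definition P_hard_logspace :: "bool list set \<Rightarrow> bool" where
  "P_hard_logspace B \<longleftrightarrow> (\<forall>L. in_P L \<longrightarrow> logspace_reducible L B)"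

end

theory Submission
  imports Defs
begin

text \<open>The empty set and \<open>\<nat>\<close> serve as truth values: on them, division is conjunction and complement
  is negation, so \<open>{Neg, Divide}\<close>-circuits evaluate arbitrary Boolean circuits.

  A polynomial-time machine is unrolled into a linear recurrence.  With row length \<open>D\<close>, site
  \<open>u = t * D + y\<close> describes the configuration at time \<open>t\<close> around tape position \<open>D - 1 - y\<close>, and it is a
  fixed finite function of the sites \<open>u - 1\<close>, \<open>u - D\<close> and \<open>u - D + 1\<close>.  Each site becomes a group of
  gates (a one-hot encoding of the site), an instance of one constant template.  Reverse
  topological order means decreasing \<open>u\<close>; the groups are therefore named by
  \<open>a = U - 1 - u\<close>, with \<open>D = 2 ^ (e * L)\<close>, \<open>U = D * D\<close> and \<open>L\<close> about \<open>log n\<close>.  The logarithmic-space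
  machine only has to keep the four binary counters \<open>a\<close>, \<open>a + 1\<close>, \<open>a + D\<close>, \<open>a + D - 1\<close> as tracks of
  one work tape of length \<open>L\<close>, increment them, and copy them into the template.  Since membership of a
  bit string in \<^const>\<open>MC\<close> only asks for some circuit with that encoding, injectivity of the
  encoding is needed as well.\<close>

section \<open>Structured programs for logarithmic-space machines\<close>

text \<open>The obstacle is that one step of a multi-tape machine depends on several heads that may
  be far apart, whereas a gate group may consult only a bounded number of other groups. Each row is
  therefore swept towards position 0 while the symbols under the heads are collected; at position 0
  all are known, and the next row starts its sweep with the action they determine. Hence
  \<open>u - 1\<close> is an argument next to two sites of the previous row. Powers of two spare the
  writer all comparisons: overflow of the counter \<open>a + D\<close> announces row 0, whose groups
  are constant and follow the input, and overflow of \<open>a\<close> ends the output. With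
  \<open>n + 2 < 2 ^ L\<close> and time bound \<open>c * (n + 1) ^ k\<close>, the exponent
  \<open>e = k + c + 1\<close> makes \<open>D\<close> exceed the running time, so heads stay within
  a row and the machine has halted at time \<open>D - 1\<close>. The final site, at time
  \<open>D - 1\<close> and position 0, has \<open>a = 0\<close>, so the name of the output gate can
  be printed before anything else. A counter has \<open>2 * e * L\<close> bits; cut into
  \<open>2 * e\<close> tracks it fits on \<open>L\<close> cells.\<close>

datatype 's prog =
  Basic "bool option \<Rightarrow> 's \<Rightarrow> int \<times> 's \<times> int \<times> bool option"
| Seq "'s prog" "'s prog"
| Cond "bool option \<Rightarrow> 's \<Rightarrow> bool" "'s prog" "'s prog"
| While "bool option \<Rightarrow> 's \<Rightarrow> bool" "'s prog"

type_synonym 's pst = "nat \<times> (nat \<Rightarrow> 's) \<times> nat \<times> bool list"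

text \<open>The control state is the list of programs that remain to be run; \<open>conts\<close> below bounds the
  lists that can occur, so that finitely many states suffice.\<close>

fun ctl :: "'s prog list \<Rightarrow> bool option \<Rightarrow> 's \<Rightarrow> 's prog list \<times> int \<times> 's \<times> int \<times> bool option" where
  "ctl [] x s = ([], 0, s, 0, None)"
| "ctl (Basic f # cs) x s = (cs, f x s)"
| "ctl (Seq a b # cs) x s = (a # b # cs, 0, s, 0, None)"
| "ctl (Cond g a b # cs) x s = ((if g x s then a else b) # cs, 0, s, 0, None)"
| "ctl (While g b # cs) x s = (if g x s then b # While g b # cs else cs, 0, s, 0, None)"

definition opt_list :: "'a option \<Rightarrow> 'a list" where
  "opt_list ob = (case ob of None \<Rightarrow> [] | Some b \<Rightarrow> [b])"

fun pstep :: "bool list \<Rightarrow> 's prog list \<times> 's pst \<Rightarrow> 's prog list \<times> 's pst" where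
  "pstep w (cs, (i, T, h, out)) =
     (case ctl cs (read_input w i) (T h) of (cs', d, s, e, ob) \<Rightarrow>
        (cs', (mv i d, T(h := s), mv h e, out @ opt_list ob)))"

fun inside :: "bool list \<Rightarrow> nat \<Rightarrow> 's pst \<Rightarrow> bool" where
  "inside w B (i, T, h, out) \<longleftrightarrow> i \<le> length w + 1 \<and> h \<le> B"

text \<open>The bound is checked only where a \<open>Basic\<close> step changes tape, heads or
  output, so a derivation certifies termination and space usage at the same time.\<close>

inductive exec :: "bool list \<Rightarrow> nat \<Rightarrow> 's prog \<Rightarrow> 's pst \<Rightarrow> 's pst \<Rightarrow> bool" for w B where
  exec_Basic: "f (read_input w i) (T h) = (d, s, e, ob) \<Longrightarrow> inside w B (mv i d, T(h := s), mv h e, out @ opt_list ob) \<Longrightarrow>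
     exec w B (Basic f) (i, T, h, out) (mv i d, T(h := s), mv h e, out @ opt_list ob)"
| exec_Seq: "exec w B a s s' \<Longrightarrow> exec w B b s' s'' \<Longrightarrow> exec w B (Seq a b) s s''"
| exec_CondT: "g (read_input w i) (T h) \<Longrightarrow> exec w B a (i, T, h, out) s' \<Longrightarrow> exec w B (Cond g a b) (i, T, h, out) s'"
| exec_CondF: "\<not> g (read_input w i) (T h) \<Longrightarrow> exec w B b (i, T, h, out) s' \<Longrightarrow> exec w B (Cond g a b) (i, T, h, out) s'"
| exec_WhileF: "\<not> g (read_input w i) (T h) \<Longrightarrow> exec w B (While g b) (i, T, h, out) (i, T, h, out)"
| exec_WhileT: "g (read_input w i) (T h) \<Longrightarrow> exec w B b (i, T, h, out) s' \<Longrightarrow> exec w B (While g b) s' s'' \<Longrightarrow>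
     exec w B (While g b) (i, T, h, out) s''"

lemma mv_0 [simp]: "mv i 0 = i"
  by (simp add: mv_def)

lemma opt_list_simps [simp]: "opt_list None = []" "opt_list (Some b) = [b]"
  by (simp_all add: opt_list_def)

definition reach :: "bool list \<Rightarrow> nat \<Rightarrow> 's prog list \<times> 's pst \<Rightarrow> 's prog list \<times> 's pst \<Rightarrow> bool" where
  "reach w B x y \<longleftrightarrow> (\<exists>t. (pstep w ^^ t) x = y \<and> (\<forall>t'\<le>t. inside w B (snd ((pstep w ^^ t') x))))"

lemma reach_refl: "inside w B (snd x) \<Longrightarrow> reach w B x x"
  unfolding reach_def by (rule exI[of _ 0]) simp

lemma reach_step:
  assumes "inside w B (snd x)" "reach w B (pstep w x) y"
  shows "reach w B x y"
proof -
  obtain t where t: "(pstep w ^^ t) (pstep w x) = y" "\<forall>t'\<le>t. inside w B (snd ((pstep w ^^ t') (pstep w x)))"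
    using assms(2) by (auto simp: reach_def)
  have "inside w B (snd ((pstep w ^^ t') x))" if "t' \<le> Suc t" for t'
    using that assms(1) t(2) by (cases t') (simp_all del: funpow.simps(2) add: funpow_Suc_right)
  with t(1) show ?thesis
    unfolding reach_def by (intro exI[of _ "Suc t"]) (simp add: funpow_Suc_right del: funpow.simps(2))
qed

lemma reach_trans:
  assumes "reach w B x y" "reach w B y z"
  shows "reach w B x z"
proof -
  obtain t where "(pstep w ^^ t) x = y" "\<forall>t'\<le>t. inside w B (snd ((pstep w ^^ t') x))"
    using assms(1) by (auto simp: reach_def)
  then show ?thesis
    using assms(2)
  proof (induction t arbitrary: x)
    case (Suc t)
    have "\<forall>t'\<le>t. inside w B (snd ((pstep w ^^ t') (pstep w x)))"
    proof (intro allI impI)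
      fix t' assume "t' \<le> t"
      then show "inside w B (snd ((pstep w ^^ t') (pstep w x)))"
        using Suc.prems(2)[rule_format, of "Suc t'"] by (simp add: funpow_Suc_right del: funpow.simps(2))
    qed
    moreover have "(pstep w ^^ t) (pstep w x) = y"
      using Suc.prems(1) by (simp add: funpow_Suc_right del: funpow.simps(2))
    ultimately have "reach w B (pstep w x) z"
      using Suc.IH Suc.prems(3) by blast
    then show ?case
      using Suc.prems(2)[rule_format, of 0] by (simp add: reach_step)
  qed simp
qed

text \<open>The rest \<open>cs\<close> is left untouched and has to be arbitrary: \<open>Seq\<close>
  and \<open>While\<close> push programs onto it, so their subprograms run in front of longer
  lists.\<close>

lemma exec_imp_reach:
  "exec w B c s s' \<Longrightarrow> inside w B s \<Longrightarrow> inside w B s' \<and> reach w B (c # cs, s) (cs, s')"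
proof (induction arbitrary: cs rule: exec.induct)
  case (exec_Basic f i T h d s e ob out)
  then show ?case
    using reach_step[of w B "(Basic f # cs, i, T, h, out)" "(cs, mv i d, T(h := s), mv h e, out @ opt_list ob)"]
    by (simp add: reach_refl)
next
  case (exec_Seq a s s' b s'')
  have "reach w B (a # b # cs, s) (cs, s'')"
    using exec_Seq by (blast intro: reach_trans)
  moreover have "pstep w (Seq a b # cs, s) = (a # b # cs, s)"
    by (cases s) simp
  ultimately show ?case
    using exec_Seq reach_step[of w B "(Seq a b # cs, s)"] by simp
next
  case (exec_CondT g i T h a out s' b)
  then show ?case using reach_step[of w B "(Cond g a b # cs, i, T, h, out)"] by simp
next
  case (exec_CondF g i T h b out s' a)
  then show ?case using reach_step[of w B "(Cond g a b # cs, i, T, h, out)"] by simp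
next
  case (exec_WhileF g i T h b out)
  then show ?case
    using reach_step[of w B "(While g b # cs, i, T, h, out)"] by (simp add: reach_refl)
next
  case (exec_WhileT g i T h b out s' s'')
  have "reach w B (b # While g b # cs, (i, T, h, out)) (cs, s'')"
    using exec_WhileT by (blast intro: reach_trans)
  then show ?case
    using exec_WhileT reach_step[of w B "(While g b # cs, i, T, h, out)"] by simp
qed

section \<open>Compilation of programs to Turing machines\<close>

fun conts :: "'s prog \<Rightarrow> 's prog list \<Rightarrow> 's prog list set" where
  "conts (Basic f) cs = {Basic f # cs}"
| "conts (Seq a b) cs = {Seq a b # cs} \<union> conts a (b # cs) \<union> conts b cs"
| "conts (Cond g a b) cs = {Cond g a b # cs} \<union> conts a cs \<union> conts b cs"
| "conts (While g b) cs = {While g b # cs} \<union> conts b (While g b # cs)"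

lemma finite_conts: "finite (conts c cs)"
  by (induction c arbitrary: cs) auto

lemma conts_self: "c # cs \<in> conts c cs"
  by (cases c) auto

text \<open>\<open>cs\<close> is added because a finished program exposes its continuation; for a
  subprogram this continuation is \<open>cs\<close> or again a member of the enclosing set.\<close>

lemma conts_closed: "ds \<in> conts c cs \<Longrightarrow> fst (ctl ds x s) \<in> insert cs (conts c cs)"
proof (induction c arbitrary: cs ds)
  case (Seq a b)
  show ?case
    using Seq.prems Seq.IH(1)[of ds "b # cs"] Seq.IH(2)[of ds cs] conts_self[of a "b # cs"] conts_self[of b cs] by auto
next
  case (Cond g a b)
  show ?case
    using Cond.prems Cond.IH(1)[of ds cs] Cond.IH(2)[of ds cs] conts_self[of a cs] conts_self[of b cs] by auto
next
  case (While g b)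
  show ?case
    using While.prems While.IH[of ds "While g b # cs"] conts_self[of b "While g b # cs"]
    by (auto split: if_splits)
qed auto

fun wf_prog :: "'s set \<Rightarrow> 's prog \<Rightarrow> bool" where
  "wf_prog S (Basic f) \<longleftrightarrow> (\<forall>x. \<forall>s\<in>S. case f x s of (d, s', e, ob) \<Rightarrow>
     d \<in> {-1, 0, 1} \<and> s' \<in> S \<and> e \<in> {-1, 0, 1})"
| "wf_prog S (Seq a b) \<longleftrightarrow> wf_prog S a \<and> wf_prog S b"
| "wf_prog S (Cond g a b) \<longleftrightarrow> wf_prog S a \<and> wf_prog S b"
| "wf_prog S (While g b) \<longleftrightarrow> wf_prog S b"

lemma wf_conts:
  "wf_prog S c \<Longrightarrow> list_all (wf_prog S) cs \<Longrightarrow> ds \<in> conts c cs \<Longrightarrow> list_all (wf_prog S) ds"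
proof (induction c arbitrary: cs ds)
  case (Seq a b)
  show ?case
    using Seq.prems Seq.IH(1)[of "b # cs" ds] Seq.IH(2)[of cs ds] by auto
next
  case (Cond g a b)
  show ?case
    using Cond.prems Cond.IH(1)[of cs ds] Cond.IH(2)[of cs ds] by auto
next
  case (While g b)
  show ?case
    using While.prems While.IH[of "While g b # cs" ds] by auto
qed auto

lemma wf_ctl:
  assumes "list_all (wf_prog S) cs" "s \<in> S" "ctl cs x s = (cs', d, s', e, ob)"
  shows "d \<in> {-1, 0, 1} \<and> s' \<in> S \<and> e \<in> {-1, 0, 1}"
  using assms
proof (cases cs)
  case (Cons c cs)
  show ?thesis
  proof (cases c)
    case (Basic f)
    have "case f x s of (d, s', e, ob) \<Rightarrow> d \<in> {-1, 0, 1} \<and> s' \<in> S \<and> e \<in> {-1, 0, 1}"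
      using assms(1,2) unfolding Cons Basic by simp
    then show ?thesis using assms(3) by (simp add: Cons Basic)
  qed (use assms Cons in auto)
qed auto

text \<open>The states code the finitely many control lists, the tape alphabet codes
  \<open>S\<close>, and the empty list is accepting. The derivation bounds all configurations up to
  the end of the run; afterwards the configuration no longer changes, so the bound holds at every
  time.\<close>

theorem logspace_computable_prog:
  fixes c :: "'s prog" and K :: real
  assumes S: "finite S" "bl \<in> S" and wf: "wf_prog S c"
    and ex: "\<And>w. exec w (bd w) c (0, \<lambda>_. bl, 0, []) (F w)"
    and out: "\<And>w. snd (snd (snd (F w))) = f w"
    and bd: "\<And>w. real (bd w) \<le> K * log 2 (real (length w) + 2)"
  shows "logspace_computable f"
proof -
  define R where "R = insert [] (conts c [])"
  have finR: "finite R" by (simp add: R_def finite_conts)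
  have R_closed: "fst (ctl cs x s) \<in> R" if "cs \<in> R" for cs x s
    using that conts_closed[of cs c "[]"] by (auto simp: R_def)
  have R_wf: "list_all (wf_prog S) cs" if "cs \<in> R" for cs
    using that wf_conts[OF wf, of "[]"] by (auto simp: R_def)
  obtain code :: "'s prog list \<Rightarrow> nat" and n where code: "code ` R = {i. i < n}" "inj_on code R"
    using finite_imp_inj_to_nat_seg[OF finR] by blast
  obtain g :: "'s \<Rightarrow> nat" and m where g: "g ` S = {i. i < m}" "inj_on g S"
    using finite_imp_inj_to_nat_seg[OF S(1)] by blast
  \<comment> \<open>Work tapes start filled with \<open>0\<close>, so \<open>bl\<close> must receive
    that code; the other codes are shifted by one.\<close>
  define sc where "sc = (\<lambda>s. if s = bl then 0 else Suc (g s))"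
  have sc_inj: "inj_on sc S"
    using g(2) by (auto simp: sc_def inj_on_def)
  have sc_less: "sc s < Suc m" if "s \<in> S" for s
    using that g(1) by (auto simp: sc_def)
  have code_less: "code cs < n" if "cs \<in> R" for cs
    using that code(1) by auto
  define dec where "dec = inv_into R code"
  define sdec where "sdec = (\<lambda>k. if k \<in> sc ` S then inv_into S sc k else bl)"
  have dec: "dec (code cs) = cs" if "cs \<in> R" for cs
    using that code(2) by (simp add: dec_def)
  have sdec: "sdec (sc s) = s" if "s \<in> S" for s
    using that sc_inj by (simp add: sdec_def)
  have sdec_in: "sdec k \<in> S" for k
    using S(2) by (auto simp: sdec_def inv_into_into)
  have dec_in: "dec q \<in> R" if "q < n" for q
    using that code(1) by (auto simp: dec_def intro!: inv_into_into)
  define \<delta> where "\<delta> = (\<lambda>q x ss. if q < n then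
      (case ctl (dec q) x (sdec (ss ! 0)) of (cs, d, s, e, ob) \<Rightarrow> (code cs, d, [(sc s, e)], ob))
      else (q, 0, [(0, 0)], None))"
  \<comment> \<open>State \<open>n\<close> codes no control list. It provides the rejecting state,
    distinct from the accepting one, that \<open>tm_wf\<close> asks for.\<close>
  define M where "M = \<lparr>tm_states = Suc n, tm_syms = Suc m, tm_tapes = 1, tm_start = code [c],
     tm_acc = code [], tm_rej = n, tm_delta = \<delta>\<rparr>"
  have inR: "[] \<in> R" "[c] \<in> R"
    using conts_self[of c "[]"] by (auto simp: R_def)
  have wfM: "tm_wf M"
    unfolding tm_wf_def
  proof (intro conjI allI impI)
    fix q x and ss :: "nat list"
    assume "q < tm_states M" and ss: "length ss = tm_tapes M \<and> set ss \<subseteq> {..<tm_syms M}"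
    show "case tm_delta M q x ss of (q', d, ops, ob) \<Rightarrow>
           q' < tm_states M \<and> d \<in> {-1, 0, 1} \<and> length ops = tm_tapes M \<and>
           (\<forall>(s, e)\<in>set ops. s < tm_syms M \<and> e \<in> {-1, 0, 1})"
    proof (cases "q < n")
      case True
      obtain cs d s e ob where c: "ctl (dec q) x (sdec (ss ! 0)) = (cs, d, s, e, ob)"
        by (metis prod_cases5)
      note wf_ctl[OF R_wf[OF dec_in[OF True]] sdec_in c]
      moreover have "cs \<in> R"
        using R_closed[OF dec_in[OF True], of x "sdec (ss ! 0)"] c by simp
      ultimately show ?thesis
        using True c sc_less code_less by (auto simp: M_def \<delta>_def less_Suc_eq)
    next
      case False
      then show ?thesis using \<open>q < tm_states M\<close> by (simp add: M_def \<delta>_def)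
    qed
  qed (use code_less inR in \<open>auto simp: M_def less_Suc_eq\<close>)
  define rep where "rep = (\<lambda>(cs, (i, T :: nat \<Rightarrow> 's, h, out)). (code cs, i :: nat, [sc \<circ> T], [h :: nat], out :: bool list))"
  define inv where "inv = (\<lambda>(cs, (i :: nat, T :: nat \<Rightarrow> 's, h :: nat, out :: bool list)). cs \<in> R \<and> range T \<subseteq> S)"
  have sim: "step M w (rep x) = rep (pstep w x) \<and> inv (pstep w x)" if "inv x" for w x
  proof -
    obtain cs i T h out where x: "x = (cs, (i, T, h, out))"
      by (metis prod_cases5)
    have cs: "cs \<in> R" and T: "range T \<subseteq> S" using that by (auto simp: x inv_def)
    obtain cs' d s e ob where c: "ctl cs (read_input w i) (T h) = (cs', d, s, e, ob)"
      by (metis prod_cases5)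
    have Th: "T h \<in> S" using T by auto
    have s: "s \<in> S" using wf_ctl[OF R_wf[OF cs] Th c] by simp
    have cs': "cs' \<in> R" using R_closed[OF cs, of "read_input w i" "T h"] c by simp
    have upd: "(sc \<circ> T)(h := sc s) = sc \<circ> T(h := s)" by auto
    have "step M w (rep x) = rep (pstep w x)"
    proof (cases "cs = []")
      case True
      then show ?thesis by (simp add: x rep_def M_def)
    next
      case False
      then have "code cs \<noteq> code []" using code(2) cs inR(1) by (auto dest: inj_onD)
      moreover have "code cs \<noteq> n" "code cs < n" using code_less[OF cs] by auto
      ultimately show ?thesis
        using c by (simp add: x rep_def M_def \<delta>_def dec[OF cs] sdec[OF Th] upd opt_list_def)
    qed
    moreover have "inv (pstep w x)"
      using cs' s T c by (auto simp: x inv_def)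
    ultimately show ?thesis by simp
  qed
  define x0 where "x0 = ([c], (0 :: nat, (\<lambda>_ :: nat. bl), 0 :: nat, [] :: bool list))"
  have init: "init_cfg M = rep x0"
    by (auto simp: init_cfg_def rep_def M_def x0_def sc_def)
  have runM: "run M w t = rep ((pstep w ^^ t) x0) \<and> inv ((pstep w ^^ t) x0)" for w t
  proof (induction t)
    case 0
    then show ?case using inR S(2) by (auto simp: run_def init inv_def x0_def)
  next
    case (Suc t)
    then show ?case using sim[of "(pstep w ^^ t) x0" w] by (simp add: run_def)
  qed
  have main: "(\<exists>T. halted M (run M w T) \<and> cfg_out (run M w T) = f w) \<and>
      (\<forall>t. cfg_inpos (run M w t) \<le> length w + 1 \<and>
           (\<forall>h\<in>set (cfg_heads (run M w t)). real h \<le> K * log 2 (real (length w) + 2)))" for w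
  proof -
    have "reach w (bd w) x0 ([], F w)"
      using exec_imp_reach[OF ex, of w "[]"] by (simp add: x0_def)
    then obtain T where T: "(pstep w ^^ T) x0 = ([], F w)"
      "\<forall>t\<le>T. inside w (bd w) (snd ((pstep w ^^ t) x0))"
      by (auto simp: reach_def)
    have stay: "(pstep w ^^ k) ([], s) = ([], s)" for k and s :: "'s pst"
      by (induction k) (simp_all, cases s, simp)
    have wi: "inside w (bd w) (snd ((pstep w ^^ t) x0))" for t
    proof (cases "t \<le> T")
      case False
      then have "(pstep w ^^ t) x0 = (pstep w ^^ (t - T)) ((pstep w ^^ T) x0)"
        by (metis add_diff_inverse_nat add.commute comp_apply funpow_add nat_le_linear not_le)
      also have "\<dots> = (pstep w ^^ T) x0" by (simp add: T(1) stay)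
      finally show ?thesis using T(2) by auto
    qed (use T(2) in auto)
    have "halted M (run M w T)" "cfg_out (run M w T) = f w"
      using runM[of w T] out[of w]
      by (auto simp: T(1) halted_def cfg_out_def rep_def M_def split: prod.splits)
    moreover have "cfg_inpos (run M w t) \<le> length w + 1 \<and>
           (\<forall>h\<in>set (cfg_heads (run M w t)). real h \<le> K * log 2 (real (length w) + 2))" for t
      using wi[of t] runM[of w t] bd[of w]
      by (auto simp: cfg_inpos_def cfg_heads_def rep_def split: prod.splits
          intro: order.trans[OF of_nat_mono])
    ultimately show ?thesis by blast
  qed
  show ?thesis
    unfolding logspace_computable_def using wfM main by blast
qed

section \<open>Circuits made of groups of gates\<close>

definition num :: "bool list \<Rightarrow> nat" where
  "num bs = foldl (\<lambda>n b. 2 * n + of_bool b) 0 bs"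

declare bin.simps [simp del]

lemma num_snoc: "num (bs @ [b]) = 2 * num bs + of_bool b"
  by (simp add: num_def)

lemma num_ge: "2 ^ length bs \<le> num (True # bs)"
proof (induction bs rule: rev_induct)
  case (snoc b bs)
  then show ?case using num_snoc[of "True # bs" b] by simp
qed (simp add: num_def)

lemma bin_num: "bin (num (True # bs)) = True # bs"
proof (induction bs rule: rev_induct)
  case Nil
  then show ?case by (simp add: num_def bin.simps)
next
  case (snoc b bs)
  have "1 \<le> num (True # bs)"
    using num_ge[of bs] by (meson one_le_power one_le_numeral order_trans)
  then have "\<not> 2 * num (True # bs) + of_bool b < 2" by simp
  then have "bin (2 * num (True # bs) + of_bool b) = bin (num (True # bs)) @ [b]"
    by (subst bin.simps) simp
  then show ?case using num_snoc[of "True # bs" b] snoc by simp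
qed

fun bits :: "nat \<Rightarrow> nat \<Rightarrow> bool list" where
  "bits 0 a = []"
| "bits (Suc m) a = odd a # bits m (a div 2)"

lemma length_bits [simp]: "length (bits m a) = m"
  by (induction m arbitrary: a) auto

lemma bits_inj: "bits m a = bits m b \<Longrightarrow> a < 2 ^ m \<Longrightarrow> b < 2 ^ m \<Longrightarrow> a = b"
proof (induction m arbitrary: a b)
  case (Suc m)
  then have "a div 2 = b div 2" "odd a = odd b" by auto
  then show ?case by (metis even_iff_mod_2_eq_zero mod_div_decomp odd_iff_mod_2_eq_one)
qed auto

text \<open>The leading \<open>True\<close> prevents \<open>bin\<close> from dropping zeros, so
  counter bits can be copied into a name verbatim. The bits of \<open>a\<close> stand least
  significant first inside a numeral read most significant first; all that matters is that names are
  distinct and exceed those of the constant gates.\<close>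

definition gate_name :: "nat \<Rightarrow> nat \<Rightarrow> nat \<Rightarrow> nat \<Rightarrow> nat" where
  "gate_name m W a s = num (True # bits m a @ bits W s)"

lemma bin_gate_name: "bin (gate_name m W a s) = True # bits m a @ bits W s"
  by (simp add: gate_name_def bin_num)

lemma gate_name_inj:
  "gate_name m W a s = gate_name m W b t \<Longrightarrow> a < 2 ^ m \<Longrightarrow> b < 2 ^ m \<Longrightarrow> s < 2 ^ W \<Longrightarrow> t < 2 ^ W \<Longrightarrow>
     a = b \<and> s = t"
  by (drule arg_cong[of _ _ bin]) (auto simp: bin_gate_name dest: bits_inj)

lemma gate_name_ge: "2 \<le> m \<Longrightarrow> 4 \<le> gate_name m W a s"
  using num_ge[of "bits m a @ bits W s"] power_increasing[of 2 "m + W" "2::nat"]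
  by (simp add: gate_name_def)

text \<open>\<open>B\<close> contains the names supplied by gates that follow the list, which allows
  a circuit to be checked group by group.\<close>

fun topo :: "nat set \<Rightarrow> gate list \<Rightarrow> bool" where
  "topo B [] \<longleftrightarrow> True"
| "topo B ((n, l, ps) # gs) \<longleftrightarrow>
     n \<notin> B \<union> fst ` set gs \<and> set ps \<subseteq> B \<union> fst ` set gs \<and> topo B gs"

lemma topo_append: "topo B (xs @ ys) \<longleftrightarrow> topo B ys \<and> topo (B \<union> fst ` set ys) xs"
  by (induction B xs rule: topo.induct) (auto simp: image_Un)

lemma topo_preds: "topo B gs \<Longrightarrow> (n, l, ps) \<in> set gs \<Longrightarrow> set ps \<subseteq> B \<union> fst ` set gs"
  by (induction B gs rule: topo.induct) auto

text \<open>Names are distinct and predecessors lie further back, so updates made by entries nearer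
  the front disturb neither a gate nor its predecessors. From here on the gate equations replace the
  evaluation order.\<close>

lemma topo_vals:
  "topo {} gs \<Longrightarrow> (n, l, ps) \<in> set gs \<Longrightarrow> vals gs n = gval l (map (vals gs) (sort ps))"
proof (induction gs)
  case (Cons g gs)
  obtain n' l' ps' where g: "g = (n', l', ps')" by (cases g)
  have new: "n' \<notin> fst ` set gs" "set ps' \<subseteq> fst ` set gs" "topo {} gs"
    using Cons.prems(1) by (auto simp: g)
  show ?case
  proof (cases "(n, l, ps) = g")
    case True
    then have "n' \<notin> set ps" using new g by auto
    then have "map (vals (g # gs)) (sort ps) = map (vals gs) (sort ps)" by (auto simp: g)
    moreover have "vals (g # gs) n = gval l (map (vals gs) (sort ps))" by (simp add: True[symmetric])
    ultimately show ?thesis by (simp only:)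
  next
    case False
    then have mem: "(n, l, ps) \<in> set gs" using Cons.prems(2) by simp
    then have "n \<noteq> n'" using new(1) by force
    moreover have "n' \<notin> set ps" using topo_preds[OF new(3) mem] new(1) by auto
    then have "map (vals (g # gs)) (sort ps) = map (vals gs) (sort ps)" by (auto simp: g)
    moreover have "vals (g # gs) n = vals gs n" using \<open>n \<noteq> n'\<close> by (simp add: g)
    ultimately show ?thesis using Cons.IH[OF new(3) mem] by (simp only:)
  qed
qed simp

definition label_ok :: "gate \<Rightarrow> bool" where
  "label_ok g \<longleftrightarrow> (case g of (n, l, ps) \<Rightarrow>
     (\<exists>a. l = Input a \<and> ps = []) \<or> l = Gate Neg \<and> length ps = 1 \<or> l = Gate Divide \<and> length ps = 2)"

lemma topo_distinct: "topo B gs \<Longrightarrow> distinct (map fst gs)"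
  by (induction B gs rule: topo.induct) auto

lemma topo_nth: "topo B gs \<Longrightarrow> i < length gs \<Longrightarrow> gs ! i = (n, l, ps) \<Longrightarrow> set ps \<subseteq> B \<union> fst ` set (drop (Suc i) gs)"
  by (induction B gs arbitrary: i rule: topo.induct) (auto simp: nth_Cons split: nat.splits)

lemma topo_is_circuit:
  assumes "topo {} gs" "g \<in> fst ` set gs" "\<forall>x\<in>set gs. label_ok x"
  shows "is_circuit {Neg, Divide} (g, gs)"
proof -
  have "case gs ! i of (n, l, ps) \<Rightarrow>
        set ps \<subseteq> fst ` set (drop (Suc i) gs) \<and>
        (case l of
           Input a \<Rightarrow> ps = []
         | Gate Neg \<Rightarrow> Neg \<in> {Neg, Divide} \<and> length ps = 1
         | Gate \<sigma> \<Rightarrow> \<sigma> \<in> {Neg, Divide} \<and> length ps = 2)" if i: "i < length gs" for i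
  proof -
    obtain n l ps where g: "gs ! i = (n, l, ps)" by (cases "gs ! i")
    have "label_ok (n, l, ps)" using assms(3) i g by (metis nth_mem)
    then show ?thesis using topo_nth[OF assms(1) i g] g by (auto simp: label_ok_def)
  qed
  then show ?thesis
    using assms topo_distinct[OF assms(1)] unfolding is_circuit_def by simp
qed

text \<open>\<open>Ref k s\<close> is gate \<open>s\<close> of the group at distance \<open>off k\<close>; \<open>Const n\<close> is one of the three
  constant gates, of which \<open>1\<close> has value \<open>{}\<close> and \<open>2\<close> has value \<open>UNIV\<close>.\<close>

datatype tref = Const nat | Ref nat nat

type_synonym tgate = "nat \<times> op \<times> tref list"

section \<open>Boolean formulas and their translation into gates\<close>

datatype fm = Var tref | Nt fm | An fm fm

fun fsize :: "fm \<Rightarrow> nat" where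
  "fsize (Var r) = 1"
| "fsize (Nt p) = Suc (fsize p)"
| "fsize (An p q) = Suc (fsize p + fsize q)"

fun fvars :: "fm \<Rightarrow> tref set" where
  "fvars (Var r) = {r}"
| "fvars (Nt p) = fvars p"
| "fvars (An p q) = fvars p \<union> fvars q"

fun feval :: "(tref \<Rightarrow> bool) \<Rightarrow> fm \<Rightarrow> bool" where
  "feval \<rho> (Var r) = \<rho> r"
| "feval \<rho> (Nt p) = (\<not> feval \<rho> p)"
| "feval \<rho> (An p q) = (feval \<rho> p \<and> feval \<rho> q)"

text \<open>Preorder numbering: \<open>s\<close> is the root and each subformula occupies a block of
  larger numbers, so references point forward in the list. Dividing a truth value by itself copies
  it, which serves variables.\<close>

fun fgates :: "nat \<Rightarrow> fm \<Rightarrow> tgate list" where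
  "fgates s (Var r) = [(s, Divide, [r, r])]"
| "fgates s (Nt p) = (s, Neg, [Ref 0 (Suc s)]) # fgates (Suc s) p"
| "fgates s (An p q) = (s, Divide, [Ref 0 (Suc s), Ref 0 (Suc s + fsize p)])
     # fgates (Suc s) p @ fgates (Suc s + fsize p) q"

fun fsgates :: "nat \<Rightarrow> fm list \<Rightarrow> tgate list" where
  "fsgates s [] = []"
| "fsgates s (p # ps) = fgates s p @ fsgates (s + fsize p) ps"

definition root :: "fm list \<Rightarrow> nat \<Rightarrow> nat" where
  "root ps i = length ps + sum_list (map fsize (take i ps))"

text \<open>Copies of the roots come first, so that formula \<open>i\<close> has gate number
  \<open>i\<close> whatever the sizes of the formulas; other groups can refer to it without knowing
  the layout.\<close>

definition template :: "fm list \<Rightarrow> tgate list" where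
  "template ps = map (\<lambda>i. (i, Divide, [Ref 0 (root ps i), Ref 0 (root ps i)])) [0..<length ps]
     @ fsgates (length ps) ps"

lemma fsize_pos: "0 < fsize p"
  by (cases p) auto

lemma length_fgates [simp]: "length (fgates s p) = fsize p"
  by (induction p arbitrary: s) auto

lemma length_fsgates [simp]: "length (fsgates s ps) = sum_list (map fsize ps)"
  by (induction ps arbitrary: s) auto

lemma length_template: "length (template ps) = length ps + sum_list (map fsize ps)"
  by (simp add: template_def)

lemma names_fgates: "map fst (fgates s p) = [s..<s + fsize p]"
proof (induction p arbitrary: s)
  case (Nt p)
  then show ?case using upt_conv_Cons[of s "Suc (s + fsize p)"] by simp
next
  case (An p q)
  have "[s..<s + fsize (An p q)] = s # [Suc s..<Suc s + fsize p + fsize q]"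
    using upt_conv_Cons[of s "s + fsize (An p q)"] by (simp add: ac_simps)
  also have "\<dots> = map fst (fgates s (An p q))"
    unfolding upt_add_eq_append[OF le_add1] by (simp add: An.IH)
  finally show ?case by simp
qed simp

lemma names_fsgates: "map fst (fsgates s ps) = [s..<s + sum_list (map fsize ps)]"
proof (induction ps arbitrary: s)
  case (Cons p ps)
  have "[s..<s + sum_list (map fsize (p # ps))] = [s..<s + fsize p + sum_list (map fsize ps)]"
    by (simp add: add.assoc)
  also have "\<dots> = map fst (fsgates s (p # ps))"
    unfolding upt_add_eq_append[OF le_add1] by (simp add: Cons.IH names_fgates)
  finally show ?case by simp
qed simp

lemma names_template: "map fst (template ps) = [0..<length (template ps)]"
  unfolding length_template upt_add_eq_append[OF le0]
  by (simp add: template_def names_fsgates comp_def)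

lemma root_less:
  assumes "i < length ps"
  shows "root ps i < length (template ps)"
proof -
  have "sum_list (map fsize ps) = sum_list (map fsize (take i ps)) + fsize (ps ! i) + sum_list (map fsize (drop (Suc i) ps))"
    by (subst id_take_nth_drop[OF assms]) simp
  then show ?thesis using fsize_pos[of "ps ! i"] by (simp add: root_def length_template)
qed

lemma refs_fgates:
  "(t, o', rs) \<in> set (fgates s p) \<Longrightarrow> r \<in> set rs \<Longrightarrow>
     r \<in> fvars p \<or> (\<exists>t'. r = Ref 0 t' \<and> t < t' \<and> t' < s + fsize p)"
proof (induction p arbitrary: s)
  case (Nt p)
  show ?case using Nt.prems Nt.IH[of "Suc s"] fsize_pos[of p] by auto
next
  case (An p q)
  consider "t = s" "rs = [Ref 0 (Suc s), Ref 0 (Suc s + fsize p)]"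
    | "(t, o', rs) \<in> set (fgates (Suc s) p)" | "(t, o', rs) \<in> set (fgates (Suc s + fsize p) q)"
    using An.prems(1) by auto
  then show ?case
  proof cases
    case 1
    then show ?thesis using An.prems(2) fsize_pos[of p] fsize_pos[of q] by auto
  next
    case 2
    then show ?thesis using An.IH(1)[OF 2 An.prems(2)] by auto
  next
    case 3
    then show ?thesis using An.IH(2)[OF 3 An.prems(2)] by auto
  qed
qed auto

lemma refs_fsgates:
  "(t, o', rs) \<in> set (fsgates s ps) \<Longrightarrow> r \<in> set rs \<Longrightarrow>
     r \<in> \<Union> (fvars ` set ps) \<or> (\<exists>t'. r = Ref 0 t' \<and> t < t' \<and> t' < s + sum_list (map fsize ps))"
proof (induction ps arbitrary: s)
  case (Cons p ps)
  then show ?case using refs_fgates[of t o' rs s p r] by fastforce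
qed auto

lemma refs_template:
  assumes "(t, o', rs) \<in> set (template ps)" "r \<in> set rs"
  shows "r \<in> \<Union> (fvars ` set ps) \<or> (\<exists>t'. r = Ref 0 t' \<and> t < t' \<and> t' < length (template ps))"
proof (cases "(t, o', rs) \<in> set (fsgates (length ps) ps)")
  case True
  then show ?thesis using refs_fsgates[OF True assms(2)] by (simp add: length_template)
next
  case False
  then have "t < length ps" "r = Ref 0 (root ps t)" using assms by (auto simp: template_def)
  then show ?thesis using root_less[of t ps] by (auto simp: root_def)
qed

definition arity_ok :: "tgate \<Rightarrow> bool" where
  "arity_ok g \<longleftrightarrow> (case g of (t, o', rs) \<Rightarrow> o' = Neg \<and> length rs = 1 \<or> o' = Divide \<and> length rs = 2)"

lemma arity_fgates: "g \<in> set (fgates s p) \<Longrightarrow> arity_ok g"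
  by (induction p arbitrary: s) (auto simp: arity_ok_def)

lemma arity_fsgates: "g \<in> set (fsgates s ps) \<Longrightarrow> arity_ok g"
  by (induction ps arbitrary: s) (auto simp: arity_fgates)

lemma arity_template: "g \<in> set (template ps) \<Longrightarrow> arity_ok g"
  by (auto simp: template_def arity_fsgates) (auto simp: arity_ok_def)

section \<open>Truth values as sets of numbers\<close>

definition bset :: "bool \<Rightarrow> nat set" where
  "bset b = (if b then UNIV else {})"

text \<open>If both sets are \<open>UNIV\<close>, then every \<open>c\<close> is the quotient of
  \<open>c\<close> and \<open>1\<close>; if one is empty, there is no pair to divide.\<close>

lemma divide_bset: "setop Divide (bset p) (bset q) = bset (p \<and> q)"
proof -
  have "\<exists>a. \<exists>b\<in>UNIV - {0}. a = c * b" for c :: nat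
    by (intro exI[of _ c] bexI[of _ 1]) auto
  then show ?thesis by (auto simp: bset_def)
qed

text \<open>Evaluation sorts the predecessors by name, so the operands may be exchanged; conjunction
  is symmetric, whereas division in general is not.\<close>

lemma gval_divide:
  "val x = bset p \<Longrightarrow> val y = bset q \<Longrightarrow> gval (Gate Divide) (map val (sort [x, y])) = bset (p \<and> q)"
  by (cases "x \<le> y") (auto simp: divide_bset conj_commute simp del: setop.simps)

lemma gval_neg: "val x = bset p \<Longrightarrow> gval (Gate Neg) (map val (sort [x])) = bset (\<not> p)"
  by (auto simp: bset_def)

text \<open>Only the gate equations enter, for any valuation \<open>val\<close>; \<open>rf\<close>
  abstracts from the concrete names.\<close>

lemma fgates_value:
  assumes "\<And>t o' rs. (t, o', rs) \<in> set (fgates s p) \<Longrightarrow>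
      val (rf (Ref 0 t)) = gval (Gate o') (map val (sort (map rf rs)))"
    and "\<And>r. r \<in> fvars p \<Longrightarrow> val (rf r) = bset (\<rho> r)"
  shows "val (rf (Ref 0 s)) = bset (feval \<rho> p)"
  using assms
proof (induction p arbitrary: s)
  case (Var r)
  then show ?case
    using gval_divide[of val "rf r" "\<rho> r" "rf r" "\<rho> r"] Var(1)[of s Divide "[r, r]"]
    by (simp del: gval.simps sort_key_simps)
next
  case (Nt p)
  have "val (rf (Ref 0 (Suc s))) = bset (feval \<rho> p)"
    by (rule Nt.IH) (use Nt.prems in auto)
  then show ?case
    using gval_neg[of val "rf (Ref 0 (Suc s))"] Nt.prems(1)[of s Neg "[Ref 0 (Suc s)]"] by simp
next
  case (An p q)
  have "val (rf (Ref 0 (Suc s))) = bset (feval \<rho> p)"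
    by (rule An.IH(1)) (use An.prems in auto)
  moreover have "val (rf (Ref 0 (Suc s + fsize p))) = bset (feval \<rho> q)"
    by (rule An.IH(2)) (use An.prems in auto)
  ultimately show ?case
    using gval_divide[of val "rf (Ref 0 (Suc s))" _ "rf (Ref 0 (Suc s + fsize p))"]
      An.prems(1)[of s Divide "[Ref 0 (Suc s), Ref 0 (Suc s + fsize p)]"]
    by (simp del: gval.simps sort_key_simps)
qed

lemma fsgates_split:
  "i < length ps \<Longrightarrow> set (fgates (s + sum_list (map fsize (take i ps))) (ps ! i)) \<subseteq> set (fsgates s ps)"
proof (induction ps arbitrary: s i)
  case (Cons p ps)
  then show ?case
    using Cons.IH[of "i - 1" "s + fsize p"] by (cases i) (auto simp: ac_simps)
qed simp

lemma template_value:
  assumes eq: "\<And>t o' rs. (t, o', rs) \<in> set (template ps) \<Longrightarrow>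
      val (rf (Ref 0 t)) = gval (Gate o') (map val (sort (map rf rs)))"
    and var: "\<And>p r. p \<in> set ps \<Longrightarrow> r \<in> fvars p \<Longrightarrow> val (rf r) = bset (\<rho> r)"
    and i: "i < length ps"
  shows "val (rf (Ref 0 i)) = bset (feval \<rho> (ps ! i))"
proof -
  have "val (rf (Ref 0 (root ps i))) = bset (feval \<rho> (ps ! i))"
  proof (rule fgates_value)
    show "val (rf (Ref 0 t)) = gval (Gate o') (map val (sort (map rf rs)))"
      if "(t, o', rs) \<in> set (fgates (root ps i) (ps ! i))" for t o' rs
      using that fsgates_split[OF i, of "length ps"] by (intro eq) (auto simp: template_def root_def)
    show "val (rf r) = bset (\<rho> r)" if "r \<in> fvars (ps ! i)" for r
      using var[OF nth_mem[OF i] that] .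
  qed
  moreover have "(i, Divide, [Ref 0 (root ps i), Ref 0 (root ps i)]) \<in> set (template ps)"
    using i by (auto simp: template_def)
  ultimately show ?thesis
    using eq[of i Divide "[Ref 0 (root ps i), Ref 0 (root ps i)]"]
      gval_divide[of val "rf (Ref 0 (root ps i))" _ "rf (Ref 0 (root ps i))"]
    by (simp del: gval.simps sort_key_simps)
qed

section \<open>Circuits assembled from instances of templates\<close>

locale gate_groups =
  fixes m W :: nat and off :: "nat \<Rightarrow> nat" and \<phi>s :: "nat \<Rightarrow> fm list"
begin

fun ref_name :: "nat \<Rightarrow> tref \<Rightarrow> nat" where
  "ref_name a (Const n) = n"
| "ref_name a (Ref k s) = gate_name m W (a + off k) s"

fun inst :: "nat \<Rightarrow> tgate \<Rightarrow> gate" where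
  "inst a (s, o', rs) = (gate_name m W a s, Gate o', map (ref_name a) rs)"

text \<open>The divisor \<open>0\<close> is excluded, so \<open>{0}\<close> divided by
  \<open>{0}\<close> is empty; this yields the value of gate \<open>1\<close>, and its complement
  that of gate \<open>2\<close>.\<close>

definition consts_part :: "gate list" where
  "consts_part = [(2, Gate Neg, [1]), (1, Gate Divide, [0, 0]), (0, Input 0, [])]"

definition group :: "nat \<Rightarrow> gate list" where
  "group a = map (inst a) (template (\<phi>s a))"

definition gates_from :: "nat \<Rightarrow> gate list" where
  "gates_from a = concat (map group [a..<2 ^ m]) @ consts_part"

end

text \<open>\<open>Ref 0\<close> stays inside a group, whereas variables need
  \<open>0 < off k\<close>: they point to groups of larger number, which stand later in the list.
  The bound on \<open>m\<close> keeps names away from the constant gates.\<close>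

locale group_circuit = gate_groups +
  assumes m: "2 \<le> m" and off0: "off 0 = 0"
    and vars: "\<And>a p r. a < 2 ^ m \<Longrightarrow> p \<in> set (\<phi>s a) \<Longrightarrow> r \<in> fvars p \<Longrightarrow>
      (case r of Const n \<Rightarrow> n \<in> {1, 2}
       | Ref k s \<Rightarrow> 0 < off k \<and> a + off k < 2 ^ m \<and> s < length (\<phi>s (a + off k)))"
    and W: "\<And>a. a < 2 ^ m \<Longrightarrow> length (template (\<phi>s a)) \<le> 2 ^ W"
begin

lemma gates_from_Cons: "a < 2 ^ m \<Longrightarrow> gates_from a = group a @ gates_from (Suc a)"
  by (simp add: gates_from_def upt_conv_Cons)

lemma inst_name: "fst (inst a g) = gate_name m W a (fst g)"
  by (cases g) simp

lemma names_group: "fst ` set (group a) = gate_name m W a ` {..<length (template (\<phi>s a))}"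
proof -
  have "fst ` set (group a) = gate_name m W a ` (set (map fst (template (\<phi>s a))))"
    by (simp add: group_def image_image inst_name)
  then show ?thesis by (simp add: names_template lessThan_atLeast0)
qed

lemma names_from: "fst ` set (gates_from a) =
    {0, 1, 2} \<union> (\<Union>b\<in>{a..<2 ^ m}. gate_name m W b ` {..<length (template (\<phi>s b))})"
  by (auto simp: gates_from_def image_Un image_UN names_group consts_part_def)

text \<open>The start \<open>k\<close> is general because the induction removes the first gate and
  leaves names beginning at \<open>Suc k\<close>.\<close>

lemma topo_insts:
  assumes "map fst ts = [k..<k + length ts]" "k + length ts \<le> 2 ^ W" "a < 2 ^ m"
    and "\<And>t o' rs r. (t, o', rs) \<in> set ts \<Longrightarrow> r \<in> set rs \<Longrightarrow>
      ref_name a r \<in> B \<or> (\<exists>t'. r = Ref 0 t' \<and> t < t' \<and> t' < k + length ts)"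
    and "\<And>t. t < k + length ts \<Longrightarrow> gate_name m W a t \<notin> B"
  shows "topo B (map (inst a) ts)"
  using assms
proof (induction ts arbitrary: k)
  case (Cons g ts)
  obtain o' rs where g: "g = (k, o', rs)" and ts: "map fst ts = [Suc k..<Suc k + length ts]"
    using Cons.prems(1) upt_conv_Cons[of k "k + length (g # ts)"] by (cases g) (simp del: upt_Suc)
  have names: "fst ` set (map (inst a) ts) = gate_name m W a ` {Suc k..<Suc k + length ts}"
  proof -
    have "fst ` set (map (inst a) ts) = gate_name m W a ` (set (map fst ts))"
      by (simp add: image_image inst_name)
    then show ?thesis unfolding ts set_upt .
  qed
  have "topo B (map (inst a) ts)"
  proof (rule Cons.IH[OF ts])
    show "ref_name a r \<in> B \<or> (\<exists>t'. r = Ref 0 t' \<and> t < t' \<and> t' < Suc k + length ts)"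
      if "(t, o', rs) \<in> set ts" "r \<in> set rs" for t o' rs r
      using Cons.prems(4)[of t o' rs r] that by auto
  qed (use Cons.prems in auto)
  moreover have "gate_name m W a k \<notin> B" using Cons.prems(5)[of k] by simp
  moreover have "gate_name m W a k \<notin> fst ` set (map (inst a) ts)"
    unfolding names using gate_name_inj[of m W a k a] Cons.prems(2,3) by fastforce
  moreover have "ref_name a r \<in> B \<union> fst ` set (map (inst a) ts)" if r: "r \<in> set rs" for r
  proof (cases "ref_name a r \<in> B")
    case False
    then obtain t' where "r = Ref 0 t'" "k < t'" "t' < k + length (g # ts)"
      using Cons.prems(4)[of k o' rs r] r g by auto
    then show ?thesis unfolding names by (auto simp: off0)
  qed simp
  ultimately show ?case by (auto simp: g)
qed simp

lemma topo_from: "a \<le> 2 ^ m \<Longrightarrow> topo {} (gates_from a)"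
proof (induction a rule: inc_induct)
  case base
  show ?case by (simp add: gates_from_def consts_part_def)
next
  case (step a)
  have "topo (fst ` set (gates_from (Suc a))) (group a)"
    unfolding group_def
  proof (rule topo_insts[of _ 0])
    show "ref_name a r \<in> fst ` set (gates_from (Suc a)) \<or>
        (\<exists>t'. r = Ref 0 t' \<and> t < t' \<and> t' < 0 + length (template (\<phi>s a)))"
      if mem: "(t, o', rs) \<in> set (template (\<phi>s a))" "r \<in> set rs" for t o' rs r
    proof (cases "r \<in> \<Union> (fvars ` set (\<phi>s a))")
      case True
      then obtain p where p: "p \<in> set (\<phi>s a)" "r \<in> fvars p" by blast
      show ?thesis
      proof (cases r)
        case (Const n)
        then show ?thesis using vars[OF _ p] step.hyps by (auto simp: names_from)
      next
        case (Ref k s)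
        then have "0 < off k" "a + off k < 2 ^ m" "s < length (template (\<phi>s (a + off k)))"
          using vars[OF _ p] step.hyps by (auto simp: length_template)
        then show ?thesis by (auto simp: names_from Ref intro!: bexI[of _ "a + off k"])
      qed
    qed (use refs_template[OF mem] in auto)
    show "gate_name m W a t \<notin> fst ` set (gates_from (Suc a))" if "t < 0 + length (template (\<phi>s a))" for t
    proof
      assume "gate_name m W a t \<in> fst ` set (gates_from (Suc a))"
      then consider "gate_name m W a t \<le> 2"
        | b t' where "Suc a \<le> b" "b < 2 ^ m" "t' < length (template (\<phi>s b))" "gate_name m W a t = gate_name m W b t'"
        by (auto simp: names_from)
      then show False
      proof cases
        case 1
        then show False using gate_name_ge[OF m, of W a t] by simp
      next
        case 2
        then show False
          using gate_name_inj[OF 2(4)] W[of a] W[of b] step.hyps that by auto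
      qed
    qed
  qed (use names_template W step.hyps in auto)
  then show ?case
    using step by (simp add: gates_from_Cons topo_append)
qed

lemma label_ok_from: "g \<in> set (gates_from a) \<Longrightarrow> label_ok g"
proof -
  assume g: "g \<in> set (gates_from a)"
  have "label_ok (inst b t)" if "t \<in> set (template (\<phi>s b))" for b t
    using arity_template[OF that] by (cases t) (auto simp: arity_ok_def label_ok_def)
  then show ?thesis
    using g by (auto simp: gates_from_def group_def consts_part_def) (auto simp: label_ok_def)
qed

abbreviation "val \<equiv> vals (gates_from 0)"

lemma val_eq: "(n, l, ps) \<in> set (gates_from 0) \<Longrightarrow> val n = gval l (map val (sort ps))"
  using topo_vals[OF topo_from] by simp

lemma val_consts: "val 1 = bset False" "val 2 = bset True"
proof -
  have mem: "set consts_part \<subseteq> set (gates_from 0)" by (simp add: gates_from_def)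
  have 0: "val 0 = {0}" using val_eq[of 0 "Input 0" "[]"] mem by (simp add: consts_part_def)
  show 1: "val 1 = bset False"
    using val_eq[of 1 "Gate Divide" "[0, 0]"] mem 0 by (simp add: consts_part_def bset_def)
  show "val 2 = bset True"
    using val_eq[of 2 "Gate Neg" "[1]"] mem 1 by (simp add: consts_part_def bset_def)
qed

text \<open>Groups with larger \<open>a\<close> are evaluated earlier, so the induction is on
  \<open>2 ^ m - a\<close>; \<open>P\<close> is any solution of the recurrence given by the
  formulas.\<close>

lemma val_group:
  assumes P: "\<And>a i. a < 2 ^ m \<Longrightarrow> i < length (\<phi>s a) \<Longrightarrow>
      P a i \<longleftrightarrow> feval (\<lambda>r. case r of Const n \<Rightarrow> n = 2 | Ref k s \<Rightarrow> P (a + off k) s) (\<phi>s a ! i)"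
  shows "a < 2 ^ m \<Longrightarrow> i < length (\<phi>s a) \<Longrightarrow> val (gate_name m W a i) = bset (P a i)"
proof (induction "2 ^ m - a" arbitrary: a i rule: less_induct)
  case less
  have "val (ref_name a (Ref 0 i)) =
      bset (feval (\<lambda>r. case r of Const n \<Rightarrow> n = 2 | Ref k s \<Rightarrow> P (a + off k) s) (\<phi>s a ! i))"
  proof (rule template_value)
    fix t o' rs
    assume "(t, o', rs) \<in> set (template (\<phi>s a))"
    then have "(gate_name m W a t, Gate o', map (ref_name a) rs) \<in> set (group a)"
      by (force simp: group_def)
    then show "val (ref_name a (Ref 0 t)) = gval (Gate o') (map val (sort (map (ref_name a) rs)))"
      using less.prems(1) by (intro val_eq[of _ "Gate o'"]) (auto simp: gates_from_def off0)
  next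
    fix p r
    assume "p \<in> set (\<phi>s a)" "r \<in> fvars p"
    note v = vars[OF less.prems(1) this]
    show "val (ref_name a r) = bset (case r of Const n \<Rightarrow> n = 2 | Ref k s \<Rightarrow> P (a + off k) s)"
    proof (cases r)
      case (Const n)
      then show ?thesis using v val_consts by auto
    next
      case (Ref k s)
      then show ?thesis using v less.hyps[of "a + off k" s] less.prems(1) by auto
    qed
  qed (use less.prems in auto)
  then show ?case using P[OF less.prems] by (simp add: off0)
qed

text \<open>The output set is empty or \<open>UNIV\<close>, so the queried number \<open>b\<close>
  is arbitrary.\<close>

lemma circuit_correct:
  assumes P: "\<And>a i. a < 2 ^ m \<Longrightarrow> i < length (\<phi>s a) \<Longrightarrow>
      P a i \<longleftrightarrow> feval (\<lambda>r. case r of Const n \<Rightarrow> n = 2 | Ref k s \<Rightarrow> P (a + off k) s) (\<phi>s a ! i)"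
    and i: "i < length (\<phi>s 0)"
  shows "is_circuit {Neg, Divide} (gate_name m W 0 i, gates_from 0)"
    and "b \<in> circuit_value (gate_name m W 0 i, gates_from 0) \<longleftrightarrow> P 0 i"
proof -
  have "i < length (template (\<phi>s 0))" using i by (simp add: length_template)
  then have "gate_name m W 0 i \<in> fst ` set (gates_from 0)"
    by (auto simp: names_from intro!: bexI[of _ 0])
  then show "is_circuit {Neg, Divide} (gate_name m W 0 i, gates_from 0)"
    using topo_from label_ok_from by (intro topo_is_circuit) auto
  show "b \<in> circuit_value (gate_name m W 0 i, gates_from 0) \<longleftrightarrow> P 0 i"
    using val_group[OF P, of 0 i] i by (simp add: circuit_value_def bset_def)
qed

end

section \<open>Programs that write gates\<close>

text \<open>\<open>Cell A\<close> holds one bit for each track, \<open>j \<in> A\<close> being the bit of track \<open>j\<close>; counters are stored least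
  significant bit first.  The bit of \<open>Mark\<close>, at the left end, records that the writing of row 0 has begun.\<close>

datatype wsym = Blank | Mark bool | Cell "nat set"

definition tape :: "bool \<Rightarrow> nat set list \<Rightarrow> nat \<Rightarrow> wsym" where
  "tape f As = (\<lambda>i. if i = 0 then Mark f else if i \<le> length As then Cell (As ! (i - 1)) else Blank)"

lemma tape_0 [simp]: "tape f As 0 = Mark f"
  by (simp add: tape_def)

lemma tape_upd_0 [simp]: "(tape f As)(0 := Mark g) = tape g As"
  by (auto simp: tape_def)

lemma tape_end: "tape f As (Suc (length As)) = Blank"
  by (simp add: tape_def)

lemma tape_mid: "tape f (Ps @ A # Qs) (Suc (length Ps)) = Cell A"
  by (simp add: tape_def)

lemma tape_upd_mid: "(tape f (Ps @ A # Qs))(Suc (length Ps) := Cell A') = tape f (Ps @ A' # Qs)"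
proof
  fix i
  show "((tape f (Ps @ A # Qs))(Suc (length Ps) := Cell A')) i = tape f (Ps @ A' # Qs) i"
    by (cases i) (auto simp: tape_def nth_append nth_Cons')
qed

lemma tape_upd_end: "(tape f Ps)(Suc (length Ps) := Cell A) = tape f (Ps @ [A])"
proof
  fix i
  show "((tape f Ps)(Suc (length Ps) := Cell A)) i = tape f (Ps @ [A]) i"
    by (cases i) (auto simp: tape_def nth_append)
qed

section \<open>Elementary programs and their execution\<close>

definition goR :: "wsym prog" where "goR = Basic (\<lambda>x s. (0, s, 1, None))"
definition goL :: "wsym prog" where "goL = Basic (\<lambda>x s. (0, s, -1, None))"
definition inR :: "wsym prog" where "inR = Basic (\<lambda>x s. (1, s, 0, None))"
definition inL :: "wsym prog" where "inL = Basic (\<lambda>x s. (-1, s, 0, None))"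
definition out1 :: "(wsym \<Rightarrow> bool) \<Rightarrow> wsym prog" where "out1 g = Basic (\<lambda>x s. (0, s, 0, Some (g s)))"
definition wr :: "(wsym \<Rightarrow> wsym) \<Rightarrow> wsym prog" where "wr g = Basic (\<lambda>x s. (0, g s, 0, None))"
definition seqs :: "wsym prog list \<Rightarrow> wsym prog" where "seqs cs = foldr Seq cs (wr id)"

lemma mv_1 [simp]: "mv h 1 = Suc h" and mv_m1 [simp]: "mv h (-1) = h - 1"
  by (simp_all add: mv_def nat_diff_distrib)

context
  fixes w :: "bool list" and B :: nat
begin

lemma exec_goR: "i \<le> length w + 1 \<Longrightarrow> Suc h \<le> B \<Longrightarrow> exec w B goR (i, T, h, out) (i, T, Suc h, out)"
  unfolding goR_def using exec_Basic[of _ w i T h 0 "T h" 1 None B out] by simp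

lemma exec_goL: "i \<le> length w + 1 \<Longrightarrow> h \<le> B \<Longrightarrow> exec w B goL (i, T, h, out) (i, T, h - 1, out)"
  unfolding goL_def using exec_Basic[of _ w i T h 0 "T h" "-1" None B out] by simp

lemma exec_inR: "i \<le> length w \<Longrightarrow> h \<le> B \<Longrightarrow> exec w B inR (i, T, h, out) (Suc i, T, h, out)"
  unfolding inR_def using exec_Basic[of _ w i T h 1 "T h" 0 None B out] by simp

lemma exec_inL: "i \<le> length w + 1 \<Longrightarrow> h \<le> B \<Longrightarrow> exec w B inL (i, T, h, out) (i - 1, T, h, out)"
  unfolding inL_def using exec_Basic[of _ w i T h "-1" "T h" 0 None B out] by simp

lemma exec_out1: "i \<le> length w + 1 \<Longrightarrow> h \<le> B \<Longrightarrow> exec w B (out1 g) (i, T, h, out) (i, T, h, out @ [g (T h)])"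
  unfolding out1_def using exec_Basic[of _ w i T h 0 "T h" 0 "Some (g (T h))" B out] by simp

lemma exec_wr: "i \<le> length w + 1 \<Longrightarrow> h \<le> B \<Longrightarrow> exec w B (wr g) (i, T, h, out) (i, T(h := g (T h)), h, out)"
  unfolding wr_def using exec_Basic[of _ w i T h 0 "g (T h)" 0 None B out] by simp

lemma exec_skip: "i \<le> length w + 1 \<Longrightarrow> h \<le> B \<Longrightarrow> exec w B (wr id) (i, T, h, out) (i, T, h, out)"
  using exec_wr[of i h id T out] by simp

lemma exec_rewind:
  "i \<le> length w + 1 \<Longrightarrow> h \<le> B \<Longrightarrow> exec w B (While (\<lambda>_ s. \<not> (\<exists>f. s = Mark f)) goL) (i, tape f As, h, out) (i, tape f As, 0, out)"
proof (induction h)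
  case 0
  show ?case by (rule exec_WhileF) simp
next
  case (Suc h)
  have "exec w B goL (i, tape f As, Suc h, out) (i, tape f As, h, out)"
    using exec_goL[of i "Suc h"] Suc.prems by simp
  then show ?case
    using Suc by (intro exec_WhileT[OF _ _ Suc.IH]) (auto simp: tape_def)
qed

end

definition rewind :: "wsym prog" where
  "rewind = While (\<lambda>_ s. \<not> (\<exists>f. s = Mark f)) goL"

text \<open>Printing starts and ends with the work head on the mark and alters neither tape nor
  input position, so pieces can be concatenated freely.\<close>

definition prints :: "bool list \<Rightarrow> nat \<Rightarrow> bool \<Rightarrow> nat set list \<Rightarrow> wsym prog \<Rightarrow> bool list \<Rightarrow> bool" where
  "prints w B f As c xs \<longleftrightarrow> (\<forall>i out. i \<le> length w + 1 \<longrightarrow>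
     exec w B c (i, tape f As, 0, out) (i, tape f As, 0, out @ xs))"

lemma prints_Seq: "prints w B f As c xs \<Longrightarrow> prints w B f As d ys \<Longrightarrow> prints w B f As (Seq c d) (xs @ ys)"
  unfolding prints_def by (simp flip: append_assoc) (blast intro: exec_Seq)

lemma prints_seqs:
  "(\<And>x. x \<in> set xs \<Longrightarrow> prints w B f As (p x) (q x)) \<Longrightarrow> prints w B f As (seqs (map p xs)) (concat (map q xs))"
proof (induction xs)
  case Nil
  then show ?case by (simp add: seqs_def prints_def exec_skip)
next
  case (Cons x xs)
  then show ?case using prints_Seq[of w B f As "p x" "q x"] by (simp add: seqs_def)
qed

definition enc_syms :: "sym list \<Rightarrow> bool list" where
  "enc_syms xs = concat (map (fixed4 \<circ> symidx) xs)"

lemma enc_syms_append [simp]: "enc_syms (xs @ ys) = enc_syms xs @ enc_syms ys"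
  by (simp add: enc_syms_def)

lemma enc_syms_Nil [simp]: "enc_syms [] = []"
  by (simp add: enc_syms_def)

lemma enc_syms_concat: "enc_syms (concat xss) = concat (map enc_syms xss)"
  by (induction xss) auto

lemma enc_syms_Bit: "enc_syms [Bit b] = [False, False, False, b]"
  by (cases b) (simp_all add: enc_syms_def fixed4_def)

definition emit :: "sym list \<Rightarrow> wsym prog" where
  "emit xs = seqs (map (\<lambda>b. out1 (\<lambda>_. b)) (enc_syms xs))"

lemma prints_emit: "prints w B f As (emit xs) (enc_syms xs)"
proof -
  have "prints w B f As (seqs (map (\<lambda>b. out1 (\<lambda>_. b)) bs)) (concat (map (\<lambda>b. [b]) bs))" for bs
    by (rule prints_seqs) (use exec_out1 in \<open>force simp: prints_def\<close>)
  then show ?thesis by (simp add: emit_def)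
qed

definition col :: "nat \<Rightarrow> nat set list \<Rightarrow> bool list" where
  "col j As = map (\<lambda>A. j \<in> A) As"

definition read_tracks :: "nat list \<Rightarrow> nat set list \<Rightarrow> bool list" where
  "read_tracks js As = concat (map (\<lambda>j. col j As) js)"

definition mem_cell :: "nat \<Rightarrow> wsym \<Rightarrow> bool" where
  "mem_cell j s = (case s of Cell A \<Rightarrow> j \<in> A | _ \<Rightarrow> False)"

text \<open>Three \<open>False\<close> followed by the stored bit form the four-bit code of a
  \<open>Bit\<close> symbol.\<close>

definition print_col :: "nat \<Rightarrow> wsym prog" where
  "print_col j = Seq goR (Seq (While (\<lambda>_ s. s \<noteq> Blank)
     (Seq (out1 (\<lambda>_. False)) (Seq (out1 (\<lambda>_. False)) (Seq (out1 (\<lambda>_. False)) (Seq (out1 (mem_cell j)) goR))))) rewind)"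

lemma prints_print_col:
  assumes B: "Suc (length As) \<le> B"
  shows "prints w B f As (print_col j) (enc_syms (map Bit (col j As)))"
proof -
  define body where "body = Seq (out1 (\<lambda>_. False)) (Seq (out1 (\<lambda>_. False)) (Seq (out1 (\<lambda>_. False)) (Seq (out1 (mem_cell j)) goR)))"
  have loop: "exec w B (While (\<lambda>_ s. s \<noteq> Blank) body) (i, tape f (Ps @ Qs), Suc (length Ps), out)
     (i, tape f (Ps @ Qs), Suc (length Ps + length Qs), out @ enc_syms (map Bit (col j Qs)))"
    if i: "i \<le> length w + 1" and "Suc (length Ps + length Qs) \<le> B" for i Ps Qs out
    using that(2)
  proof (induction Qs arbitrary: Ps out)
    case Nil
    then show ?case using exec_WhileF[of "\<lambda>_ s. s \<noteq> Blank" w i "tape f Ps" "Suc (length Ps)" B body out]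
      by (simp add: tape_end col_def)
  next
    case (Cons A Qs)
    let ?T = "tape f (Ps @ A # Qs)" and ?h = "Suc (length Ps)"
    have "exec w B body (i, ?T, ?h, out) (i, ?T, Suc ?h, (((out @ [False]) @ [False]) @ [False]) @ [mem_cell j (?T ?h)])"
      unfolding body_def using Cons.prems i
      by (intro exec_Seq[OF exec_out1] exec_Seq[OF exec_out1] exec_Seq[OF exec_out1] exec_Seq[OF exec_out1] exec_goR) auto
    moreover have "exec w B (While (\<lambda>_ s. s \<noteq> Blank) body) (i, ?T, Suc ?h, out @ [False, False, False, j \<in> A])
      (i, ?T, Suc (length Ps + length (A # Qs)), (out @ [False, False, False, j \<in> A]) @ enc_syms (map Bit (col j Qs)))"
      using Cons.IH[of "Ps @ [A]" "out @ [False, False, False, j \<in> A]"] Cons.prems by simp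
    moreover have "enc_syms (map Bit (col j (A # Qs))) = [False, False, False, j \<in> A] @ enc_syms (map Bit (col j Qs))"
      using enc_syms_append[of "[Bit (j \<in> A)]"] by (simp add: col_def enc_syms_Bit)
    ultimately show ?case
      by (intro exec_WhileT[of _ w i ?T ?h]) (auto simp: tape_mid mem_cell_def)
  qed
  have "exec w B (print_col j) (i, tape f As, 0, out) (i, tape f As, 0, out @ enc_syms (map Bit (col j As)))"
    if i: "i \<le> length w + 1" for i out
    unfolding print_col_def body_def[symmetric] rewind_def
    using loop[OF i, of "[]" As out] B i by (intro exec_Seq[OF exec_goR] exec_Seq[OF _ exec_rewind]) auto
  then show ?thesis by (simp add: prints_def)
qed

lemma prints_print_tracks:
  "Suc (length As) \<le> B \<Longrightarrow> prints w B f As (seqs (map print_col js)) (enc_syms (map Bit (read_tracks js As)))"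
  using prints_seqs[of js w B f As print_col "\<lambda>j. enc_syms (map Bit (col j As))"]
  by (simp add: prints_print_col read_tracks_def map_concat enc_syms_concat comp_def)

text \<open>One column has only as many bits as there are cells; reading \<open>2 * e\<close>
  columns one after the other gives a counter of \<open>2 * e * L\<close> bits without lengthening
  the tape.\<close>

definition tracks :: "nat \<Rightarrow> nat \<Rightarrow> nat list" where
  "tracks e k = map (\<lambda>j. 2 * e * k + j) [0..<2 * e]"

definition print_name :: "nat \<Rightarrow> nat \<Rightarrow> nat \<Rightarrow> nat \<Rightarrow> wsym prog" where
  "print_name e W k s = Seq (emit [Bit True]) (Seq (seqs (map print_col (tracks e k))) (emit (map Bit (bits W s))))"

fun print_ref :: "nat \<Rightarrow> nat \<Rightarrow> tref \<Rightarrow> wsym prog" where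
  "print_ref e W (Const n) = emit (enc_nat n)"
| "print_ref e W (Ref k s) = print_name e W k s"

fun print_gate :: "nat \<Rightarrow> nat \<Rightarrow> tgate \<Rightarrow> wsym prog" where
  "print_gate e W (s, o', rs) = Seq (emit [Open]) (Seq (print_name e W 0 s) (Seq (emit [Comma, OpSym o', Comma, Open])
     (Seq (seqs (map (\<lambda>r. Seq (print_ref e W r) (emit [Comma])) rs)) (emit [Close, Close]))))"

definition print_template :: "nat \<Rightarrow> nat \<Rightarrow> fm list \<Rightarrow> wsym prog" where
  "print_template e W ps = seqs (map (print_gate e W) (template ps))"

lemma enc_nat_gate_name: "enc_nat (gate_name m W a s) = [Bit True] @ map Bit (bits m a) @ map Bit (bits W s)"
  by (simp add: enc_nat_def bin_gate_name)

context gate_groups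
begin

context
  fixes e :: nat and As :: "nat set list" and B a :: nat
  assumes B: "Suc (length As) \<le> B" and off0: "off 0 = 0"
begin

lemma prints_name:
  "read_tracks (tracks e k) As = bits m (a + off k) \<Longrightarrow>
     prints w B f As (print_name e W k s) (enc_syms (enc_nat (gate_name m W (a + off k) s)))"
  unfolding enc_nat_gate_name enc_syms_append print_name_def
  by (intro prints_Seq prints_emit) (use prints_print_tracks[OF B, of w f "tracks e k"] in simp)

lemma prints_ref:
  "(\<And>k s. r = Ref k s \<Longrightarrow> read_tracks (tracks e k) As = bits m (a + off k)) \<Longrightarrow>
     prints w B f As (print_ref e W r) (enc_syms (enc_nat (ref_name a r)))"
  by (cases r) (simp_all add: prints_emit prints_name)

lemma prints_gate:
  assumes "read_tracks (tracks e 0) As = bits m a"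
    and "\<And>k s. Ref k s \<in> set (snd (snd g)) \<Longrightarrow> read_tracks (tracks e k) As = bits m (a + off k)"
  shows "prints w B f As (print_gate e W g) (enc_syms (enc_gate (inst a g)))"
proof -
  obtain s o' rs where g: "g = (s, o', rs)" by (cases g)
  have enc: "enc_gate (inst a (s, o', rs)) = [Open] @ enc_nat (gate_name m W (a + off 0) s) @ [Comma, OpSym o', Comma, Open]
      @ concat (map (\<lambda>r. enc_nat (ref_name a r) @ [Comma]) rs) @ [Close, Close]"
    by (simp add: off0 comp_def)
  have "prints w B f As (seqs (map (\<lambda>r. Seq (print_ref e W r) (emit [Comma])) rs))
     (concat (map (\<lambda>r. enc_syms (enc_nat (ref_name a r)) @ enc_syms [Comma]) rs))"
    using assms(2) g by (intro prints_seqs prints_Seq prints_ref prints_emit) auto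
  then have "prints w B f As (seqs (map (\<lambda>r. Seq (print_ref e W r) (emit [Comma])) rs))
     (enc_syms (concat (map (\<lambda>r. enc_nat (ref_name a r) @ [Comma]) rs)))"
    by (simp add: enc_syms_concat comp_def)
  then show ?thesis
    unfolding g enc enc_syms_append print_gate.simps using assms(1)
    by (intro prints_Seq prints_emit prints_name) (simp_all add: off0)
qed

lemma prints_template:
  assumes "read_tracks (tracks e 0) As = bits m a"
    and "\<And>k s p. p \<in> set (\<phi>s a) \<Longrightarrow> Ref k s \<in> fvars p \<Longrightarrow> read_tracks (tracks e k) As = bits m (a + off k)"
  shows "prints w B f As (print_template e W (\<phi>s a)) (enc_syms (concat (map enc_gate (group a))))"
proof -
  have "prints w B f As (print_template e W (\<phi>s a)) (concat (map (\<lambda>g. enc_syms (enc_gate (inst a g))) (template (\<phi>s a))))"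
    unfolding print_template_def
  proof (intro prints_seqs prints_gate assms(1))
    show "read_tracks (tracks e k) As = bits m (a + off k)"
      if "g \<in> set (template (\<phi>s a))" "Ref k s \<in> set (snd (snd g))" for g k s
    proof -
      obtain t o' rs where "g = (t, o', rs)" by (cases g)
      then have "Ref k s \<in> \<Union> (fvars ` set (\<phi>s a)) \<or> k = 0"
        using refs_template[of t o' rs "\<phi>s a" "Ref k s"] that by auto
      then show ?thesis using assms by (auto simp: off0)
    qed
  qed
  then show ?thesis by (simp add: group_def enc_syms_concat comp_def)
qed

end

end

section \<open>Counters and the circuit-writing program\<close>

fun incb :: "bool list \<Rightarrow> bool list" where
  "incb [] = []"
| "incb (b # bs) = (if b then False # incb bs else True # bs)"

lemma incb_append: "incb (xs @ ys) = (if \<forall>b\<in>set xs. b then incb xs @ incb ys else incb xs @ ys)"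
  by (induction xs) auto

lemma incb_bits: "incb (bits m a) = bits m (Suc a)"
  by (induction m arbitrary: a) auto

text \<open>Turns the overflow of an increment into a statement about the counter value; the exits
  of both writing loops rest on it.\<close>

lemma all_bits: "a < 2 ^ m \<Longrightarrow> (\<forall>b\<in>set (bits m a). b) \<longleftrightarrow> Suc a = 2 ^ m"
proof (induction m arbitrary: a)
  case (Suc m)
  have "(\<forall>b\<in>set (bits (Suc m) a). b) \<longleftrightarrow> odd a \<and> Suc (a div 2) = 2 ^ m"
    using Suc by simp
  also have "\<dots> \<longleftrightarrow> Suc a = 2 ^ Suc m"
    by (auto elim!: oddE) (metis dvd_triv_left even_Suc odd_two_times_div_two_succ add.commute plus_1_eq_Suc)
  finally show ?case .
qed simp

fun incA :: "nat \<Rightarrow> nat set list \<Rightarrow> nat set list" where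
  "incA j [] = []"
| "incA j (A # As) = (if j \<in> A then (A - {j}) # incA j As else insert j A # As)"

text \<open>The next track is more significant and receives a carry only if the current one consists
  of ones.\<close>

fun incAs :: "nat list \<Rightarrow> nat set list \<Rightarrow> nat set list" where
  "incAs [] As = As"
| "incAs (j # js) As = (if \<forall>A\<in>set As. j \<in> A then incAs js (incA j As) else incA j As)"

lemma length_incA [simp]: "length (incA j As) = length As"
  by (induction As) auto

lemma length_incAs [simp]: "length (incAs js As) = length As"
  by (induction js arbitrary: As) auto

lemma col_incA: "col j (incA j As) = incb (col j As)"
  by (induction As) (auto simp: col_def)

lemma col_incA_other: "i \<noteq> j \<Longrightarrow> col i (incA j As) = col i As"
  by (induction As) (auto simp: col_def)

lemma read_tracks_incA_other: "j \<notin> set js \<Longrightarrow> read_tracks js (incA j As) = read_tracks js As"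
  by (induction js) (auto simp: read_tracks_def col_incA_other)

lemma read_tracks_Nil [simp]: "read_tracks [] As = []"
  by (simp add: read_tracks_def)

lemma read_tracks_Cons [simp]: "read_tracks (j # js) As = col j As @ read_tracks js As"
  by (simp add: read_tracks_def)

lemma read_tracks_incAs_other: "set js \<inter> set ks = {} \<Longrightarrow> read_tracks ks (incAs js As) = read_tracks ks As"
  by (induction js arbitrary: As) (auto simp: read_tracks_incA_other)

lemma all_col: "(\<forall>b\<in>set (col j As). b) \<longleftrightarrow> (\<forall>A\<in>set As. j \<in> A)"
  by (simp add: col_def)

lemma read_tracks_incAs: "distinct js \<Longrightarrow> read_tracks js (incAs js As) = incb (read_tracks js As)"
proof (induction js arbitrary: As)
  case (Cons j js)
  show ?case
  proof (cases "\<forall>A\<in>set As. j \<in> A")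
    case True
    have "col j (incAs js (incA j As)) = col j (incA j As)"
      using read_tracks_incAs_other[of js "[j]" "incA j As"] Cons.prems by simp
    then show ?thesis
      using Cons True by (simp add: incb_append all_col col_incA read_tracks_incA_other)
  next
    case False
    then show ?thesis
      using Cons.prems by (auto simp: incb_append all_col col_incA read_tracks_incA_other)
  qed
qed simp

definition clr :: "nat \<Rightarrow> wsym \<Rightarrow> wsym" where
  "clr j s = (case s of Cell A \<Rightarrow> Cell (A - {j}) | _ \<Rightarrow> s)"

definition put :: "nat \<Rightarrow> wsym \<Rightarrow> wsym" where
  "put j s = (case s of Cell A \<Rightarrow> Cell (insert j A) | _ \<Rightarrow> s)"

definition remark :: "(bool \<Rightarrow> bool) \<Rightarrow> wsym \<Rightarrow> wsym" where
  "remark g s = (case s of Mark f \<Rightarrow> Mark (g f) | _ \<Rightarrow> s)"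

definition carry :: "nat \<Rightarrow> wsym prog" where
  "carry j = While (\<lambda>_. mem_cell j) (Seq (wr (clr j)) goR)"

definition cleared :: "nat \<Rightarrow> nat set list \<Rightarrow> nat set list" where
  "cleared j As = map (\<lambda>A. A - {j}) (takeWhile (\<lambda>A. j \<in> A) As)"

lemma exec_carry:
  assumes i: "i \<le> length w + 1"
  shows "Suc (length Ps + length Qs) \<le> B \<Longrightarrow>
    exec w B (carry j) (i, tape f (Ps @ Qs), Suc (length Ps), out)
      (i, tape f (Ps @ cleared j Qs @ dropWhile (\<lambda>A. j \<in> A) Qs), Suc (length (Ps @ cleared j Qs)), out)"
proof (induction Qs arbitrary: Ps)
  case Nil
  then show ?case using exec_WhileF[of "\<lambda>_. mem_cell j" w i "tape f Ps" "Suc (length Ps)"]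
    by (simp add: carry_def cleared_def tape_end mem_cell_def)
next
  case (Cons A Qs)
  let ?T = "tape f (Ps @ A # Qs)" and ?h = "Suc (length Ps)"
  show ?case
  proof (cases "j \<in> A")
    case False
    then show ?thesis using exec_WhileF[of "\<lambda>_. mem_cell j" w i ?T ?h]
      by (simp add: carry_def cleared_def tape_mid mem_cell_def)
  next
    case True
    have "exec w B (Seq (wr (clr j)) goR) (i, ?T, ?h, out) (i, ?T(?h := clr j (?T ?h)), Suc ?h, out)"
      using Cons.prems i by (intro exec_Seq[OF exec_wr] exec_goR) auto
    then have "exec w B (Seq (wr (clr j)) goR) (i, ?T, ?h, out) (i, tape f (Ps @ (A - {j}) # Qs), Suc ?h, out)"
      by (simp add: tape_mid clr_def tape_upd_mid)
    moreover have "exec w B (carry j) (i, tape f (Ps @ (A - {j}) # Qs), Suc ?h, out)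
      (i, tape f (Ps @ cleared j (A # Qs) @ dropWhile (\<lambda>A. j \<in> A) (A # Qs)), Suc (length (Ps @ cleared j (A # Qs))), out)"
      using Cons.IH[of "Ps @ [A - {j}]"] Cons.prems True by (simp add: cleared_def)
    ultimately show ?thesis
      using True unfolding carry_def by (intro exec_WhileT[of _ w i ?T ?h]) (auto simp: tape_mid mem_cell_def)
  qed
qed

lemma incA_cleared:
  "incA j As = cleared j As @ (case dropWhile (\<lambda>A. j \<in> A) As of [] \<Rightarrow> [] | A # Ts \<Rightarrow> insert j A # Ts)"
  by (induction As) (auto simp: cleared_def)

text \<open>The case \<open>[]\<close> is reached exactly when the carry has passed through all
  tracks, and only then \<open>g\<close> is applied to the mark. Overflow thereby becomes visible to
  a loop guard at the left end.\<close>

fun inc_prog :: "(bool \<Rightarrow> bool) \<Rightarrow> nat list \<Rightarrow> wsym prog" where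
  "inc_prog g [] = wr (remark g)"
| "inc_prog g (j # js) = Seq goR (Seq (carry j) (Cond (\<lambda>_ s. s = Blank)
     (Seq rewind (inc_prog g js)) (Seq (wr (put j)) rewind)))"

lemma exec_inc_prog:
  assumes i: "i \<le> length w + 1"
  shows "distinct js \<Longrightarrow> Suc (length As) \<le> B \<Longrightarrow>
    exec w B (inc_prog g js) (i, tape f As, 0, out)
      (i, tape (if \<forall>b\<in>set (read_tracks js As). b then g f else f) (incAs js As), 0, out)"
proof (induction js arbitrary: As)
  case Nil
  then show ?case using exec_wr[OF i, of 0 B "remark g" "tape f As" out] by (simp add: remark_def)
next
  case (Cons j js)
  have "exec w B goR (i, tape f As, 0, out) (i, tape f As, 1, out)"
    using exec_goR[OF i, of 0] Cons.prems by simp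
  moreover
  let ?T = "tape f (cleared j As @ dropWhile (\<lambda>A. j \<in> A) As)" and ?h = "Suc (length (cleared j As))"
  have "exec w B (carry j) (i, tape f As, 1, out) (i, ?T, ?h, out)"
    using exec_carry[OF i, of "[]" As B j f out] Cons.prems by simp
  moreover have h: "?h \<le> B"
    using Cons.prems(2) length_takeWhile_le[of "\<lambda>A. j \<in> A" As] by (simp add: cleared_def)
  have "exec w B (Cond (\<lambda>_ s. s = Blank) (Seq rewind (inc_prog g js)) (Seq (wr (put j)) rewind)) (i, ?T, ?h, out)
      (i, tape (if \<forall>b\<in>set (read_tracks (j # js) As). b then g f else f) (incAs (j # js) As), 0, out)"
  proof (cases "dropWhile (\<lambda>A. j \<in> A) As")
    case Nil
    then have all: "\<forall>A\<in>set As. j \<in> A" by (simp add: dropWhile_eq_Nil_conv)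
    have T: "?T = tape f (incA j As)" using Nil by (simp add: incA_cleared del: dropWhile_eq_Nil_conv)
    have len: "length (cleared j As) = length As" using all by (simp add: cleared_def takeWhile_eq_all_conv[THEN iffD2])
    have "exec w B (Seq rewind (inc_prog g js)) (i, ?T, ?h, out)
       (i, tape (if \<forall>b\<in>set (read_tracks js (incA j As)). b then g f else f) (incAs js (incA j As)), 0, out)"
      unfolding T rewind_def using h Cons.prems by (intro exec_Seq[OF exec_rewind[OF i] Cons.IH]) auto
    moreover have "read_tracks js (incA j As) = read_tracks js As" using Cons.prems by (simp add: read_tracks_incA_other)
    moreover have "?T ?h = Blank" using Nil tape_end[of f "cleared j As"] by (simp del: dropWhile_eq_Nil_conv)
    ultimately show ?thesis using all by (intro exec_CondT) (auto simp: all_col ball_Un)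
  next
    case (Cons A Ts)
    then have ex: "\<not> (\<forall>A\<in>set As. j \<in> A)" by (metis dropWhile_eq_Nil_conv list.distinct(1))
    have "exec w B (Seq (wr (put j)) rewind) (i, ?T, ?h, out) (i, tape f (incA j As), 0, out)"
    proof (rule exec_Seq)
      show "exec w B (wr (put j)) (i, ?T, ?h, out) (i, ?T(?h := put j (?T ?h)), ?h, out)"
        using exec_wr[OF i h] .
      have "?T(?h := put j (?T ?h)) = tape f (incA j As)"
        by (simp add: Cons tape_mid put_def tape_upd_mid incA_cleared)
      then show "exec w B rewind (i, ?T(?h := put j (?T ?h)), ?h, out) (i, tape f (incA j As), 0, out)"
        using exec_rewind[OF i h] by (simp add: rewind_def)
    qed
    moreover have "?T ?h \<noteq> Blank" by (simp add: Cons tape_mid)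
    ultimately show ?thesis using ex by (intro exec_CondF) (auto simp: all_col ball_Un)
  qed
  ultimately show ?case
    unfolding inc_prog.simps by (intro exec_Seq)
qed

section \<open>Measuring the logarithm of the input length\<close>

fun grow :: "nat set list \<Rightarrow> nat set list" where
  "grow [] = [{0}]"
| "grow (A # As) = (if 0 \<in> A then (A - {0}) # grow As else insert 0 A # As)"

fun count :: "nat set list \<Rightarrow> nat" where
  "count [] = 0"
| "count (A # As) = of_bool (0 \<in> A) + 2 * count As"

lemma count_grow: "count (grow As) = Suc (count As)"
  by (induction As) auto

lemma count_less: "count As < 2 ^ length As"
  by (induction As) auto

lemma length_grow: "length As \<le> length (grow As)" "grow As \<noteq> []"
  by (induction As) auto

lemma last_grow: "(As \<noteq> [] \<longrightarrow> 0 \<in> last As) \<Longrightarrow> 0 \<in> last (grow As)"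
proof (induction As)
  case (Cons A As)
  then show ?case using length_grow(2)[of As] by (cases As) auto
qed simp

lemma count_ge: "As \<noteq> [] \<Longrightarrow> 0 \<in> last As \<Longrightarrow> 2 ^ (length As - 1) \<le> count As"
proof (induction As)
  case (Cons A As)
  then show ?case by (cases As) (auto split: if_splits)
qed simp

lemma grow_cleared:
  "grow As = cleared 0 As @ (case dropWhile (\<lambda>A. 0 \<in> A) As of [] \<Rightarrow> [{0}] | A # Ts \<Rightarrow> insert 0 A # Ts)"
  by (induction As) (auto simp: cleared_def)

definition put0 :: "wsym \<Rightarrow> wsym" where
  "put0 s = (case s of Cell A \<Rightarrow> Cell (insert 0 A) | _ \<Rightarrow> Cell {0})"

definition grow_prog :: "wsym prog" where
  "grow_prog = Seq goR (Seq (carry 0) (Seq (wr put0) rewind))"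

lemma exec_grow_prog:
  assumes i: "i \<le> length w + 1" and B: "Suc (length As) \<le> B"
  shows "exec w B grow_prog (i, tape f As, 0, out) (i, tape f (grow As), 0, out)"
proof -
  let ?T = "tape f (cleared 0 As @ dropWhile (\<lambda>A. 0 \<in> A) As)" and ?h = "Suc (length (cleared 0 As))"
  have h: "?h \<le> B"
    using B length_takeWhile_le[of "\<lambda>A. 0 \<in> A" As] by (simp add: cleared_def)
  have "?T(?h := put0 (?T ?h)) = tape f (grow As)"
    by (cases "dropWhile (\<lambda>A. 0 \<in> A) As")
      (simp_all add: grow_cleared tape_end tape_mid put0_def tape_upd_mid tape_upd_end del: dropWhile_eq_Nil_conv)
  then have "exec w B (wr put0) (i, ?T, ?h, out) (i, tape f (grow As), ?h, out)"
    using exec_wr[OF i h, of put0 ?T out] by simp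
  moreover have "exec w B goR (i, tape f As, 0, out) (i, tape f As, 1, out)"
    using exec_goR[OF i, of 0] B by simp
  moreover have "exec w B (carry 0) (i, tape f As, 1, out) (i, ?T, ?h, out)"
    using exec_carry[OF i, of "[]" As B 0 f out] B by simp
  ultimately show ?thesis
    unfolding grow_prog_def rewind_def by (intro exec_Seq[OF _ exec_Seq[OF _ exec_Seq[OF _ exec_rewind[OF i h]]]])
qed

text \<open>The counter is lengthened when it overflows, so for positive \<open>k\<close> its length
  is the number of binary digits of \<open>k\<close>; no logarithm has to be computed.\<close>

definition counted :: "nat \<Rightarrow> nat set list" where
  "counted k = (grow ^^ k) []"

text \<open>The summand \<open>2\<close> gives at least two cells even for the empty input, from
  which the lower bounds on row length and name width follow.\<close>

definition ncells :: "bool list \<Rightarrow> nat" where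
  "ncells w = length (counted (length w + 2))"

lemma count_counted: "count (counted k) = k"
  by (induction k) (simp_all add: counted_def count_grow)

lemma counted_mono: "k \<le> k' \<Longrightarrow> length (counted k) \<le> length (counted k')"
  by (induction k' rule: dec_induct) (auto simp: counted_def intro: order_trans length_grow)

lemma counted_Suc: "counted (Suc k) = grow (counted k)"
  by (simp add: counted_def)

text \<open>The last cell always holds the leading digit 1, which bounds the count from below by a
  power of two.\<close>

lemma ncells_bounds:
  shows "length w + 2 < 2 ^ ncells w" and "2 ^ (ncells w - 1) \<le> length w + 2" and "2 \<le> ncells w"
proof -
  have top: "counted k \<noteq> [] \<longrightarrow> 0 \<in> last (counted k)" for k
    by (induction k) (auto simp: counted_Suc last_grow, simp add: counted_def)
  have ne: "counted (length w + 2) \<noteq> []"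
    by (simp add: counted_Suc length_grow)
  show 1: "length w + 2 < 2 ^ ncells w"
    using count_less[of "counted (length w + 2)"] by (simp add: ncells_def count_counted)
  show "2 ^ (ncells w - 1) \<le> length w + 2"
    using count_ge[OF ne] top ne by (simp add: ncells_def count_counted)
  show "2 \<le> ncells w"
  proof (rule ccontr)
    assume "\<not> 2 \<le> ncells w"
    then have "(2::nat) ^ ncells w \<le> 2 ^ 1" by (intro power_increasing) auto
    then show False using 1 by simp
  qed
qed

text \<open>The two initial \<open>grow_prog\<close> contribute the summand \<open>2\<close>; one
  more follows for each input symbol.\<close>

definition scan_prog :: "wsym prog" where
  "scan_prog = Seq (wr (\<lambda>_. Mark False)) (Seq grow_prog (Seq grow_prog (Seq inR
     (While (\<lambda>x _. x \<noteq> None) (Seq grow_prog inR)))))"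

lemma exec_scan_prog:
  assumes B: "B = Suc (ncells w)"
  shows "exec w B scan_prog (0, \<lambda>_. Blank, 0, out) (length w + 1, tape False (counted (length w + 2)), 0, out)"
proof -
  have lenB: "Suc (length (counted k)) \<le> B" if "k \<le> length w + 2" for k
    using counted_mono[OF that] by (simp add: B ncells_def)
  have g: "exec w B grow_prog (i, tape False (counted k), 0, out) (i, tape False (counted (Suc k)), 0, out)"
    if "i \<le> length w + 1" "k \<le> length w + 2" for i k
    unfolding counted_Suc using exec_grow_prog[OF that(1) lenB[OF that(2)]] .
  have loop: "exec w B (While (\<lambda>x _. x \<noteq> None) (Seq grow_prog inR)) (i, tape False (counted (Suc i)), 0, out)
     (length w + 1, tape False (counted (length w + 2)), 0, out)" if "i \<ge> 1" "i \<le> length w + 1" for i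
    using that(2,1)
  proof (induction i rule: inc_induct)
    case base
    then show ?case using exec_WhileF[of "\<lambda>x _. x \<noteq> None" w "length w + 1"] by (simp add: read_input_def)
  next
    case (step i)
    have "exec w B (Seq grow_prog inR) (i, tape False (counted (Suc i)), 0, out) (Suc i, tape False (counted (Suc (Suc i))), 0, out)"
      using step.hyps by (intro exec_Seq[OF g exec_inR]) auto
    then show ?case
      using step by (intro exec_WhileT[of _ w i]) (auto simp: read_input_def)
  qed
  have "(\<lambda>_. Blank)(0 := Mark False) = tape False (counted 0)"
    by (auto simp: tape_def counted_def)
  then have "exec w B (wr (\<lambda>_. Mark False)) (0, \<lambda>_. Blank, 0, out) (0, tape False (counted 0), 0, out)"
    using exec_wr[of 0 w 0 B "\<lambda>_. Mark False" "\<lambda>_. Blank" out] by simp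
  then show ?thesis
    unfolding scan_prog_def
    using g[of 0 0] g[of 0 1] exec_inR[of 0 w 0 B "tape False (counted 2)" out] loop[of 1]
    by (auto intro!: exec_Seq simp: numeral_2_eq_2)
qed

lemma bits_append: "a < 2 ^ p \<Longrightarrow> bits (p + q) (a + 2 ^ p * b) = bits p a @ bits q b"
proof (induction p arbitrary: a)
  case (Suc p)
  have "(a + 2 * 2 ^ p * b) div 2 = a div 2 + 2 ^ p * b" by simp
  then show ?case using Suc.IH[of "a div 2"] Suc.prems by simp
qed simp

lemma bits_0: "bits m 0 = replicate m False"
  by (induction m) auto

lemma bits_ones: "bits m (2 ^ m - 1) = replicate m True"
proof (induction m)
  case (Suc m)
  have "(2 * 2 ^ m - Suc 0) div 2 = 2 ^ m - (1 :: nat)" by (cases "(2::nat) ^ m") auto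
  moreover have "odd (2 * 2 ^ m - Suc 0 :: nat)" by simp
  ultimately show ?case using Suc by simp
qed simp

lemma bits_1: "bits (Suc m) 1 = True # replicate m False"
  by (simp add: bits_0)

text \<open>The initial values \<open>0\<close>, \<open>1\<close>, \<open>D\<close>, \<open>D - 1\<close> of the four counters: only the last one has bits set
  outside the first cell.\<close>

definition init_low :: "nat \<Rightarrow> nat set" where
  "init_low e = {2 * e * 3 ..< 2 * e * 3 + e}"

text \<open>In the first cell, track \<open>2 * e * 1\<close> is the bit of weight 1 of counter 1.
  Track \<open>2 * e * 2 + e\<close> of counter 2 starts at bit \<open>e * L\<close>, whose weight
  is \<open>D\<close>. The first \<open>e\<close> tracks of counter 3 are ones in every cell, which
  gives \<open>D - 1\<close>.\<close>

definition init_first :: "nat \<Rightarrow> nat set" where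
  "init_first e = insert (2 * e * 1) (insert (2 * e * 2 + e) (init_low e))"

definition fill_prog :: "nat \<Rightarrow> wsym prog" where
  "fill_prog e = Seq goR (Seq (wr (\<lambda>_. Cell (init_first e))) (Seq goR
     (Seq (While (\<lambda>_ s. s \<noteq> Blank) (Seq (wr (\<lambda>_. Cell (init_low e))) goR)) rewind)))"

definition init_cells :: "nat \<Rightarrow> nat \<Rightarrow> nat set list" where
  "init_cells e L = init_first e # replicate (L - 1) (init_low e)"

lemma exec_fill_prog:
  assumes i: "i \<le> length w + 1" and L: "1 \<le> length As" and B: "Suc (length As) \<le> B"
  shows "exec w B (fill_prog e) (i, tape f As, 0, out) (i, tape f (init_cells e (length As)), 0, out)"
proof -
  define body where "body = Seq (wr (\<lambda>_. Cell (init_low e))) goR"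
  have loop: "exec w B (While (\<lambda>_ s. s \<noteq> Blank) body) (i, tape f (Ps @ Qs), Suc (length Ps), out)
     (i, tape f (Ps @ replicate (length Qs) (init_low e)), Suc (length Ps + length Qs), out)"
    if "Suc (length Ps + length Qs) \<le> B" for Ps Qs
    using that
  proof (induction Qs arbitrary: Ps)
    case Nil
    then show ?case using exec_WhileF[of "\<lambda>_ s. s \<noteq> Blank" w i "tape f Ps" "Suc (length Ps)"]
      by (simp add: tape_end)
  next
    case (Cons A Qs)
    have "exec w B body (i, tape f (Ps @ A # Qs), Suc (length Ps), out)
        (i, (tape f (Ps @ A # Qs))(Suc (length Ps) := Cell (init_low e)), Suc (Suc (length Ps)), out)"
      unfolding body_def using Cons.prems i by (intro exec_Seq[OF exec_wr exec_goR]) auto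
    then show ?case
      using Cons.IH[of "Ps @ [init_low e]"] Cons.prems
      by (intro exec_WhileT[of _ w i "tape f (Ps @ A # Qs)" "Suc (length Ps)"]) (auto simp: tape_mid tape_upd_mid)
  qed
  obtain A Qs where As: "As = A # Qs" using L by (cases As) auto
  have 1: "exec w B goR (i, tape f As, 0, out) (i, tape f As, 1, out)"
    using exec_goR[OF i, of 0] B by simp
  have "(tape f As)(1 := Cell (init_first e)) = tape f (init_first e # Qs)"
    using tape_upd_mid[of f "[]" A Qs] by (simp add: As)
  then have 2: "exec w B (wr (\<lambda>_. Cell (init_first e))) (i, tape f As, 1, out) (i, tape f (init_first e # Qs), 1, out)"
    using exec_wr[OF i, of 1 B "\<lambda>_. Cell (init_first e)" "tape f As" out] B by simp
  have 3: "exec w B goR (i, tape f (init_first e # Qs), 1, out) (i, tape f (init_first e # Qs), 2, out)"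
    using exec_goR[OF i, of 1] B As by (simp add: numeral_2_eq_2)
  have 4: "exec w B (While (\<lambda>_ s. s \<noteq> Blank) body) (i, tape f (init_first e # Qs), 2, out)
     (i, tape f (init_cells e (length As)), Suc (length As), out)"
    using loop[of "[init_first e]" Qs] B As by (simp add: init_cells_def numeral_2_eq_2)
  have 5: "exec w B rewind (i, tape f (init_cells e (length As)), Suc (length As), out)
     (i, tape f (init_cells e (length As)), 0, out)"
    unfolding rewind_def by (rule exec_rewind[OF i B])
  show ?thesis
    unfolding fill_prog_def body_def[symmetric] by (rule exec_Seq[OF 1 exec_Seq[OF 2 exec_Seq[OF 3 exec_Seq[OF 4 5]]]])
qed

lemma distinct_tracks: "distinct (tracks e k)"
  by (simp add: tracks_def distinct_map inj_on_def)

lemma tracks_disjoint: "k \<noteq> k' \<Longrightarrow> set (tracks e k) \<inter> set (tracks e k') = {}"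
proof -
  assume "k \<noteq> k'"
  have False if "2 * e * k + j = 2 * e * k' + j'" "j < 2 * e" "j' < 2 * e" for j j'
  proof -
    have "(2 * e * k + j) div (2 * e) = k" "(2 * e * k' + j') div (2 * e) = k'"
      using that(2,3) by simp_all
    then show False using that(1) \<open>k \<noteq> k'\<close> by metis
  qed
  then show ?thesis unfolding tracks_def set_map set_upt by (blast dest: atLeastLessThan_iff[THEN iffD1])
qed

definition dist :: "nat \<Rightarrow> nat \<Rightarrow> nat" where
  "dist D k = [0, 1, D, D - 1] ! k"


lemma read_tracks_append: "read_tracks (js @ ks) As = read_tracks js As @ read_tracks ks As"
  by (simp add: read_tracks_def)

lemma read_tracks_const: "(\<And>j. j \<in> set js \<Longrightarrow> col j As = replicate L b) \<Longrightarrow> read_tracks js As = replicate (length js * L) b"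
  by (induction js) (auto simp: replicate_add)

lemma read_tracks_init_cells:
  assumes e: "1 \<le> e" and L: "1 \<le> L" and k: "k < 4"
  shows "read_tracks (tracks e k) (init_cells e L) = bits (2 * e * L) (dist (2 ^ (e * L)) k)"
proof -
  have col: "col j (init_cells e L) = (j \<in> init_first e) # replicate (L - 1) (j \<in> init_low e)" for j
    by (simp add: init_cells_def col_def)
  have rep: "b # replicate (L - 1) b = replicate L b" for b :: bool
    using L by (cases L) auto
  have split: "[0..<2 * e] = [0..<e] @ [e..<2 * e]"
    using upt_add_eq_append[of 0 e e] by (simp add: mult_2)
  have consecutive: "[a..<b] = a # [Suc a..<b]" if "a < b" for a b
    using that by (rule upt_conv_Cons)
  have eL: "2 * e * L = e * L + e * L" "1 \<le> e * L"
    using e L by (simp_all add: mult_2 distrib_right)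
  consider "k = 0" | "k = 1" | "k = 2" | "k = 3" using k by linarith
  then show ?thesis
  proof cases
    case 1
    have "read_tracks (tracks e k) (init_cells e L) = replicate (2 * e * L) False"
      by (subst read_tracks_const[of _ _ L False]) (use 1 rep in \<open>auto simp: tracks_def col init_first_def init_low_def\<close>)
    then show ?thesis by (simp add: 1 dist_def bits_0)
  next
    case 2
    have "tracks e k = (2 * e) # map (\<lambda>j. 2 * e + j) [1..<2 * e]"
      using e 2 by (simp add: tracks_def consecutive[of 0])
    moreover have "read_tracks (map (\<lambda>j. 2 * e + j) [1..<2 * e]) (init_cells e L) = replicate ((2 * e - 1) * L) False"
      by (subst read_tracks_const[of _ _ L False]) (use rep in \<open>auto simp: col init_first_def init_low_def\<close>)
    ultimately have "read_tracks (tracks e k) (init_cells e L) = True # replicate (L - 1 + (2 * e - 1) * L) False"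
      using e by (auto simp add: col init_first_def init_low_def replicate_add)
    moreover have "2 * e * L = Suc (L - 1 + (2 * e - 1) * L)"
      using e L by (cases e; cases L) auto
    ultimately show ?thesis using 2 bits_1 by (simp add: dist_def)
  next
    case 3
    have t: "tracks e k = map (\<lambda>j. 2 * e * 2 + j) [0..<e] @ (2 * e * 2 + e) # map (\<lambda>j. 2 * e * 2 + j) [Suc e..<2 * e]"
      using e 3 by (simp add: tracks_def split consecutive[of e])
    have 1: "read_tracks (map (\<lambda>j. 2 * e * 2 + j) [0..<e]) (init_cells e L) = replicate (e * L) False"
      by (subst read_tracks_const[of _ _ L False]) (use rep in \<open>auto simp: col init_first_def init_low_def\<close>)
    have 2: "read_tracks (map (\<lambda>j. 2 * e * 2 + j) [Suc e..<2 * e]) (init_cells e L) = replicate ((e - 1) * L) False"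
      by (subst read_tracks_const[of _ _ L False]) (use rep in \<open>auto simp: col init_first_def init_low_def\<close>)
    have "read_tracks (tracks e k) (init_cells e L) = replicate (e * L) False @ True # replicate (L - 1 + (e - 1) * L) False"
      unfolding t read_tracks_append read_tracks_Cons 1 2 using e by (simp add: col init_first_def init_low_def replicate_add)
    also have "True # replicate (L - 1 + (e - 1) * L) False = bits (e * L) 1"
    proof -
      have "e * L = Suc (L - 1 + (e - 1) * L)" using e L by (cases e; cases L) auto
      then show ?thesis using bits_1 by metis
    qed
    also have "replicate (e * L) False @ bits (e * L) 1 = bits (2 * e * L) (2 ^ (e * L))"
      using bits_append[of 0 "e * L" "e * L" 1] by (simp add: eL(1) bits_0)
    finally show ?thesis by (simp add: 3 dist_def)
  next
    case 4
    have t: "tracks e k = map (\<lambda>j. 2 * e * 3 + j) [0..<e] @ map (\<lambda>j. 2 * e * 3 + j) [e..<2 * e]"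
      using 4 by (simp add: tracks_def split)
    have 1: "read_tracks (map (\<lambda>j. 2 * e * 3 + j) [0..<e]) (init_cells e L) = replicate (e * L) True"
      by (subst read_tracks_const[of _ _ L True]) (use rep in \<open>auto simp: col init_first_def init_low_def\<close>)
    have 2: "read_tracks (map (\<lambda>j. 2 * e * 3 + j) [e..<2 * e]) (init_cells e L) = replicate (e * L) False"
      by (subst read_tracks_const[of _ _ L False]) (use rep in \<open>auto simp: col init_first_def init_low_def\<close>)
    have "read_tracks (tracks e k) (init_cells e L) = bits (e * L) (2 ^ (e * L) - 1) @ bits (e * L) 0"
      unfolding t read_tracks_append 1 2 bits_ones bits_0 ..
    also have "\<dots> = bits (2 * e * L) (2 ^ (e * L) - 1)"
      using bits_append[of "2 ^ (e * L) - 1" "e * L" "e * L" 0] by (simp add: eL(1))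
    finally show ?thesis by (simp add: 4 dist_def)
  qed
qed

text \<open>Both ends of the input read \<open>None\<close>; the first \<open>inL\<close> leaves the
  right end before the loop searches for the left one.\<close>

definition in_rewind :: "wsym prog" where
  "in_rewind = Seq inL (While (\<lambda>x _. x \<noteq> None) inL)"

lemma exec_in_rewind:
  "exec w B in_rewind (length w + 1, T, 0, out) (0, T, 0, out)"
proof -
  have loop: "exec w B (While (\<lambda>x _. x \<noteq> None) inL) (i, T, 0, out) (0, T, 0, out)" if "i \<le> length w" for i
    using that
  proof (induction i)
    case 0
    show ?case by (rule exec_WhileF) (simp add: read_input_def)
  next
    case (Suc i)
    have "exec w B inL (Suc i, T, 0, out) (i, T, 0, out)"
      using exec_inL[of "Suc i" w 0 B T out] Suc.prems by simp
    then show ?case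
      using Suc by (intro exec_WhileT[of _ w "Suc i"]) (auto simp: read_input_def)
  qed
  show ?thesis
    unfolding in_rewind_def using exec_inL[of "length w + 1" w 0 B T out] loop[of "length w"]
    by (intro exec_Seq) auto
qed

lemma prints_exec: "prints w B f As c xs \<Longrightarrow> i \<le> length w + 1 \<Longrightarrow>
    exec w B c (i, tape f As, 0, out) (i, tape f As, 0, out @ xs)"
  by (simp add: prints_def)

section \<open>The circuit writer and its output\<close>

locale emitter =
  fixes e W N :: nat and mainf firstf :: "fm list" and inif :: "bool option \<Rightarrow> fm list"
  assumes e: "1 \<le> e"
    and mainf: "\<And>p k s. p \<in> set mainf \<Longrightarrow> Ref k s \<in> fvars p \<Longrightarrow> k < 4"
    and firstf: "\<And>p k s. p \<in> set firstf \<Longrightarrow> Ref k s \<notin> fvars p"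
    and inif: "\<And>x p k s. p \<in> set (inif x) \<Longrightarrow> Ref k s \<notin> fvars p"
begin

definition nbits :: "bool list \<Rightarrow> nat" where "nbits w = 2 * e * ncells w"
definition row_len :: "bool list \<Rightarrow> nat" where "row_len w = 2 ^ (e * ncells w)"

text \<open>Row 0 occupies the last \<open>row_len w\<close> groups, and within it the tape position
  increases with \<open>a\<close>, so the input can be read from left to right meanwhile. Position 0
  is singled out because it carries the edge flag and all heads.\<close>

definition forms :: "bool list \<Rightarrow> nat \<Rightarrow> fm list" where
  "forms w a = (if a < 2 ^ nbits w - row_len w then mainf
     else if a = 2 ^ nbits w - row_len w then firstf else inif (read_input w (a - (2 ^ nbits w - row_len w))))"

definition incr :: "(bool \<Rightarrow> bool) \<Rightarrow> nat \<Rightarrow> wsym prog" where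
  "incr g k = inc_prog g (tracks e k)"

text \<open>Only counter 2, which holds \<open>a + D\<close>, changes the mark: its overflow means
  that the next group starts row 0.\<close>

definition row_body :: "wsym prog" where
  "row_body = Seq (print_template e W mainf) (Seq (incr id 0) (Seq (incr id 1) (Seq (incr (\<lambda>_. True) 2) (incr id 3))))"

definition main_loop :: "wsym prog" where
  "main_loop = While (\<lambda>_ s. s = Mark False) row_body"

text \<open>At the right end marker the input head stays, so all remaining positions are treated as
  lying beyond the input. Overflow of counter 0 clears the mark after the last group.\<close>

definition init_body :: "wsym prog" where
  "init_body = Cond (\<lambda>x _. x = None) (Seq (print_template e W (inif None)) (incr (\<lambda>_. False) 0))
     (Cond (\<lambda>x _. x = Some True)
       (Seq (print_template e W (inif (Some True))) (Seq (incr (\<lambda>_. False) 0) inR))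
       (Seq (print_template e W (inif (Some False))) (Seq (incr (\<lambda>_. False) 0) inR)))"

definition init_loop :: "wsym prog" where
  "init_loop = Seq (print_template e W firstf) (Seq (incr (\<lambda>_. False) 0) (Seq inR
     (While (\<lambda>_ s. s = Mark True) init_body)))"

definition tail_syms :: "sym list" where
  "tail_syms = concat (map enc_gate gate_groups.consts_part) @ [Comma] @ enc_nat 0 @ [Close]"

definition emit_prog :: "wsym prog" where
  "emit_prog = Seq scan_prog (Seq (fill_prog e) (Seq in_rewind (Seq (emit [Open]) (Seq (print_name e W 0 N)
     (Seq (emit [Comma]) (Seq main_loop (Seq init_loop (emit tail_syms))))))))"

context
  fixes w :: "bool list" and B :: nat
  assumes B: "B = Suc (ncells w)"
begin

abbreviation "m \<equiv> nbits w"
abbreviation "D \<equiv> row_len w"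

interpretation G: gate_groups m W "dist D" "forms w" .

definition represents :: "nat \<Rightarrow> nat set list \<Rightarrow> bool" where
  "represents a As \<longleftrightarrow> length As = ncells w \<and> (\<forall>k<4. read_tracks (tracks e k) As = bits m (a + dist D k))"

lemma D_bounds: "4 \<le> D" "D < 2 ^ m" "2 ^ m = D * D" "2 \<le> m"
proof -
  have 2: "2 \<le> e * ncells w" using ncells_bounds(3)[of w] e by (metis mult_le_mono nat_mult_1)
  then have "(2::nat) ^ 2 \<le> 2 ^ (e * ncells w)" by (intro power_increasing) auto
  then show 4: "4 \<le> D" by (simp add: row_len_def)
  show eq: "2 ^ m = D * D" by (simp add: nbits_def row_len_def mult_2 distrib_right power_add)
  show "D < 2 ^ m" unfolding eq using 4 by simp
  show "2 \<le> m" using 2 unfolding nbits_def mult.assoc by linarith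
qed

lemma exec_incr:
  assumes "i \<le> length w + 1" "length As = ncells w"
  shows "exec w B (incr g k) (i, tape f As, 0, out)
      (i, tape (if \<forall>b\<in>set (read_tracks (tracks e k) As). b then g f else f) (incAs (tracks e k) As), 0, out)"
  unfolding incr_def using assms by (intro exec_inc_prog distinct_tracks) (auto simp: B)

lemma exec_row_body:
  assumes i: "i \<le> length w + 1" and a: "a < 2 ^ m - D" and R: "represents a As"
  shows "\<exists>As'. represents (Suc a) As' \<and> exec w B row_body (i, tape False As, 0, out)
    (i, tape (Suc a = 2 ^ m - D) As', 0, out @ enc_syms (concat (map enc_gate (G.group a))))"
proof -
  let ?I = "\<lambda>k. incAs (tracks e k)"
  let ?out = "out @ enc_syms (concat (map enc_gate (G.group a)))"
  have [simp]: "(if c then id f else f) = f" for c f :: bool by (cases c) simp_all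
  have len: "length As = ncells w" and rep: "\<And>k. k < 4 \<Longrightarrow> read_tracks (tracks e k) As = bits m (a + dist D k)"
    using R by (auto simp: represents_def)
  have forms: "forms w a = mainf" using a by (simp add: forms_def)
  have "prints w B False As (print_template e W (forms w a)) (enc_syms (concat (map enc_gate (G.group a))))"
    using rep[of 0] rep mainf by (intro G.prints_template) (auto simp: B len dist_def forms)
  then have 0: "exec w B (print_template e W mainf) (i, tape False As, 0, out) (i, tape False As, 0, ?out)"
    using i by (simp add: prints_def forms)
  have other: "read_tracks (tracks e k') (?I k Bs) = read_tracks (tracks e k') Bs" if "k \<noteq> k'" for k k' Bs
    using read_tracks_incAs_other[OF tracks_disjoint[OF that]] .
  have same: "read_tracks (tracks e k) (?I k Bs) = incb (read_tracks (tracks e k) Bs)" for k Bs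
    by (rule read_tracks_incAs[OF distinct_tracks])
  have 1: "exec w B (incr id 0) (i, tape False As, 0, ?out) (i, tape False (?I 0 As), 0, ?out)"
    using exec_incr[OF i len, of id 0 False ?out] by simp
  have 2: "exec w B (incr id 1) (i, tape False (?I 0 As), 0, ?out) (i, tape False (?I 1 (?I 0 As)), 0, ?out)"
    using exec_incr[OF i, of "?I 0 As" id 1 False ?out] len by simp
  have "read_tracks (tracks e 2) (?I 1 (?I 0 As)) = bits m (a + D)"
    using rep[of 2] by (simp add: other dist_def)
  \<comment> \<open>Only counters 0 and 1 have been incremented so far; counter 2 still holds
    \<open>a + D\<close>, and all its bits are one iff \<open>a + D + 1 = 2 ^ m\<close>.\<close>
  then have ov: "(\<forall>b\<in>set (read_tracks (tracks e 2) (?I 1 (?I 0 As))). b) \<longleftrightarrow> Suc a = 2 ^ m - D"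
    using all_bits[of "a + D" m] a by auto
  have 3: "exec w B (incr (\<lambda>_. True) 2) (i, tape False (?I 1 (?I 0 As)), 0, ?out)
      (i, tape (Suc a = 2 ^ m - D) (?I 2 (?I 1 (?I 0 As))), 0, ?out)"
    using exec_incr[OF i, of "?I 1 (?I 0 As)" "\<lambda>_. True" 2 False ?out] len unfolding ov by (simp split: if_splits)
  have 4: "exec w B (incr id 3) (i, tape (Suc a = 2 ^ m - D) (?I 2 (?I 1 (?I 0 As))), 0, ?out)
      (i, tape (Suc a = 2 ^ m - D) (?I 3 (?I 2 (?I 1 (?I 0 As)))), 0, ?out)"
    using exec_incr[OF i, of "?I 2 (?I 1 (?I 0 As))" id 3 "Suc a = 2 ^ m - D" ?out] len by simp
  have "represents (Suc a) (?I 3 (?I 2 (?I 1 (?I 0 As))))"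
    unfolding represents_def
  proof (intro conjI allI impI)
    fix k :: nat assume "k < 4"
    then consider "k = 0" | "k = 1" | "k = 2" | "k = 3" by linarith
    then show "read_tracks (tracks e k) (?I 3 (?I 2 (?I 1 (?I 0 As)))) = bits m (Suc a + dist D k)"
      using rep[OF \<open>k < 4\<close>] by cases (simp_all add: other same incb_bits)
  qed (simp add: len)
  then show ?thesis
    unfolding row_body_def using exec_Seq[OF 0 exec_Seq[OF 1 exec_Seq[OF 2 exec_Seq[OF 3 4]]]] by blast
qed

lemma exec_main_loop:
  assumes i: "i \<le> length w + 1"
  shows "a \<le> 2 ^ m - D \<Longrightarrow> represents a As \<Longrightarrow> \<exists>As'. represents (2 ^ m - D) As' \<and>
    exec w B main_loop (i, tape (a = 2 ^ m - D) As, 0, out)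
      (i, tape True As', 0, out @ enc_syms (concat (map enc_gate (concat (map G.group [a..<2 ^ m - D])))))"
proof (induction a arbitrary: As out rule: inc_induct)
  case base
  then show ?case
    using exec_WhileF[of "\<lambda>_ s. s = Mark False" w i "tape True As" 0] by (auto simp: main_loop_def)
next
  case (step a)
  obtain As1 where As1: "represents (Suc a) As1" "exec w B row_body (i, tape False As, 0, out)
    (i, tape (Suc a = 2 ^ m - D) As1, 0, out @ enc_syms (concat (map enc_gate (G.group a))))"
    using exec_row_body[OF i step.hyps(2) step.prems] by blast
  obtain As2 where As2: "represents (2 ^ m - D) As2"
    "exec w B main_loop (i, tape (Suc a = 2 ^ m - D) As1, 0, out @ enc_syms (concat (map enc_gate (G.group a))))
      (i, tape True As2, 0, (out @ enc_syms (concat (map enc_gate (G.group a))))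
         @ enc_syms (concat (map enc_gate (concat (map G.group [Suc a..<2 ^ m - D])))))"
    using step.IH[OF As1(1)] by blast
  have "exec w B main_loop (i, tape False As, 0, out) (i, tape True As2, 0, (out @ enc_syms (concat (map enc_gate (G.group a))))
         @ enc_syms (concat (map enc_gate (concat (map G.group [Suc a..<2 ^ m - D])))))"
    using As1(2) As2(2) unfolding main_loop_def by (intro exec_WhileT) auto
  then show ?case
    using As2(1) step.hyps(2) by (auto simp: upt_conv_Cons)
qed

text \<open>Formulas of row 0 contain no \<open>Ref\<close> variables, so only the counter for the
  group's own name is still needed.\<close>

definition represents0 :: "nat \<Rightarrow> nat set list \<Rightarrow> bool" where
  "represents0 a As \<longleftrightarrow> length As = ncells w \<and> read_tracks (tracks e 0) As = bits m a"

lemma exec_init_step: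
  assumes i: "i \<le> length w + 1" and a: "2 ^ m - D \<le> a" "a < 2 ^ m" and R: "represents0 a As"
    and forms: "forms w a = ps"
  shows "exec w B (print_template e W ps) (i, tape True As, 0, out)
      (i, tape True As, 0, out @ enc_syms (concat (map enc_gate (G.group a))))" (is ?print)
    and "exec w B (incr (\<lambda>_. False) 0) (i, tape True As, 0, out)
      (i, tape (Suc a \<noteq> 2 ^ m) (incAs (tracks e 0) As), 0, out)" (is ?incr)
    and "represents0 (Suc a) (incAs (tracks e 0) As)"
proof -
  have len: "length As = ncells w" and rep: "read_tracks (tracks e 0) As = bits m a"
    using R by (auto simp: represents0_def)
  have "prints w B True As (print_template e W (forms w a)) (enc_syms (concat (map enc_gate (G.group a))))"
    using firstf inif a by (intro G.prints_template rep) (auto simp: B len dist_def forms_def split: if_splits)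
  then show ?print using i by (simp add: prints_def forms)
  show ?incr
    using exec_incr[OF i len, of "\<lambda>_. False" 0 True out] all_bits[OF a(2)] unfolding rep by (auto split: if_splits)
  show "represents0 (Suc a) (incAs (tracks e 0) As)"
    using rep len by (simp add: represents0_def read_tracks_incAs distinct_tracks incb_bits)
qed

definition after_gates :: "nat \<Rightarrow> bool list \<Rightarrow> bool list" where
  "after_gates a out = out @ enc_syms (concat (map enc_gate (concat (map G.group [a..<2 ^ m]))))"

lemma after_gates_step:
  "a < 2 ^ m \<Longrightarrow> after_gates (Suc a) (out @ enc_syms (concat (map enc_gate (G.group a)))) = after_gates a out"
  by (simp add: after_gates_def upt_conv_Cons)

lemma exec_init_body:
  assumes x: "1 \<le> x" "x < D" and R: "represents0 (2 ^ m - D + x) As"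
  shows "exec w B init_body (min x (length w + 1), tape True As, 0, out)
    (min (Suc x) (length w + 1), tape (Suc x \<noteq> D) (incAs (tracks e 0) As), 0,
     out @ enc_syms (concat (map enc_gate (G.group (2 ^ m - D + x)))))"
proof -
  let ?a = "2 ^ m - D + x" and ?i = "min x (length w + 1)"
  let ?out = "out @ enc_syms (concat (map enc_gate (G.group ?a)))"
  have a: "2 ^ m - D \<le> ?a" "?a < 2 ^ m" "Suc ?a = 2 ^ m \<longleftrightarrow> Suc x = D"
    using x D_bounds(1,2) by auto
  \<comment> \<open>From position \<open>length w + 1\<close> on every position reads
    \<open>None\<close>, so the parked head sees the symbol of position \<open>x\<close>.\<close>
  have input: "read_input w ?i = read_input w x"
    by (auto simp: read_input_def min_def)
  have forms: "forms w ?a = inif (read_input w ?i)"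
    unfolding input using x by (simp add: forms_def)
  note step = exec_init_step[OF _ a(1,2) R forms, of ?i]
  have print: "exec w B (print_template e W (inif (read_input w ?i))) (?i, tape True As, 0, out) (?i, tape True As, 0, ?out)"
    by (rule step) simp
  have incr: "exec w B (incr (\<lambda>_. False) 0) (?i, tape True As, 0, ?out)
      (?i, tape (Suc x \<noteq> D) (incAs (tracks e 0) As), 0, ?out)"
    using step(2)[of ?out] a(3) by simp
  show ?thesis
  proof (cases "read_input w ?i")
    case None
    then have "?i = min (Suc x) (length w + 1)"
      using x by (auto simp: read_input_def min_def split: if_splits)
    then show ?thesis
      using exec_Seq[OF print incr] None unfolding init_body_def by (intro exec_CondT) auto
  next
    case (Some b)
    then have "x \<le> length w" by (auto simp: read_input_def min_def split: if_splits)
    then have "exec w B inR (?i, tape (Suc x \<noteq> D) (incAs (tracks e 0) As), 0, ?out)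
       (min (Suc x) (length w + 1), tape (Suc x \<noteq> D) (incAs (tracks e 0) As), 0, ?out)"
      using exec_inR[of x w 0 B "tape (Suc x \<noteq> D) (incAs (tracks e 0) As)" ?out] by (simp add: min_def)
    note all = exec_Seq[OF print exec_Seq[OF incr this]]
    show ?thesis
      unfolding init_body_def
    proof (rule exec_CondF)
      show "exec w B (Cond (\<lambda>x _. x = Some True)
       (Seq (print_template e W (inif (Some True))) (Seq (incr (\<lambda>_. False) 0) inR))
       (Seq (print_template e W (inif (Some False))) (Seq (incr (\<lambda>_. False) 0) inR))) (?i, tape True As, 0, out)
        (min (Suc x) (length w + 1), tape (Suc x \<noteq> D) (incAs (tracks e 0) As), 0, ?out)"
        using all Some by (cases b) (auto intro: exec_CondT exec_CondF)
    qed (use Some in simp)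
  qed
qed

lemma exec_init_while:
  "x \<le> D \<Longrightarrow> 1 \<le> x \<Longrightarrow> represents0 (2 ^ m - D + x) As \<Longrightarrow> \<exists>As' i'. length As' = ncells w \<and> i' \<le> length w + 1 \<and>
    exec w B (While (\<lambda>_ s. s = Mark True) init_body) (min x (length w + 1), tape (x \<noteq> D) As, 0, out)
      (i', tape False As', 0, after_gates (2 ^ m - D + x) out)"
proof (induction x arbitrary: As out rule: inc_induct)
  case base
  have "after_gates (2 ^ m - D + D) out = out"
    using D_bounds(1,2) by (simp add: after_gates_def)
  then show ?case
    using exec_WhileF[of "\<lambda>_ s. s = Mark True" w "min D (length w + 1)" "tape False As" 0 B init_body out] base
    by (intro exI[of _ As] exI[of _ "min D (length w + 1)"]) (auto simp: represents0_def)
next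
  case (step x)
  let ?a = "2 ^ m - D + x"
  have a: "?a < 2 ^ m" using step.hyps D_bounds(1,2) by auto
  have R: "represents0 (2 ^ m - D + Suc x) (incAs (tracks e 0) As)"
    using exec_init_step(3)[of 0 ?a As] a step.prems by simp
  let ?out = "out @ enc_syms (concat (map enc_gate (G.group ?a)))"
  obtain As' i' where IH: "length As' = ncells w" "i' \<le> length w + 1"
    "exec w B (While (\<lambda>_ s. s = Mark True) init_body)
       (min (Suc x) (length w + 1), tape (Suc x \<noteq> D) (incAs (tracks e 0) As), 0, ?out)
       (i', tape False As', 0, after_gates (2 ^ m - D + Suc x) ?out)"
    using step.IH[OF _ R, of ?out] by auto
  have "exec w B init_body (min x (length w + 1), tape True As, 0, out)
    (min (Suc x) (length w + 1), tape (Suc x \<noteq> D) (incAs (tracks e 0) As), 0, ?out)"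
    using step by (intro exec_init_body) auto
  then have "exec w B (While (\<lambda>_ s. s = Mark True) init_body) (min x (length w + 1), tape True As, 0, out)
       (i', tape False As', 0, after_gates (2 ^ m - D + Suc x) ?out)"
    using IH(3) by (intro exec_WhileT) auto
  then show ?case
    using IH(1,2) after_gates_step[OF a, of out] step.hyps by auto
qed

lemma exec_init_loop:
  assumes R: "represents0 (2 ^ m - D) As"
  shows "\<exists>As' i'. length As' = ncells w \<and> i' \<le> length w + 1 \<and>
    exec w B init_loop (0, tape True As, 0, out) (i', tape False As', 0, after_gates (2 ^ m - D) out)"
proof -
  let ?a = "2 ^ m - D"
  let ?out = "out @ enc_syms (concat (map enc_gate (G.group ?a)))"
  let ?As = "incAs (tracks e 0) As"
  have a: "?a < 2 ^ m" "Suc ?a \<noteq> 2 ^ m" using D_bounds(1,2) by auto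
  note step = exec_init_step[OF _ _ a(1) R, of 0 firstf]
  have forms: "forms w ?a = firstf" by (simp add: forms_def)
  have 1: "exec w B (print_template e W firstf) (0, tape True As, 0, out) (0, tape True As, 0, ?out)"
    using step(1)[of out] forms by simp
  have 2: "exec w B (incr (\<lambda>_. False) 0) (0, tape True As, 0, ?out) (0, tape True ?As, 0, ?out)"
    using step(2)[of ?out] forms a(2) by simp
  have 3: "exec w B inR (0, tape True ?As, 0, ?out) (1, tape True ?As, 0, ?out)"
    using exec_inR[of 0 w 0 B "tape True ?As" ?out] by simp
  obtain As' i' where 4: "length As' = ncells w" "i' \<le> length w + 1"
    "exec w B (While (\<lambda>_ s. s = Mark True) init_body) (1, tape True ?As, 0, ?out)
      (i', tape False As', 0, after_gates (?a + 1) ?out)"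
    using exec_init_while[of 1 ?As ?out] step(3) forms D_bounds(1) by auto
  show ?thesis
    unfolding init_loop_def using exec_Seq[OF 1 exec_Seq[OF 2 exec_Seq[OF 3 4(3)]]] 4(1,2) after_gates_step[OF a(1), of out]
    by auto
qed

definition instance_out :: "bool list" where
  "instance_out = enc_instance (gate_name m W 0 N, G.gates_from 0) 0"

lemma instance_out_eq:
  "instance_out = after_gates (2 ^ m - D) (enc_syms ([Open] @ enc_nat (gate_name m W 0 N) @ [Comma])
     @ enc_syms (concat (map enc_gate (concat (map G.group [0..<2 ^ m - D]))))) @ enc_syms tail_syms"
proof -
  have split: "[0..<2 ^ m] = [0..<2 ^ m - D] @ [2 ^ m - D..<2 ^ m]"
    using upt_add_eq_append[of 0 "2 ^ m - D" D] D_bounds(1,2) by simp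
  have "instance_out = enc_syms ([Open] @ enc_nat (gate_name m W 0 N) @ [Comma] @ concat (map enc_gate (G.gates_from 0))
      @ [Comma] @ enc_nat 0 @ [Close])"
    by (simp add: instance_out_def enc_instance_def enc_syms_def)
  also have "concat (map enc_gate (G.gates_from 0)) =
     concat (map enc_gate (concat (map G.group [0..<2 ^ m - D]))) @
     concat (map enc_gate (concat (map G.group [2 ^ m - D..<2 ^ m]))) @ concat (map enc_gate gate_groups.consts_part)"
    unfolding G.gates_from_def split by simp
  finally show ?thesis
    unfolding after_gates_def tail_syms_def enc_syms_append append_assoc .
qed

lemma exec_emit_prog:
  "\<exists>s. exec w B emit_prog (0, \<lambda>_. Blank, 0, []) s \<and> snd (snd (snd s)) = instance_out"
proof -
  let ?n = "length w + 1" and ?C = "counted (length w + 2)"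
  let ?I = "init_cells e (ncells w)" and ?o = "enc_syms ([Open] @ enc_nat (gate_name m W 0 N) @ [Comma])"
  have L: "2 \<le> ncells w" by (rule ncells_bounds)
  have lenI: "length ?I = ncells w" using L by (simp add: init_cells_def)
  have rep: "represents 0 ?I"
    using read_tracks_init_cells[OF e, of "ncells w"] L lenI by (simp add: represents_def nbits_def row_len_def)
  have 1: "exec w B scan_prog (0, \<lambda>_. Blank, 0, []) (?n, tape False ?C, 0, [])"
    by (rule exec_scan_prog[OF B])
  have 2: "exec w B (fill_prog e) (?n, tape False ?C, 0, []) (?n, tape False ?I, 0, [])"
    using exec_fill_prog[of ?n w ?C B e False "[]"] L by (simp add: ncells_def B)
  have 3: "exec w B in_rewind (?n, tape False ?I, 0, []) (0, tape False ?I, 0, [])"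
    by (rule exec_in_rewind)
  have 4: "exec w B (emit [Open]) (0, tape False ?I, 0, []) (0, tape False ?I, 0, enc_syms [Open])"
    using prints_exec[OF prints_emit[of w B False ?I "[Open]"], of 0 "[]"] by simp
  have "prints w B False ?I (print_name e W 0 N) (enc_syms (enc_nat (gate_name m W (0 + dist D 0) N)))"
    using rep by (intro G.prints_name) (auto simp: represents_def B dist_def)
  then have 5: "exec w B (print_name e W 0 N) (0, tape False ?I, 0, enc_syms [Open])
      (0, tape False ?I, 0, enc_syms [Open] @ enc_syms (enc_nat (gate_name m W 0 N)))"
    by (intro prints_exec) (simp_all add: dist_def)
  have 6: "exec w B (emit [Comma]) (0, tape False ?I, 0, enc_syms [Open] @ enc_syms (enc_nat (gate_name m W 0 N)))
      (0, tape False ?I, 0, ?o)"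
    unfolding enc_syms_append append_assoc[symmetric] by (rule prints_exec[OF prints_emit]) simp
  \<comment> \<open>Row 0 is not the first row written, so the mark \<open>False\<close> is the
    right one for entering the main loop.\<close>
  have ne: "0 \<noteq> 2 ^ m - D" using D_bounds(1,2) by simp
  obtain As1 where 7: "represents (2 ^ m - D) As1" "exec w B main_loop (0, tape False ?I, 0, ?o)
      (0, tape True As1, 0, ?o @ enc_syms (concat (map enc_gate (concat (map G.group [0..<2 ^ m - D])))))" (is "exec _ _ _ _ (_, _, _, ?o1)")
    using exec_main_loop[of 0 0 ?I ?o] rep ne by auto
  have "represents0 (2 ^ m - D) As1"
    using 7(1) by (auto simp: represents_def represents0_def dist_def dest: spec[of _ 0])
  then obtain As2 i where 8: "length As2 = ncells w" "i \<le> ?n"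
    "exec w B init_loop (0, tape True As1, 0, ?o1) (i, tape False As2, 0, after_gates (2 ^ m - D) ?o1)"
    using exec_init_loop[of As1 ?o1] by blast
  have 9: "exec w B (emit tail_syms) (i, tape False As2, 0, after_gates (2 ^ m - D) ?o1) (i, tape False As2, 0, instance_out)"
    unfolding instance_out_eq by (rule prints_exec[OF prints_emit 8(2)])
  show ?thesis
    unfolding emit_prog_def
    using exec_Seq[OF 1 exec_Seq[OF 2 exec_Seq[OF 3 exec_Seq[OF 4 exec_Seq[OF 5 exec_Seq[OF 6
      exec_Seq[OF 7(2) exec_Seq[OF 8(3) 9]]]]]]]] by force
qed

end

text \<open>The bound \<open>8 * e\<close> stands for four counters of \<open>2 * e\<close> tracks
  each.\<close>

definition wsyms :: "wsym set" where
  "wsyms = {Blank, Mark True, Mark False} \<union> Cell ` Pow {..<8 * e}"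

lemma finite_wsyms: "finite wsyms"
  by (simp add: wsyms_def)

lemma Cell_wsyms: "Cell A \<in> wsyms \<longleftrightarrow> A \<subseteq> {..<8 * e}"
  by (auto simp: wsyms_def)

lemma Mark_wsyms: "Mark b \<in> wsyms" and Blank_wsyms: "Blank \<in> wsyms"
  by (cases b, auto simp: wsyms_def)

lemmas wsyms_simps = Cell_wsyms Mark_wsyms Blank_wsyms

lemma wf_basics [simp]:
  "wf_prog wsyms goR" "wf_prog wsyms goL" "wf_prog wsyms inR" "wf_prog wsyms inL" "wf_prog wsyms (out1 p)"
  "wf_prog wsyms (wr f) \<longleftrightarrow> (\<forall>s\<in>wsyms. f s \<in> wsyms)"
  by (simp_all add: goR_def goL_def inR_def inL_def out1_def wr_def)

lemma wf_seqs [simp]: "wf_prog wsyms (seqs cs) \<longleftrightarrow> (\<forall>c\<in>set cs. wf_prog wsyms c)"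
  by (induction cs) (auto simp: seqs_def)

lemma wf_rewind [simp]: "wf_prog wsyms rewind"
  by (simp add: rewind_def)

lemma wf_emit [simp]: "wf_prog wsyms (emit xs)"
  by (auto simp: emit_def)

lemma wf_print_name [simp]: "wf_prog wsyms (print_name e' W' k s)"
  by (auto simp: print_name_def print_col_def)

lemma wf_print_ref [simp]: "wf_prog wsyms (print_ref e' W' r)"
  by (cases r) auto

lemma wf_print_gate [simp]: "wf_prog wsyms (print_gate e' W' g)"
  by (cases g) auto

lemma wf_print_template [simp]: "wf_prog wsyms (print_template e' W' ps)"
  by (simp add: print_template_def)

lemma wf_carry [simp]: "wf_prog wsyms (carry j)"
  by (auto simp: carry_def clr_def wsyms_simps split: wsym.splits)

lemma wf_inc_prog: "set js \<subseteq> {..<8 * e} \<Longrightarrow> wf_prog wsyms (inc_prog g js)"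
  by (induction js) (auto simp: remark_def put_def wsyms_simps split: wsym.splits)

lemma wf_incr [simp]:
  assumes "k < 4"
  shows "wf_prog wsyms (incr g k)"
proof -
  have "k = 0 \<or> k = 1 \<or> k = 2 \<or> k = 3" using assms by linarith
  then have "set (tracks e k) \<subseteq> {..<8 * e}" by (auto simp: tracks_def)
  then show ?thesis unfolding incr_def by (rule wf_inc_prog)
qed

lemma wf_emit_prog: "wf_prog wsyms emit_prog"
  using e by (auto simp: emit_prog_def scan_prog_def grow_prog_def fill_prog_def in_rewind_def main_loop_def
      row_body_def init_loop_def init_body_def wsyms_simps put0_def init_first_def init_low_def split: wsym.splits)

theorem logspace_instance:
  "logspace_computable (\<lambda>w. enc_instance (gate_name (nbits w) W 0 N,
     gate_groups.gates_from (nbits w) W (dist (row_len w)) (forms w) 0) 0)" (is "logspace_computable ?f")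
proof -
  define F where "F = (\<lambda>w. SOME s. exec w (Suc (ncells w)) emit_prog (0, \<lambda>_. Blank, 0, []) s \<and> snd (snd (snd s)) = ?f w)"
  have F: "exec w (Suc (ncells w)) emit_prog (0, \<lambda>_. Blank, 0, []) (F w) \<and> snd (snd (snd (F w))) = ?f w" for w
    unfolding F_def by (rule someI_ex) (use exec_emit_prog[OF refl, of w] in \<open>simp add: instance_out_def\<close>)
  \<comment> \<open>\<open>ncells w - 1\<close> is at most the logarithm, and the logarithm is at
    least 1; hence the factor 3 for \<open>ncells w + 1\<close>.\<close>
  have bd: "real (Suc (ncells w)) \<le> 3 * log 2 (real (length w) + 2)" for w
  proof -
    have "2 ^ (ncells w - 1) \<le> real (length w + 2)"
      using ncells_bounds(2)[of w] by (metis of_nat_le_iff of_nat_numeral of_nat_power)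
    then have "real (ncells w - 1) \<le> log 2 (real (length w) + 2)"
      by (intro le_log_of_power) (auto simp: add.commute)
    moreover have "1 \<le> log 2 (real (length w) + 2)" by simp
    ultimately show ?thesis using ncells_bounds(3)[of w] by simp
  qed
  show ?thesis
    by (rule logspace_computable_prog[where F = F and bd = "\<lambda>w. Suc (ncells w)", OF finite_wsyms Blank_wsyms wf_emit_prog])
      (use F bd in auto)
qed

end

section \<open>Injectivity of the encoding\<close>

lemma num_bin: "num (bin n) = n"
proof (induction n rule: less_induct)
  case (less n)
  show ?case
  proof (cases "n < 2")
    case True
    then have "n = 0 \<or> n = 1" by auto
    then show ?thesis by (auto simp: bin.simps[of n] num_def)
  next
    case False
    then have "bin n = bin (n div 2) @ [odd n]" by (simp add: bin.simps[of n])
    moreover have "num (bin (n div 2)) = n div 2" using False by (intro less) simp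
    ultimately show ?thesis by (simp add: num_snoc)
  qed
qed

definition not_bit :: "sym list \<Rightarrow> bool" where
  "not_bit xs \<longleftrightarrow> xs \<noteq> [] \<and> (\<forall>b. hd xs \<noteq> Bit b)"

lemma not_bit_Cons [simp]: "not_bit (x # xs) \<longleftrightarrow> (\<forall>b. x \<noteq> Bit b)"
  by (simp add: not_bit_def)

text \<open>Every numeral in the encoding is followed by a symbol that is not a bit, which marks its
  end.\<close>

lemma enc_nat_cancel:
  assumes "enc_nat a @ xs = enc_nat b @ ys" "not_bit xs" "not_bit ys"
  shows "a = b \<and> xs = ys"
proof -
  have "map Bit as @ xs = map Bit bs @ ys \<Longrightarrow> as = bs \<and> xs = ys" for as bs
  proof (induction as arbitrary: bs)
    case Nil
    then show ?case using assms(2) by (cases bs) auto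
  next
    case (Cons c as)
    then show ?case using assms(3) by (cases bs) auto
  qed
  then have "bin a = bin b \<and> xs = ys" using assms(1) by (simp add: enc_nat_def)
  then show ?thesis by (metis num_bin)
qed

lemma enc_nat_hd: "\<exists>b xs. enc_nat a = Bit b # xs"
proof -
  have "bin a \<noteq> []" by (subst bin.simps) simp
  then show ?thesis by (cases "bin a") (auto simp: enc_nat_def)
qed

text \<open>A further predecessor begins with a bit and the end of the list is \<open>Close\<close>,
  so the first symbol decides.\<close>

lemma enc_preds_cancel:
  "concat (map (\<lambda>p. enc_nat p @ [Comma]) ps) @ Close # xs = concat (map (\<lambda>p. enc_nat p @ [Comma]) qs) @ Close # ys \<Longrightarrow>
     ps = qs \<and> xs = ys"
proof (induction ps arbitrary: qs)
  case Nil
  then show ?case using enc_nat_hd[of "hd qs"] by (cases qs) auto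
next
  case (Cons p ps)
  show ?case
  proof (cases qs)
    case Nil
    then show ?thesis using Cons.prems enc_nat_hd[of p] by auto
  next
    case q: (Cons q qs')
    then show ?thesis
      using Cons.prems Cons.IH[of qs'] enc_nat_cancel[of p "Comma # _" q "Comma # _"] by auto
  qed
qed

lemma enc_label_cancel:
  "enc_label l @ Comma # xs = enc_label l' @ Comma # ys \<Longrightarrow> l = l' \<and> xs = ys"
  by (cases l; cases l') (auto dest!: enc_nat_cancel)

lemma enc_gate_cancel: "enc_gate g @ xs = enc_gate g' @ ys \<Longrightarrow> g = g' \<and> xs = ys"
proof -
  assume eq: "enc_gate g @ xs = enc_gate g' @ ys"
  obtain n l ps n' l' ps' where g: "g = (n, l, ps)" "g' = (n', l', ps')" by (cases g; cases g')
  let ?X = "\<lambda>l ps xs. enc_label l @ Comma # Open # concat (map (\<lambda>p. enc_nat p @ [Comma]) ps) @ Close # Close # xs"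
  have "enc_nat n @ Comma # ?X l ps xs = enc_nat n' @ Comma # ?X l' ps' ys"
    using eq by (simp add: g)
  from enc_nat_cancel[OF this] have "n = n'" and 1: "?X l ps xs = ?X l' ps' ys" by simp_all
  from enc_label_cancel[OF 1] have "l = l'"
    and 2: "concat (map (\<lambda>p. enc_nat p @ [Comma]) ps) @ Close # Close # xs =
      concat (map (\<lambda>p. enc_nat p @ [Comma]) ps') @ Close # Close # ys" by simp_all
  from enc_preds_cancel[OF 2] show ?thesis using \<open>n = n'\<close> \<open>l = l'\<close> by (simp add: g)
qed

lemma enc_gate_hd: "\<exists>xs. enc_gate g = Open # xs"
  by (cases g) auto

text \<open>\<open>Open\<close> announces another gate, \<open>Comma\<close> the end of the
  list.\<close>

lemma enc_gates_cancel:
  "concat (map enc_gate gs) @ Comma # xs = concat (map enc_gate gs') @ Comma # ys \<Longrightarrow> gs = gs' \<and> xs = ys"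
proof (induction gs arbitrary: gs')
  case Nil
  then show ?case using enc_gate_hd[of "hd gs'"] by (cases gs') auto
next
  case (Cons g gs)
  show ?case
  proof (cases gs')
    case Nil
    then show ?thesis using Cons.prems enc_gate_hd[of g] by auto
  next
    case g': (Cons g' gs'')
    then show ?thesis using Cons.prems Cons.IH[of gs''] enc_gate_cancel[of g _ g'] by auto
  qed
qed

lemma fixed4_inj: "k < 16 \<Longrightarrow> l < 16 \<Longrightarrow> fixed4 k = fixed4 l \<Longrightarrow> k = l"
proof -
  have "distinct (map fixed4 [0..<16])" by code_simp
  then have "inj_on fixed4 {0..<16}" by (simp add: distinct_map)
  then show "k < 16 \<Longrightarrow> l < 16 \<Longrightarrow> fixed4 k = fixed4 l \<Longrightarrow> k = l" by (auto dest: inj_onD)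
qed

lemma symidx_less: "symidx s < 16"
proof -
  have "opidx a < 10" for a by (cases a) auto
  then show ?thesis by (cases s rule: symidx.cases) auto
qed

lemma symidx_inj: "symidx s = symidx s' \<Longrightarrow> s = s'"
proof -
  have op: "opidx a = opidx b \<Longrightarrow> a = b" for a b by (cases a; cases b) auto
  show "symidx s = symidx s' \<Longrightarrow> s = s'"
    by (cases s rule: symidx.cases; cases s' rule: symidx.cases) (auto dest: op)
qed

lemma enc_syms_inj: "enc_syms xs = enc_syms ys \<Longrightarrow> xs = ys"
proof (induction xs arbitrary: ys)
  case Nil
  then show ?case by (cases ys) (auto simp: enc_syms_def fixed4_def)
next
  case (Cons x xs)
  show ?case
  proof (cases ys)
    case Nil
    then show ?thesis using Cons.prems by (auto simp: enc_syms_def fixed4_def)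
  next
    case y: (Cons y ys')
    have "fixed4 (symidx x) @ enc_syms xs = fixed4 (symidx y) @ enc_syms ys'"
      using Cons.prems y by (simp add: enc_syms_def)
    then have "fixed4 (symidx x) = fixed4 (symidx y)" "enc_syms xs = enc_syms ys'"
      by (simp_all add: fixed4_def)
    then show ?thesis
      using fixed4_inj symidx_less symidx_inj Cons.IH y by blast
  qed
qed

lemma enc_instance_inj: "enc_instance C b = enc_instance C' b' \<Longrightarrow> C = C' \<and> b = b'"
proof -
  assume "enc_instance C b = enc_instance C' b'"
  then have eq: "[Open] @ enc_nat (fst C) @ [Comma] @ concat (map enc_gate (snd C)) @ [Comma] @ enc_nat b @ [Close] =
      [Open] @ enc_nat (fst C') @ [Comma] @ concat (map enc_gate (snd C')) @ [Comma] @ enc_nat b' @ [Close]"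
    unfolding enc_instance_def enc_syms_def[symmetric] by (rule enc_syms_inj)
  then have "enc_nat (fst C) @ Comma # concat (map enc_gate (snd C)) @ Comma # enc_nat b @ [Close] =
      enc_nat (fst C') @ Comma # concat (map enc_gate (snd C')) @ Comma # enc_nat b' @ [Close]"
    by simp
  from enc_nat_cancel[OF this]
  have 1: "fst C = fst C'" "concat (map enc_gate (snd C)) @ Comma # enc_nat b @ [Close] =
      concat (map enc_gate (snd C')) @ Comma # enc_nat b' @ [Close]"
    by simp_all
  from enc_gates_cancel[OF 1(2)] have "snd C = snd C'" "enc_nat b @ [Close] = enc_nat b' @ [Close]" by simp_all
  then show ?thesis
    using 1(1) enc_nat_cancel[of b "[Close]" b' "[Close]"] by (simp add: prod_eq_iff)
qed


section \<open>The tableau as a recurrence\<close>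

text \<open>The configuration of \<open>M\<close> as it is seen at one tape position \<open>x\<close>, with the input tape as tape \<open>0\<close>.
  A row is swept from high to low positions.  Besides the symbols and head markers at \<open>x\<close>, a site
  carries the action that led to the current row, the head markers of the previous row, and
  the symbols under those heads that the sweep has already met.\<close>

datatype site = Site (edge: bool) (syms: "nat list") (marks: "bool list") (ctrl: nat)
  (ops: "(nat \<times> int) list") (prev: "bool list") (seen: "nat list")

fun input_code :: "bool option \<Rightarrow> nat" where
  "input_code None = 0" | "input_code (Some False) = 1" | "input_code (Some True) = 2"

definition input_decode :: "nat \<Rightarrow> bool option" where
  "input_decode s = (if s = 0 then None else Some (s = 2))"

lemma input_decode_code [simp]: "input_decode (input_code x) = x"
  by (cases x rule: input_code.cases) (auto simp: input_decode_def)

text \<open>A halted machine rewrites the symbols it reads and does not move, so later rows repeat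
  the configuration. The input is treated as a tape on which the symbol read is written
  back.\<close>

definition action :: "tm \<Rightarrow> nat \<Rightarrow> nat list \<Rightarrow> nat \<times> (nat \<times> int) list" where
  "action M q rs = (if q = tm_acc M \<or> q = tm_rej M then (q, map (\<lambda>s. (s, 0)) rs)
     else case tm_delta M q (input_decode (hd rs)) (tl rs) of (q', d, os, ob) \<Rightarrow> (q', (hd rs, d) # os))"

definition all_heads :: "cfg \<Rightarrow> nat list" where
  "all_heads c = cfg_inpos c # cfg_heads c"

definition all_syms :: "bool list \<Rightarrow> cfg \<Rightarrow> nat \<Rightarrow> nat list" where
  "all_syms w c x = input_code (read_input w x) # map (\<lambda>T. T x) (fst (snd (snd c)))"

definition all_reads :: "tm \<Rightarrow> bool list \<Rightarrow> cfg \<Rightarrow> nat list" where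
  "all_reads M w c = map (\<lambda>j. all_syms w c (all_heads c ! j) ! j) [0..<Suc (tm_tapes M)]"

definition cfg_ok :: "tm \<Rightarrow> cfg \<Rightarrow> bool" where
  "cfg_ok M c \<longleftrightarrow> fst c < tm_states M \<and> length (fst (snd (snd c))) = tm_tapes M \<and>
     length (cfg_heads c) = tm_tapes M \<and> (\<forall>T\<in>set (fst (snd (snd c))). \<forall>x. T x < tm_syms M)"

lemma all_reads_eq:
  assumes "length ts = tm_tapes M" "length hs = tm_tapes M"
  shows "all_reads M w (q, i, ts, hs, out) = input_code (read_input w i) # map (\<lambda>(T, h). T h) (zip ts hs)"
  using assms
  by (auto simp: all_reads_def all_syms_def all_heads_def cfg_inpos_def cfg_heads_def nth_Cons'
      intro!: nth_equalityI simp del: upt_Suc)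

text \<open>The number 3 accounts for the codes of input cells.\<close>

definition sym_bound :: "tm \<Rightarrow> nat" where
  "sym_bound M = max 3 (tm_syms M)"

text \<open>Describes a step cell by cell and uniformly for all tapes, so that the tableau needs no
  separate treatment of the input tape.\<close>

lemma step_action:
  assumes M: "tm_wf M" and c: "cfg_ok M c" and act: "action M (fst c) (all_reads M w c) = (q', os)"
  shows "cfg_ok M (step M w c)" "fst (step M w c) = q'" "length os = Suc (tm_tapes M)"
    and "\<forall>(s, e)\<in>set os. s < sym_bound M \<and> e \<in> {-1, 0, 1}"
    and "j < Suc (tm_tapes M) \<Longrightarrow> all_heads (step M w c) ! j = mv (all_heads c ! j) (snd (os ! j))"
    and "j < Suc (tm_tapes M) \<Longrightarrow> all_syms w (step M w c) x ! j =
       (if all_heads c ! j = x then fst (os ! j) else all_syms w c x ! j)"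
proof -
  obtain q i ts hs out where c_eq: "c = (q, i, ts, hs, out)" by (metis prod_cases5)
  have len: "length ts = tm_tapes M" "length hs = tm_tapes M" and q: "q < tm_states M"
    and T: "\<And>T x. T \<in> set ts \<Longrightarrow> T x < tm_syms M"
    using c by (auto simp: cfg_ok_def c_eq cfg_heads_def)
  define rs where "rs = map (\<lambda>(T, h). T h) (zip ts hs)"
  have rs: "length rs = tm_tapes M" "set rs \<subseteq> {..<tm_syms M}"
    using len T by (auto simp: rs_def dest: set_zip_leftD)
  have reads: "all_reads M w c = input_code (read_input w i) # rs"
    unfolding c_eq rs_def by (rule all_reads_eq[OF len])
  have ic: "input_code x < 3" for x by (cases x rule: input_code.cases) auto
  have "cfg_ok M (step M w c) \<and> fst (step M w c) = q' \<and> length os = Suc (tm_tapes M) \<and>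
      (\<forall>(s, e)\<in>set os. s < sym_bound M \<and> e \<in> {-1, 0, 1}) \<and>
      (\<forall>j<Suc (tm_tapes M). all_heads (step M w c) ! j = mv (all_heads c ! j) (snd (os ! j)) \<and>
         (\<forall>x. all_syms w (step M w c) x ! j = (if all_heads c ! j = x then fst (os ! j) else all_syms w c x ! j)))"
  proof (cases "q = tm_acc M \<or> q = tm_rej M")
    case True
    then have st: "step M w c = c" by (auto simp: c_eq)
    have os: "q' = q" "os = map (\<lambda>s. (s, 0)) (all_reads M w c)"
      using act True by (auto simp: action_def c_eq)
    have read_tracks: "all_reads M w c ! j = all_syms w c (all_heads c ! j) ! j" if "j < Suc (tm_tapes M)" for j
      using that by (simp add: all_reads_def del: upt_Suc)
    have len_rd: "length (all_reads M w c) = Suc (tm_tapes M)" by (simp add: all_reads_def)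
    have "s < sym_bound M" if "s \<in> set (all_reads M w c)" for s
      using that rs(2) ic[of "read_input w i"] unfolding reads sym_bound_def by auto
    then show ?thesis
      unfolding st os using c len_rd read_tracks by (auto simp: nth_map c_eq)
  next
    case False
    obtain q'' d os' ob where \<delta>: "tm_delta M q (read_input w i) rs = (q'', d, os', ob)"
      by (metis prod_cases4)
    have wf: "q'' < tm_states M" "d \<in> {-1, 0, 1}" "length os' = tm_tapes M"
      "\<forall>(s, e)\<in>set os'. s < tm_syms M \<and> e \<in> {-1, 0, 1}"
    proof -
      have "case tm_delta M q (read_input w i) rs of (q', d, os, ob) \<Rightarrow>
           q' < tm_states M \<and> d \<in> {-1, 0, 1} \<and> length os = tm_tapes M \<and>
           (\<forall>(s, e)\<in>set os. s < tm_syms M \<and> e \<in> {-1, 0, 1})"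
        using conjunct2[OF conjunct2[OF conjunct2[OF conjunct2[OF conjunct2[OF M[unfolded tm_wf_def]]]]],
          THEN spec, THEN mp, OF q, THEN spec, THEN spec, THEN mp, OF conjI[OF rs]] .
      then show "q'' < tm_states M" "d \<in> {-1, 0, 1}" "length os' = tm_tapes M"
        "\<forall>(s, e)\<in>set os'. s < tm_syms M \<and> e \<in> {-1, 0, 1}"
        unfolding \<delta> by simp_all
    qed
    have os: "q' = q''" "os = (input_code (read_input w i), d) # os'"
      using act False \<delta> by (auto simp: action_def reads) (auto simp: c_eq)
    have st: "step M w c = (q'', mv i d, map (\<lambda>((t, h), (s, e)). t(h := s)) (zip (zip ts hs) os'),
       map (\<lambda>(h, (s, e)). mv h e) (zip hs os'), out @ (case ob of None \<Rightarrow> [] | Some b \<Rightarrow> [b]))"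
      using False \<delta> by (simp add: c_eq rs_def)
    have "cfg_ok M (step M w c)"
    proof -
      have "(if x = h then s else t x) < tm_syms M" if "((t, h), (s, e)) \<in> set (zip (zip ts hs) os')" for t h s e x
        using wf(4) T[OF set_zip_leftD[OF set_zip_leftD[OF that]]] set_zip_rightD[OF that] by auto
      then show ?thesis
        using len wf by (auto simp: st cfg_ok_def cfg_heads_def)
    qed
    moreover have "\<forall>(s, e)\<in>set os. s < sym_bound M \<and> e \<in> {-1, 0, 1}"
      using wf ic[of "read_input w i"] by (auto simp: os sym_bound_def)
    moreover have "all_heads (step M w c) ! j = mv (all_heads c ! j) (snd (os ! j)) \<and>
         all_syms w (step M w c) x ! j = (if all_heads c ! j = x then fst (os ! j) else all_syms w c x ! j)"
      if "j < Suc (tm_tapes M)" for j x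
      unfolding st using that len wf(3)
      by (cases j) (auto simp: os c_eq all_heads_def all_syms_def cfg_inpos_def cfg_heads_def case_prod_beta)
    ultimately show ?thesis using wf(3) by (simp add: st os)
  qed
  then show "cfg_ok M (step M w c)" "fst (step M w c) = q'" "length os = Suc (tm_tapes M)"
    "\<forall>(s, e)\<in>set os. s < sym_bound M \<and> e \<in> {-1, 0, 1}"
    "j < Suc (tm_tapes M) \<Longrightarrow> all_heads (step M w c) ! j = mv (all_heads c ! j) (snd (os ! j))"
    "j < Suc (tm_tapes M) \<Longrightarrow> all_syms w (step M w c) x ! j =
       (if all_heads c ! j = x then fst (os ! j) else all_syms w c x ! j)"
    by blast+
qed

text \<open>\<open>s1\<close>, \<open>s2\<close>, \<open>s3\<close> are the previous site of the sweep and the sites of the previous row at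
  positions \<open>x\<close> and \<open>x - 1\<close>; if \<open>s1\<close> has the edge flag, it is the end of the previous row.\<close>

definition next_action :: "tm \<Rightarrow> site \<Rightarrow> nat \<times> (nat \<times> int) list" where
  "next_action M s1 = (if edge s1 then action M (ctrl s1) (seen s1) else (ctrl s1, ops s1))"

definition next_syms :: "tm \<Rightarrow> site \<Rightarrow> site \<Rightarrow> nat list" where
  "next_syms M s1 s2 = map (\<lambda>j. if marks s2 ! j then fst (snd (next_action M s1) ! j) else syms s2 ! j) [0..<Suc (tm_tapes M)]"

text \<open>The disjuncts are the ways a head can arrive at \<open>x\<close>: it stays, where a left
  move at position 0 also counts because \<open>mv\<close> truncates; it comes from
  \<open>x + 1\<close>, as remembered in \<open>prev s1\<close>; or it comes from
  \<open>x - 1\<close>.\<close>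

definition next_marks :: "tm \<Rightarrow> site \<Rightarrow> site \<Rightarrow> site \<Rightarrow> bool list" where
  "next_marks M s1 s2 s3 = map (\<lambda>j. let e = snd (snd (next_action M s1) ! j) in
     marks s2 ! j \<and> (e = 0 \<or> e = -1 \<and> edge s2) \<or> \<not> edge s1 \<and> prev s1 ! j \<and> e = -1
     \<or> \<not> edge s2 \<and> marks s3 ! j \<and> e = 1) [0..<Suc (tm_tapes M)]"

definition next_site :: "tm \<Rightarrow> site \<Rightarrow> site \<Rightarrow> site \<Rightarrow> site" where
  "next_site M s1 s2 s3 = Site (edge s2) (next_syms M s1 s2) (next_marks M s1 s2 s3)
     (fst (next_action M s1)) (snd (next_action M s1)) (marks s2)
     (map (\<lambda>j. if next_marks M s1 s2 s3 ! j then next_syms M s1 s2 ! j else if edge s1 then 0 else seen s1 ! j) [0..<Suc (tm_tapes M)])"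

text \<open>No action leads to row 0; its entry is a default of the right length and range.\<close>

definition ops_at :: "tm \<Rightarrow> bool list \<Rightarrow> nat \<Rightarrow> (nat \<times> int) list" where
  "ops_at M w t = (case t of 0 \<Rightarrow> replicate (Suc (tm_tapes M)) (0, 0)
     | Suc t' \<Rightarrow> snd (action M (fst (run M w t')) (all_reads M w (run M w t'))))"

text \<open>At \<open>t = 0\<close> the subtraction \<open>t - 1\<close> truncates, so row 0 serves
  as its own predecessor. A head at or above \<open>x\<close> has been met by the sweep;
  \<open>0\<close> is the default for the others.\<close>

definition site :: "tm \<Rightarrow> bool list \<Rightarrow> nat \<Rightarrow> nat \<Rightarrow> site" where
  "site M w t x = Site (x = 0) (all_syms w (run M w t) x) (map (\<lambda>h. h = x) (all_heads (run M w t)))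
     (fst (run M w t)) (ops_at M w t) (map (\<lambda>h. h = x) (all_heads (run M w (t - 1))))
     (map (\<lambda>j. if x \<le> all_heads (run M w t) ! j then all_reads M w (run M w t) ! j else 0) [0..<Suc (tm_tapes M)])"

lemma run_Suc: "run M w (Suc t) = step M w (run M w t)"
  by (simp add: run_def)

lemma cfg_ok_run: "tm_wf M \<Longrightarrow> cfg_ok M (run M w t)"
proof (induction t)
  case 0
  then show ?case by (simp add: run_def init_cfg_def cfg_ok_def cfg_heads_def tm_wf_def)
next
  case (Suc t)
  then show ?case unfolding run_Suc using step_action(1)[of M "run M w t" w] by (metis surj_pair)
qed

lemma length_all: "cfg_ok M c \<Longrightarrow> length (all_heads c) = Suc (tm_tapes M)"
    "cfg_ok M c \<Longrightarrow> length (all_syms w c x) = Suc (tm_tapes M)"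
  by (simp_all add: cfg_ok_def all_heads_def all_syms_def)

text \<open>Heads start at 0 and advance by at most one cell per step; hence no head leaves a row of
  length \<open>D\<close> before time \<open>D\<close>.\<close>

lemma all_heads_le:
  assumes "tm_wf M" "j < Suc (tm_tapes M)"
  shows "all_heads (run M w t) ! j \<le> t"
proof (induction t)
  case 0
  then show ?case using assms(2)
    by (auto simp: run_def init_cfg_def all_heads_def cfg_inpos_def cfg_heads_def nth_Cons')
next
  case (Suc t)
  let ?c = "run M w t"
  obtain q os where act: "action M (fst ?c) (all_reads M w ?c) = (q, os)" by fastforce
  note st = step_action[OF assms(1) cfg_ok_run[OF assms(1)] act]
  have "os ! j \<in> set os" using st(3) assms(2) by simp
  then have "snd (os ! j) \<in> {-1, 0, 1}" using st(4) by (auto simp: case_prod_beta)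
  then show ?case
    unfolding run_Suc using st(5)[OF assms(2)] Suc by (auto simp: mv_def)
qed

text \<open>At the right end of a row, \<open>s1\<close> is position 0 of the previous row; there
  \<open>seen\<close> is the full list of symbols read and determines the action. Elsewhere the
  action is inherited. The bound on \<open>t\<close> keeps all heads inside the row, so none can
  arrive from position \<open>D\<close>.\<close>

lemma site_recurrence:
  assumes M: "tm_wf M" and x: "x < D" and t: "Suc t < D"
    and s1: "s1 = (if Suc x = D then site M w t 0 else site M w (Suc t) (Suc x))"
    and s3: "x \<noteq> 0 \<Longrightarrow> s3 = site M w t (x - 1)"
  shows "site M w (Suc t) x = next_site M s1 (site M w t x) s3"
proof -
  define c where "c = run M w t"
  define c' where "c' = run M w (Suc t)"
  obtain q os where act: "action M (fst c) (all_reads M w c) = (q, os)" by fastforce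
  have okc: "cfg_ok M c" and okc': "cfg_ok M c'" using cfg_ok_run[OF M] by (simp_all add: c_def c'_def)
  note st = step_action[OF M okc act]
  have c'_eq: "c' = step M w c" by (simp add: c_def c'_def run_Suc)
  have edge1: "edge s1 \<longleftrightarrow> Suc x = D" by (simp add: s1 site_def)
  have reads: "map (\<lambda>j. all_reads M w c ! j) [0..<Suc (tm_tapes M)] = all_reads M w c"
    by (rule nth_equalityI) (auto simp: all_reads_def simp del: upt_Suc)
  have ops': "ops_at M w (Suc t) = os" by (simp add: ops_at_def act flip: c_def)
  have na: "next_action M s1 = (q, os)"
  proof (cases "Suc x = D")
    case True
    then show ?thesis using reads act by (simp add: next_action_def s1 site_def c_def del: upt_Suc)
  next
    case False
    then show ?thesis using ops' st(2) by (simp add: next_action_def s1 site_def c'_eq[unfolded c'_def])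
  qed
  have s2: "edge (site M w t x) \<longleftrightarrow> x = 0" "syms (site M w t x) = all_syms w c x"
    "marks (site M w t x) = map (\<lambda>h. h = x) (all_heads c)"
    by (simp_all add: site_def c_def)
  have syms': "next_syms M s1 (site M w t x) = all_syms w c' x"
  proof (rule nth_equalityI)
    fix j assume "j < length (next_syms M s1 (site M w t x))"
    then have j: "j < Suc (tm_tapes M)" by (simp add: next_syms_def)
    show "next_syms M s1 (site M w t x) ! j = all_syms w c' x ! j"
      using j st(6)[OF j, of x] length_all(1)[OF okc]
      by (simp add: next_syms_def s2 na c'_eq del: upt_Suc)
  qed (use length_all[OF okc'] in \<open>simp add: next_syms_def\<close>)
  have marks': "next_marks M s1 (site M w t x) s3 = map (\<lambda>h. h = x) (all_heads c')"
  proof (rule nth_equalityI)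
    fix j assume "j < length (next_marks M s1 (site M w t x) s3)"
    then have j: "j < Suc (tm_tapes M)" by (simp add: next_marks_def)
    define h e where "h = all_heads c ! j" and "e = snd (os ! j)"
    have "os ! j \<in> set os" using st(3) j by simp
    then have e: "e = -1 \<or> e = 0 \<or> e = 1" using st(4) by (auto simp: case_prod_beta e_def)
    have h: "h \<le> t" using all_heads_le[OF M j, of w t] by (simp add: h_def c_def)
    have prev1: "prev s1 ! j \<longleftrightarrow> h = Suc x" if "Suc x \<noteq> D"
      using that j length_all(1)[OF okc] by (simp add: s1 site_def h_def c_def)
    have marks3: "marks s3 ! j \<longleftrightarrow> h = x - 1" if "x \<noteq> 0"
      using that j length_all(1)[OF okc] by (simp add: s3 site_def h_def c_def)
    have "next_marks M s1 (site M w t x) s3 ! j \<longleftrightarrow>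
        h = x \<and> (e = 0 \<or> e = -1 \<and> x = 0) \<or> Suc x \<noteq> D \<and> prev s1 ! j \<and> e = -1 \<or> x \<noteq> 0 \<and> marks s3 ! j \<and> e = 1"
      using j length_all(1)[OF okc] by (simp add: next_marks_def na s2 edge1 Let_def h_def e_def del: upt_Suc)
    also have "\<dots> \<longleftrightarrow> mv h e = x"
      using e h t x prev1 marks3 by (auto simp: mv_def)
    also have "mv h e = all_heads c' ! j"
      using st(5)[OF j] by (simp add: c'_eq h_def e_def)
    finally show "next_marks M s1 (site M w t x) s3 ! j = map (\<lambda>h. h = x) (all_heads c') ! j"
      using j length_all(1)[OF okc'] by simp
  qed (use length_all[OF okc'] in \<open>simp add: next_marks_def\<close>)
  have seen': "(if map (\<lambda>h. h = x) (all_heads c') ! j then all_syms w c' x ! j else if edge s1 then 0 else seen s1 ! j)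
      = (if x \<le> all_heads c' ! j then all_reads M w c' ! j else 0)" if j: "j < Suc (tm_tapes M)" for j
  proof -
    have h: "all_heads c' ! j < D" using all_heads_le[OF M j, of w "Suc t"] t by (simp add: c'_def)
    have "seen s1 ! j = (if Suc x \<le> all_heads c' ! j then all_reads M w c' ! j else 0)" if "Suc x \<noteq> D"
      using that j by (simp add: s1 site_def c'_def del: upt_Suc)
    moreover have "all_reads M w c' ! j = all_syms w c' (all_heads c' ! j) ! j"
      using j by (simp add: all_reads_def del: upt_Suc)
    ultimately show ?thesis
      using j h length_all(1)[OF okc'] by (auto simp: edge1)
  qed
  have "site M w (Suc t) x = Site (x = 0) (all_syms w c' x) (map (\<lambda>h. h = x) (all_heads c')) q os
     (map (\<lambda>h. h = x) (all_heads c))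
     (map (\<lambda>j. if x \<le> all_heads c' ! j then all_reads M w c' ! j else 0) [0..<Suc (tm_tapes M)])"
    using ops' st(2) by (simp add: site_def c'_def c_def run_Suc del: upt_Suc)
  also have "\<dots> = next_site M s1 (site M w t x) s3"
    unfolding next_site_def s2 syms' marks' na by (simp add: seen' del: upt_Suc cong: map_cong)
  finally show ?thesis .
qed

section \<open>Finiteness of the set of sites, and row 0\<close>

definition sites :: "tm \<Rightarrow> site set" where
  "sites M = (\<lambda>(b, ss, ms, q, os, ps, rs). Site b ss ms q os ps rs) `
     (UNIV \<times> {xs. set xs \<subseteq> {..<sym_bound M} \<and> length xs = Suc (tm_tapes M)}
       \<times> {xs. set xs \<subseteq> UNIV \<and> length xs = Suc (tm_tapes M)}
       \<times> {..<tm_states M}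
       \<times> {xs. set xs \<subseteq> {..<sym_bound M} \<times> {-1, 0, 1} \<and> length xs = Suc (tm_tapes M)}
       \<times> {xs. set xs \<subseteq> UNIV \<and> length xs = Suc (tm_tapes M)}
       \<times> {xs. set xs \<subseteq> {..<sym_bound M} \<and> length xs = Suc (tm_tapes M)})"

lemma finite_sites: "finite (sites M)"
  unfolding sites_def by (intro finite_imageI finite_cartesian_product finite_lists_length_eq) auto

lemma site_in_sites:
  assumes M: "tm_wf M"
  shows "site M w t x \<in> sites M"
proof -
  note ok = cfg_ok_run[OF M, of w]
  have bound: "set (all_syms w (run M w t) x) \<subseteq> {..<sym_bound M}" for t x
  proof -
    have "input_code b < 3" for b by (cases b rule: input_code.cases) auto
    then show ?thesis
      using ok[of t] by (auto simp: all_syms_def cfg_ok_def sym_bound_def less_max_iff_disj)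
  qed
  have "set (map (\<lambda>j. if x \<le> all_heads (run M w t) ! j then all_reads M w (run M w t) ! j else 0) [0..<Suc (tm_tapes M)])
      \<subseteq> {..<sym_bound M}"
  proof -
    have "all_reads M w (run M w t) ! j < sym_bound M" if "j < Suc (tm_tapes M)" for j
      using bound[of t "all_heads (run M w t) ! j"] length_all(2)[OF ok[of t], of w "all_heads (run M w t) ! j"] that
        nth_mem[of j "all_syms w (run M w t) (all_heads (run M w t) ! j)"]
      by (auto simp: all_reads_def simp del: upt_Suc nth_mem)
    then show ?thesis by (auto simp: sym_bound_def simp del: upt_Suc)
  qed
  moreover have "set (ops_at M w t) \<subseteq> {..<sym_bound M} \<times> {-1, 0, 1} \<and> length (ops_at M w t) = Suc (tm_tapes M)"
  proof (cases t)
    case 0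
    then show ?thesis by (auto simp: ops_at_def sym_bound_def)
  next
    case (Suc t')
    obtain q os where act: "action M (fst (run M w t')) (all_reads M w (run M w t')) = (q, os)" by fastforce
    show ?thesis
      using step_action(3,4)[OF M ok act] by (auto simp: Suc ops_at_def act)
  qed
  moreover have "fst (run M w t) < tm_states M" using ok by (simp add: cfg_ok_def)
  ultimately show ?thesis
    unfolding sites_def site_def using bound length_all[OF ok]
    by (intro image_eqI[where x = "(x = 0, all_syms w (run M w t) x, map (\<lambda>h. h = x) (all_heads (run M w t)),
     fst (run M w t), ops_at M w t, map (\<lambda>h. h = x) (all_heads (run M w (t - 1))),
     map (\<lambda>j. if x \<le> all_heads (run M w t) ! j then all_reads M w (run M w t) ! j else 0) [0..<Suc (tm_tapes M)])"])
      (auto simp del: upt_Suc)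
qed

definition init_site :: "tm \<Rightarrow> bool \<Rightarrow> bool option \<Rightarrow> site" where
  "init_site M b y = (let K = Suc (tm_tapes M); ss = input_code y # replicate (tm_tapes M) 0 in
     Site b ss (replicate K b) (tm_start M) (replicate K (0, 0)) (replicate K b) (if b then ss else replicate K 0))"

lemma site_0: "site M w 0 x = init_site M (x = 0) (read_input w x)"
proof -
  have reads: "all_reads M w (run M w 0) = input_code (read_input w 0) # replicate (tm_tapes M) 0"
    unfolding run_def init_cfg_def funpow_0 by (subst all_reads_eq) (auto intro!: nth_equalityI simp: nth_Cons')
  have heads: "all_heads (run M w 0) = replicate (Suc (tm_tapes M)) 0"
    by (simp add: run_def init_cfg_def all_heads_def cfg_inpos_def cfg_heads_def)
  have seen: "map (\<lambda>j. if x \<le> all_heads (run M w 0) ! j then all_reads M w (run M w 0) ! j else 0) [0..<Suc (tm_tapes M)]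
     = (if x = 0 then input_code (read_input w 0) # replicate (tm_tapes M) 0 else replicate (Suc (tm_tapes M)) 0)"
    unfolding heads reads by (rule nth_equalityI) (auto simp: nth_Cons' simp del: upt_Suc replicate_Suc)
  have marks: "map (\<lambda>h. h = x) (all_heads (run M w 0)) = replicate (Suc (tm_tapes M)) (x = 0)"
    unfolding heads by auto
  show ?thesis
    unfolding site_def diff_0_eq_0 seen marks
    by (auto simp: init_site_def Let_def ops_at_def all_syms_def run_def init_cfg_def read_input_def)
qed

section \<open>The reduction\<close>

definition conj_fm :: "fm list \<Rightarrow> fm" where
  "conj_fm ps = foldr An ps (Var (Const 2))"

lemma feval_conj: "feval \<rho> (conj_fm ps) \<longleftrightarrow> (\<forall>p\<in>set ps. feval \<rho> p) \<and> \<rho> (Const 2)"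
  by (induction ps) (auto simp: conj_fm_def)

lemma fvars_conj: "fvars (conj_fm ps) = insert (Const 2) (\<Union> (fvars ` set ps))"
  by (induction ps) (auto simp: conj_fm_def)

text \<open>If \<open>Ref k b\<close> says that the \<open>k\<close>-th argument of \<open>F\<close> has code \<open>b\<close>, then the value of \<open>F\<close>
  satisfies \<open>Q\<close> iff every tuple of codes whose value violates \<open>Q\<close> fails to match.\<close>

definition match_fm :: "nat \<Rightarrow> (nat \<Rightarrow> nat \<Rightarrow> nat \<Rightarrow> bool) \<Rightarrow> fm" where
  "match_fm N Q = conj_fm (map (\<lambda>(b1, b2, b3). Nt (An (Var (Ref 1 b1)) (An (Var (Ref 2 b2)) (Var (Ref 3 b3)))))
     (filter (\<lambda>(b1, b2, b3). \<not> Q b1 b2 b3) (List.product [0..<N] (List.product [0..<N] [0..<N]))))"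

lemma ball_filter_map: "(\<forall>p\<in>set (map f (filter R xs)). P p) \<longleftrightarrow> (\<forall>x\<in>set xs. R x \<longrightarrow> P (f x))"
  by auto

lemma feval_match_fm:
  assumes "\<And>k b. k \<in> {1, 2, 3} \<Longrightarrow> b < N \<Longrightarrow> \<rho> (Ref k b) \<longleftrightarrow> v k = b" "\<rho> (Const 2)"
    and "v 1 < N" "v 2 < N" "v 3 < N"
  shows "feval \<rho> (match_fm N Q) \<longleftrightarrow> Q (v 1) (v 2) (v 3)"
proof -
  have "feval \<rho> (match_fm N Q) \<longleftrightarrow> (\<forall>b1<N. \<forall>b2<N. \<forall>b3<N. \<not> Q b1 b2 b3 \<longrightarrow> \<not> (v 1 = b1 \<and> v 2 = b2 \<and> v 3 = b3))"
    unfolding match_fm_def feval_conj ball_filter_map using assms(1,2)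
    by (simp add: split_paired_Ball_Sigma Ball_def; blast)
  then show ?thesis using assms(3-) by blast
qed

lemma fvars_match_fm:
  "r \<in> fvars (match_fm N Q) \<Longrightarrow> r = Const 2 \<or> (\<exists>k b. r = Ref k b \<and> k \<in> {1, 2, 3} \<and> b < N)"
  by (auto simp: match_fm_def fvars_conj)

text \<open>\<open>c\<close> is below \<open>2 ^ (c + 1)\<close> and \<open>n + 1\<close> is below
  \<open>2 ^ L\<close>, which explains the exponent \<open>k + c + 1\<close>, later called
  \<open>e\<close>.\<close>

lemma two_power_dominates: "c * (n + 1) ^ k < (2 ^ L) ^ (k + c + 1)" if "n + 2 < 2 ^ L"
proof -
  have L: "(2::nat) \<le> 2 ^ L" using that by linarith
  have "c < 2 ^ (c + 1)" using less_exp[of "c + 1"] by linarith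
  also have "(2::nat) ^ (c + 1) \<le> (2 ^ L) ^ (c + 1)" using L by (rule power_mono) simp
  finally have "c < (2 ^ L) ^ (c + 1)" .
  then have "c * (n + 1) ^ k < (2 ^ L) ^ (c + 1) * (n + 1) ^ k" by (intro mult_strict_right_mono) auto
  also have "\<dots> \<le> (2 ^ L) ^ (c + 1) * (2 ^ L) ^ k" using that by (intro mult_left_mono power_mono) auto
  also have "\<dots> = (2 ^ L) ^ (k + c + 1)" by (simp add: power_add)
  finally show ?thesis .
qed

lemma halted_run: "T \<le> t \<Longrightarrow> halted M (run M w T) \<Longrightarrow> run M w t = run M w T"
proof (induction t rule: dec_induct)
  case (step t)
  have "step M w (run M w T) = run M w T"
    using step.prems by (cases "run M w T") (auto simp: halted_def)
  then show ?case using step by (simp add: run_Suc)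
qed simp

theorem in_P_reducible:
  assumes "in_P L"
  shows "logspace_reducible L (MC {Neg, Divide})"
proof -
  obtain M k c where M: "tm_wf M"
    and halt: "\<And>w. halted M (run M w (c * (length w + 1) ^ k))"
    and acc: "\<And>w. fst (run M w (c * (length w + 1) ^ k)) = tm_acc M \<longleftrightarrow> w \<in> L"
    using assms by (auto simp: in_P_def)
  define e where "e = k + c + 1"
  obtain code :: "site \<Rightarrow> nat" and N where code: "code ` sites M = {i. i < N}" "inj_on code (sites M)"
    using finite_imp_inj_to_nat_seg[OF finite_sites] by blast
  define dec where "dec = inv_into (sites M) code"
  have dec: "dec (code s) = s" if "s \<in> sites M" for s using that code(2) by (simp add: dec_def)
  have code_less: "code s < N" if "s \<in> sites M" for s using that code(1) by auto
  \<comment> \<open>Indices below \<open>N\<close> form the one-hot code of a site; the extra index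
    \<open>N\<close> tests for acceptance and provides the output gate.\<close>
  define Q where "Q = (\<lambda>i s. if i < N then code s = i else ctrl s = tm_acc M)"
  define mainf where "mainf = map (\<lambda>i. match_fm N (\<lambda>b1 b2 b3. Q i (next_site M (dec b1) (dec b2) (dec b3)))) [0..<Suc N]"
  define constf where "constf = (\<lambda>s. map (\<lambda>i. Var (Const (if Q i s then 2 else 1))) [0..<Suc N])"
  define firstf where "firstf = constf (init_site M True None)"
  define inif where "inif = (\<lambda>y. constf (init_site M False y))"
  \<comment> \<open>A constant formula has size 1, so the constant templates have
    \<open>2 * Suc N\<close> gates; \<open>W\<close> bounds every template length, and
    \<open>W < 2 ^ W\<close>.\<close>
  define W where "W = length (template mainf) + 2 * Suc N"
  have len: "length mainf = Suc N" "length firstf = Suc N" "\<And>y. length (inif y) = Suc N"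
    by (simp_all add: mainf_def firstf_def inif_def constf_def)
  have const_vars: "r \<in> {Const 1, Const 2}" if "p \<in> set (constf s)" "r \<in> fvars p" for p r s
    using that by (auto simp: constf_def simp del: upt_Suc split: if_splits)
  have main_vars: "r = Const 2 \<or> (\<exists>k b. r = Ref k b \<and> k \<in> {1, 2, 3} \<and> b < N)" if "p \<in> set mainf" "r \<in> fvars p" for p r
    using that fvars_match_fm by (auto simp: mainf_def simp del: upt_Suc)
  interpret emitter e W N mainf firstf inif
  proof
    show "Ref k s \<in> fvars p \<Longrightarrow> k < 4" if "p \<in> set mainf" for p k s
      using main_vars[OF that, of "Ref k s"] by auto
    show "Ref k s \<notin> fvars p" if "p \<in> set firstf" for p k s
      using const_vars[of p _ "Ref k s"] that by (auto simp: firstf_def)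
    show "Ref k s \<notin> fvars p" if "p \<in> set (inif x)" for p k s x
      using const_vars[of p _ "Ref k s"] that by (auto simp: inif_def)
  qed (simp add: e_def)
  have "w \<in> L \<longleftrightarrow> enc_instance (gate_name (nbits w) W 0 N,
     gate_groups.gates_from (nbits w) W (dist (row_len w)) (forms w) 0) 0 \<in> MC {Neg, Divide}" for w
  proof -
    define D where "D = row_len w"
    define U :: nat where "U = 2 ^ nbits w"
    define C where "C = (gate_name (nbits w) W 0 N, gate_groups.gates_from (nbits w) W (dist D) (forms w) 0)"
    have D: "4 \<le> D" "D < U" "U = D * D" "2 \<le> nbits w"
      using D_bounds[OF refl, of w] by (simp_all add: D_def U_def)
    have forms_eq: "forms w a = (if a < U - D then mainf else if a = U - D then firstf
        else inif (read_input w (a - (U - D))))" for a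
      by (simp add: forms_def U_def D_def)
    have len_forms: "length (forms w a) = Suc N" for a
      by (simp add: forms_eq len)
    have dist: "dist D 0 = 0" "dist D (Suc 0) = 1" "dist D 2 = D" "dist D 3 = D - 1"
      by (simp_all add: dist_def)
    interpret group_circuit "nbits w" W "dist D" "forms w"
    proof
      fix a :: nat and p r assume a: "a < 2 ^ nbits w" and p: "p \<in> set (forms w a)" and r: "r \<in> fvars p"
      show "case r of Const n \<Rightarrow> n \<in> {1, 2}
       | Ref k s \<Rightarrow> 0 < dist D k \<and> a + dist D k < 2 ^ nbits w \<and> s < length (forms w (a + dist D k))"
      proof (cases "a < U - D")
        case True
        then have "p \<in> set mainf" using p by (simp add: forms_eq)
        from main_vars[OF this r] show ?thesis
        proof (elim disjE exE conjE)
          fix k b assume kb: "r = Ref k b" "k \<in> {1, 2, 3}" "b < N"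
          have "0 < dist D k \<and> a + dist D k < U"
            using kb(2) True D(1) by (auto simp: dist)
          then show ?thesis using kb by (simp add: len_forms U_def)
        qed simp
      next
        case False
        then obtain s where "p \<in> set (constf s)"
          using p unfolding forms_eq unfolding firstf_def inif_def by (auto split: if_splits)
        from const_vars[OF this r] show ?thesis by auto
      qed
    next
      fix a :: nat assume "a < 2 ^ nbits w"
      have "length (template (constf s)) = 2 * Suc N" for s
        by (simp add: length_template constf_def comp_def sum_list_triv del: upt_Suc)
      then have "length (template (forms w a)) \<le> W"
        unfolding forms_eq by (simp add: firstf_def inif_def W_def)
      also have "W < 2 ^ W" by (rule less_exp)
      finally show "length (template (forms w a)) \<le> 2 ^ W" by simp
    qed (simp_all add: D dist)
    have divmod: "v div D = q" "v mod D = r" if "v = q * D + r" "r < D" for v q r :: nat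
      using that by simp_all
    \<comment> \<open>Inverts the numbering: \<open>U - 1 - a\<close> is the site number, its
      quotient by \<open>D\<close> the time and its remainder the distance from the right end of the
      row.\<close>
    define s where "s = (\<lambda>a. site M w ((U - 1 - a) div D) (D - 1 - (U - 1 - a) mod D))"
    have s_in: "s a \<in> sites M" for a by (simp add: s_def site_in_sites[OF M])
    have rec: "s a = next_site M (s (a + 1)) (s (a + D)) (s (a + (D - 1)))" if a: "a < U - D" for a
    proof -
      define u where "u = U - 1 - a"
      define t y where "t = u div D" and "y = u mod D"
      have u: "u = t * D + y" "y < D" using D(1) by (simp_all add: t_def y_def)
      have "D \<le> u" "u < D * D" using a D(2,3) by (auto simp: u_def)
      then have t: "0 < t" "t < D"
        unfolding t_def using D(1) by (auto simp: div_greater_zero_iff less_mult_imp_div_less)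
      then obtain t' where t': "t = Suc t'" by (cases t) auto
      have idx: "U - 1 - (a + j) = u - j" for j by (simp add: u_def)
      have sa: "s a = site M w (Suc t') (D - 1 - y)"
        using t' by (simp add: s_def t_def y_def u_def)
      have s2: "s (a + D) = site M w t' (D - 1 - y)"
      proof -
        have "u - D = t' * D + y" by (simp add: u t')
        then have "(u - D) div D = t'" "(u - D) mod D = y" by (rule divmod, use u(2) in simp)+
        then show ?thesis unfolding s_def idx by simp
      qed
      \<comment> \<open>For \<open>y = 0\<close> the preceding site is the last one of the previous
        row, at position 0.\<close>
      have s1: "s (a + 1) = (if Suc (D - 1 - y) = D then site M w t' 0 else site M w (Suc t') (Suc (D - 1 - y)))"
      proof (cases y)
        case 0
        have "u - 1 = t' * D + (D - 1)" using D(1) by (simp add: u t' 0)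
        then have "(u - 1) div D = t'" "(u - 1) mod D = D - 1" by (rule divmod, use D(1) in simp)+
        then show ?thesis unfolding s_def idx using D(1) 0 by simp
      next
        case (Suc y')
        have "u - 1 = t * D + y'" by (simp add: u Suc)
        then have "(u - 1) div D = t" "(u - 1) mod D = y'" by (rule divmod, use u(2) Suc in simp)+
        moreover have "D - Suc y' \<noteq> D" using D(1) by simp
        ultimately show ?thesis unfolding s_def idx using u(2) Suc t' by (simp add: Suc_diff_Suc)
      qed
      \<comment> \<open>Going back \<open>D - 1\<close> instead of \<open>D\<close> sites lands one
        tape position lower in the previous row, provided that \<open>y + 1 < D\<close>.\<close>
      have s3: "s (a + (D - 1)) = site M w t' (D - 1 - y - 1)" if "D - 1 - y \<noteq> 0"
      proof -
        have "u - (D - 1) = t' * D + Suc y" using D(1) by (simp add: u t')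
        then have "(u - (D - 1)) div D = t'" "(u - (D - 1)) mod D = Suc y" by (rule divmod, use that in simp)+
        then show ?thesis unfolding s_def idx by simp
      qed
      show ?thesis
        unfolding sa s2
        by (rule site_recurrence[OF M _ _ s1 s3]) (use u(2) t t' in auto)
    qed
    have init: "s a = init_site M (a = U - D) (read_input w (a - (U - D)))" if a: "U - D \<le> a" "a < U" for a
    proof -
      have "(U - 1 - a) div D = 0" "(U - 1 - a) mod D = U - 1 - a" using a D by auto
      moreover have "D - 1 - (U - 1 - a) = a - (U - D)" using a D(1,2) by auto
      moreover have "a - (U - D) = 0 \<longleftrightarrow> a = U - D" using a by auto
      ultimately show ?thesis unfolding s_def by (simp only: site_0)
    qed
    define P where "P = (\<lambda>a i. Q i (s a))"
    have P: "P a i \<longleftrightarrow> feval (\<lambda>r. case r of Const n \<Rightarrow> n = 2 | Ref k j \<Rightarrow> P (a + dist D k) j) (forms w a ! i)"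
      if a: "a < 2 ^ nbits w" and i: "i < length (forms w a)" for a i
    proof (cases "a < U - D")
      case True
      have i: "i < Suc N" using i by (simp add: len_forms)
      have "forms w a ! i = match_fm N (\<lambda>b1 b2 b3. Q i (next_site M (dec b1) (dec b2) (dec b3)))"
        unfolding forms_eq using True i by (simp add: mainf_def del: upt_Suc)
      moreover have "feval (\<lambda>r. case r of Const n \<Rightarrow> n = 2 | Ref k j \<Rightarrow> P (a + dist D k) j)
          (match_fm N (\<lambda>b1 b2 b3. Q i (next_site M (dec b1) (dec b2) (dec b3)))) \<longleftrightarrow>
        Q i (next_site M (dec (code (s (a + dist D 1)))) (dec (code (s (a + dist D 2)))) (dec (code (s (a + dist D 3)))))"
        by (rule feval_match_fm[where v = "\<lambda>k. code (s (a + dist D k))"])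
          (auto simp: P_def Q_def code_less s_in)
      ultimately show ?thesis using rec[OF True] by (simp add: P_def dec s_in dist)
    next
      case False
      then have "forms w a = constf (init_site M (a = U - D) (read_input w (a - (U - D))))"
        unfolding forms_eq by (auto simp: firstf_def inif_def read_input_def)
      then show ?thesis
        using i init[of a] False a by (simp add: P_def constf_def U_def del: upt_Suc)
    qed
    have N: "N < length (forms w 0)" by (simp add: len_forms)
    \<comment> \<open>Group 0 is site \<open>U - 1\<close>, which is time \<open>D - 1\<close> at
      position 0; its control field is the machine state at that time.\<close>
    have "(U - 1) div D = D - 1" "(U - 1) mod D = D - 1"
    proof -
      have "U - 1 = (D - 1) * D + (D - 1)" using D(1) by (simp add: D(3) algebra_simps)
      then show "(U - 1) div D = D - 1" "(U - 1) mod D = D - 1" by (rule divmod, use D(1) in simp)+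
    qed
    then have "P 0 N \<longleftrightarrow> fst (run M w (D - 1)) = tm_acc M"
      by (simp add: P_def Q_def s_def site_def)
    also have "run M w (D - 1) = run M w (c * (length w + 1) ^ k)"
    proof (rule halted_run[OF _ halt])
      have "D = (2 ^ ncells w) ^ (k + c + 1)"
        unfolding D_def row_len_def unfolding e_def power_mult[symmetric] by (simp only: mult.commute)
      then have "c * (length w + 1) ^ k < D"
        using two_power_dominates[OF ncells_bounds(1), of c w k] by simp
      then show "c * (length w + 1) ^ k \<le> D - 1" by simp
    qed
    finally have PL: "P 0 N \<longleftrightarrow> w \<in> L" using acc by simp
    have C: "is_circuit {Neg, Divide} C" "0 \<in> circuit_value C \<longleftrightarrow> w \<in> L"
      using circuit_correct[OF P N] PL by (simp_all add: C_def)
    have "enc_instance C 0 \<in> MC {Neg, Divide} \<longleftrightarrow> w \<in> L"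
      unfolding MC_def using C enc_instance_inj[of C 0] by blast
    then show ?thesis by (simp add: C_def D_def)
  qed
  then show ?thesis
    unfolding logspace_reducible_def using logspace_instance by blast
qed

theorem theorem8:
  shows "P_hard_logspace (MC {Neg, Divide})"
  unfolding P_hard_logspace_def using in_P_reducible by blast

end
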